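(* Let $V$ be a complex Banach space and let $T(V)$ be the tensor algebra over $V$. Then $\mathcal{HH}^n(T(V))=0$ for all $n\ge2$; $\mathcal{HH}^0(T(V))$ is the space of traces on $T(V)$; and $\mathcal{HH}^1(T(V))$ is isomorphic to the space of traces on $T(V)$ which vanish at $\mathbf 1\in T(V)$.
   Context: Tensor algebra: $T(V)=\ell^1\text{-}\bigoplus_{k=0}^\infty\hat\bigotimes^kV$, the $\ell^1$-direct sum of the completed projective tensor powers of $V$ with their usual norms, where $\hat\bigotimes^0V:=\mathbb C$ (its elements are written $\lambda\mathbf 1$, and $\mathbf 1$ is the unit). The product is the linear extension of the isometric isomorphisms $\hat\bigotimes^kV\,\hat\otimes\,\hat\bigotimes^lV\to\hat\bigotimes^{k+l}V$ given by concatenation $(v_1\otimes\cdots\otimes v_k)\otimes(w_1\otimes\cdots\otimes w_l)\mapsto v_1\otimes\cdots\otimes v_k\otimes w_1\otimes\cdots\otimes w_l$. Cohomology: for a Banach algebra $\mathcal A$ and $n\ge0$, $\mathcal C_n(\mathcal A,\mathcal A)=\mathcal A^{\hat\otimes(n+1)}$ is the $(n+1)$-fold completed projective tensor product, and $d^n:\mathcal C_{n+1}(\mathcal A,\mathcal A)\to\mathcal C_n(\mathcal A,\mathcal A)$ is the bounded linear map with $$d^n(a_1\otimes\cdots\otimes a_{n+2})=a_2\otimes\cdots\otimes a_{n+1}\otimes a_{n+2}a_1+\sum_{j=1}^{n+1}(-1)^j a_1\otimes\cdots\otimes a_ja_{j+1}\otimes\cdots\otimes a_{n+2}.$$ The space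 of $n$-cochains $\mathcal C^n(\mathcal A,\mathcal A')$ is the dual of $\mathcal C_n(\mathcal A,\mathcal A)$ (equivalently, bounded $n$-linear maps $T:\mathcal A^n\to\mathcal A'$ via $T(a_1\otimes\cdots\otimes a_{n+1})=T(a_1,\dots,a_n)(a_{n+1})$; in particular $\mathcal C^0=\mathcal A'$), with $\mathcal C^n=0$ for $n<0$, and $\delta^n:\mathcal C^n\to\mathcal C^{n+1}$ is the adjoint of $d^n$. The simplicial cohomology group is $\mathcal{HH}^n(\mathcal A)=\ker\delta^n/\operatorname{im}\delta^{n-1}$. A trace on a Banach algebra $\mathcal A$ is an element $\tau$ of the dual $\mathcal A'$ with $\tau(ab)=\tau(ba)$ for all $a,b\in\mathcal A$. *)

theory Defs
  imports "HOL-Analysis.Analysis" "HOL-Library.Poly_Mapping"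
begin

subsection \<open>Complex normed spaces and Banach algebras\<close>

class scaleC = scaleR +
  fixes scaleC :: "complex \<Rightarrow> 'a \<Rightarrow> 'a" (infixr "*\<^sub>C" 75)

class complex_normed_vector = scaleC + real_normed_vector +
  assumes scaleC_add_right: "a *\<^sub>C (x + y) = a *\<^sub>C x + a *\<^sub>C y"
    and scaleC_add_left: "(a + b) *\<^sub>C x = a *\<^sub>C x + b *\<^sub>C x"
    and scaleC_scaleC: "a *\<^sub>C b *\<^sub>C x = (a * b) *\<^sub>C x"
    and scaleR_scaleC: "r *\<^sub>R x = complex_of_real r *\<^sub>C x"
    and norm_scaleC: "norm (a *\<^sub>C x) = cmod a * norm x"

class complex_banach = complex_normed_vector + banach

class complex_normed_algebra = complex_normed_vector + real_normed_algebra +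
  assumes mult_scaleC_left: "(a *\<^sub>C x) * y = a *\<^sub>C (x * y)"
    and mult_scaleC_right: "x * (a *\<^sub>C y) = a *\<^sub>C (x * y)"

class complex_banach_algebra = complex_normed_algebra + complex_banach

instantiation complex :: complex_banach_algebra
begin
definition scaleC_complex :: "complex \<Rightarrow> complex \<Rightarrow> complex" where
  "scaleC_complex a x = a * x"
instance
  by standard (auto simp: scaleC_complex_def algebra_simps norm_mult scaleR_conv_of_real)
end

lemma scaleC_one [simp]: "1 *\<^sub>C (x :: 'a :: complex_normed_vector) = x"
  using scaleR_scaleC[of 1 x] by simp

lemma scaleC_minus1: "(-1) *\<^sub>C (x :: 'a :: complex_normed_vector) = - x"
  using scaleR_scaleC[of "-1" x] by simp

lemma scaleC_zero_left [simp]: "0 *\<^sub>C (x :: 'a :: complex_normed_vector) = 0"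
  using scaleR_scaleC[of 0 x] by simp

lemma scaleC_zero_right [simp]: "a *\<^sub>C (0 :: 'a :: complex_normed_vector) = 0"
  using scaleC_add_right[of a "0::'a" 0] by simp

lemma scaleC_diff_right: "a *\<^sub>C (x - y) = a *\<^sub>C x - a *\<^sub>C (y :: 'a :: complex_normed_vector)"
  using scaleC_add_right[of a "x - y" y] by (simp add: algebra_simps)

lemma bounded_linear_scaleC: "bounded_linear (\<lambda>x :: 'a :: complex_normed_vector. a *\<^sub>C x)"
  by (rule bounded_linear_intro[where K = "cmod a"])
     (auto simp: scaleC_add_right scaleR_scaleC scaleC_scaleC norm_scaleC mult.commute)

subsection \<open>The completion of a normed space\<close>

lemma Cauchy_const: "Cauchy (\<lambda>_. c :: 'a::real_normed_vector)"
  by (simp add: convergent_Cauchy convergent_const)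

definition cauchy_equiv :: "(nat \<Rightarrow> 'a::real_normed_vector) \<Rightarrow> (nat \<Rightarrow> 'a) \<Rightarrow> bool" where
  "cauchy_equiv x y \<longleftrightarrow> Cauchy x \<and> Cauchy y \<and> (\<lambda>n. x n - y n) \<longlonglongrightarrow> 0"

lemma part_equivp_cauchy_equiv: "part_equivp (cauchy_equiv :: (nat \<Rightarrow> 'a::real_normed_vector) \<Rightarrow> _)"
proof (rule part_equivpI)
  show "\<exists>x. cauchy_equiv x (x :: nat \<Rightarrow> 'a)"
    by (rule exI[of _ "\<lambda>_. 0"]) (auto simp: cauchy_equiv_def Cauchy_const)
  show "symp (cauchy_equiv :: (nat \<Rightarrow> 'a) \<Rightarrow> _)"
  proof (rule sympI)
    fix x y :: "nat \<Rightarrow> 'a" assume "cauchy_equiv x y"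
    then show "cauchy_equiv y x"
      using tendsto_minus[of "\<lambda>n. x n - y n" 0 sequentially] by (auto simp: cauchy_equiv_def)
  qed
  show "transp (cauchy_equiv :: (nat \<Rightarrow> 'a) \<Rightarrow> _)"
  proof (rule transpI)
    fix x y z :: "nat \<Rightarrow> 'a" assume "cauchy_equiv x y" "cauchy_equiv y z"
    then show "cauchy_equiv x z"
      using tendsto_add[of "\<lambda>n. x n - y n" 0 sequentially "\<lambda>n. y n - z n" 0]
      by (auto simp: cauchy_equiv_def)
  qed
qed

quotient_type (overloaded) 'a banach_completion = "nat \<Rightarrow> 'a::real_normed_vector" / partial: cauchy_equiv
  by (rule part_equivp_cauchy_equiv)

lemma Cauchy_add: "Cauchy x \<Longrightarrow> Cauchy y \<Longrightarrow> Cauchy (\<lambda>n. x n + y n :: 'a::real_normed_vector)"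
  unfolding Cauchy_iff
proof (intro allI impI)
  fix e :: real assume x: "\<forall>e>0. \<exists>M. \<forall>m\<ge>M. \<forall>n\<ge>M. norm (x m - x n) < e"
    and y: "\<forall>e>0. \<exists>M. \<forall>m\<ge>M. \<forall>n\<ge>M. norm (y m - y n) < e" and e: "e > 0"
  obtain M where M: "\<And>m n. m \<ge> M \<Longrightarrow> n \<ge> M \<Longrightarrow> norm (x m - x n) < e / 2"
    using x[rule_format, of "e / 2"] e by auto
  obtain N where N: "\<And>m n. m \<ge> N \<Longrightarrow> n \<ge> N \<Longrightarrow> norm (y m - y n) < e / 2"
    using y[rule_format, of "e / 2"] e by auto
  have "norm ((x m + y m) - (x n + y n)) < e" if "m \<ge> max M N" "n \<ge> max M N" for m n
  proof -
    have "norm ((x m + y m) - (x n + y n)) \<le> norm (x m - x n) + norm (y m - y n)"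
      by (rule norm_diff_triangle_ineq)
    then show ?thesis using M[of m n] N[of m n] that by auto
  qed
  then show "\<exists>M. \<forall>m\<ge>M. \<forall>n\<ge>M. norm (x m + y m - (x n + y n)) < e" by blast
qed

lemma Cauchy_bounded_linear: "bounded_linear f \<Longrightarrow> Cauchy x \<Longrightarrow> Cauchy (\<lambda>n. f (x n))"
  by (rule bounded_linear.Cauchy)

lemma Cauchy_diff: "Cauchy x \<Longrightarrow> Cauchy y \<Longrightarrow> Cauchy (\<lambda>n. x n - y n :: 'a::real_normed_vector)"
  using Cauchy_add[of x "\<lambda>n. - y n"]
    Cauchy_bounded_linear[OF bounded_linear_minus[OF bounded_linear_ident], of y] by simp

lemma Cauchy_mult_alg:
  fixes x y :: "nat \<Rightarrow> 'a::real_normed_algebra"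
  assumes "Cauchy x" "Cauchy y"
  shows "Cauchy (\<lambda>n. x n * y n)"
proof -
  obtain K where K: "\<And>n. norm (x n) \<le> K" "K > 0"
    using Cauchy_Bseq[OF assms(1)] by (auto simp: Bseq_def)
  obtain L where L: "\<And>n. norm (y n) \<le> L" "L > 0"
    using Cauchy_Bseq[OF assms(2)] by (auto simp: Bseq_def)
  show ?thesis
  proof (rule CauchyI)
    fix e :: real assume e: "e > 0"
    obtain M where M: "\<And>m n. m \<ge> M \<Longrightarrow> n \<ge> M \<Longrightarrow> norm (x m - x n) < e / (2 * L)"
      using CauchyD[OF assms(1), of "e / (2 * L)"] e L by auto
    obtain N where N: "\<And>m n. m \<ge> N \<Longrightarrow> n \<ge> N \<Longrightarrow> norm (y m - y n) < e / (2 * K)"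
      using CauchyD[OF assms(2), of "e / (2 * K)"] e K by auto
    have "norm (x m * y m - x n * y n) < e" if "m \<ge> max M N" "n \<ge> max M N" for m n
    proof -
      have "x m * y m - x n * y n = (x m - x n) * y m + x n * (y m - y n)"
        by (simp add: algebra_simps)
      then have "norm (x m * y m - x n * y n) \<le> norm (x m - x n) * norm (y m) + norm (x n) * norm (y m - y n)"
        by (simp only:) (intro norm_triangle_le add_mono norm_mult_ineq)
      also have "norm (x n) * norm (y m - y n) \<le> K * norm (y m - y n)"
        using K(1)[of n] by (intro mult_right_mono) auto
      also have "norm (x m - x n) * norm (y m) \<le> norm (x m - x n) * L"
        using L(1)[of m] by (intro mult_left_mono) auto
      also have "norm (x m - x n) * L < e / (2 * L) * L"
        using M[of m n] L(2) that by (intro mult_strict_right_mono) auto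
      also have "K * norm (y m - y n) < K * (e / (2 * K))"
        using N[of m n] K(2) that by (intro mult_strict_left_mono) auto
      finally show ?thesis using K(2) L(2) by simp
    qed
    then show "\<exists>M. \<forall>m\<ge>M. \<forall>n\<ge>M. norm (x m * y m - x n * y n) < e" by blast
  qed
qed

lemma cauchy_equiv_lincomb:
  assumes "bounded_linear f" "cauchy_equiv x y"
  shows "cauchy_equiv (\<lambda>n. f (x n)) (\<lambda>n. f (y n))"
proof -
  interpret bounded_linear f by fact
  from assms(2) show ?thesis using tendsto_zero[of "\<lambda>n. x n - y n"]
    by (auto simp: cauchy_equiv_def Cauchy diff)
qed

lemma cauchy_equiv_norm:
  assumes "cauchy_equiv x y"
  shows "lim (\<lambda>n. norm (x n)) = lim (\<lambda>n. norm (y n))" "(\<lambda>n. norm (x n)) \<longlonglongrightarrow> lim (\<lambda>n. norm (x n))"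
proof -
  have c: "convergent (\<lambda>n. norm (z n))" if "Cauchy z" for z :: "nat \<Rightarrow> 'a"
  proof -
    have "Cauchy (\<lambda>n. norm (z n))"
    proof (rule CauchyI)
      fix e :: real assume "e > 0"
      from CauchyD[OF that this] obtain M where "\<forall>m\<ge>M. \<forall>n\<ge>M. norm (z m - z n) < e" by blast
      then show "\<exists>M. \<forall>m\<ge>M. \<forall>n\<ge>M. norm (norm (z m) - norm (z n)) < e"
        by (auto intro: le_less_trans[OF norm_triangle_ineq3])
    qed
    then show ?thesis by (simp add: Cauchy_convergent_iff)
  qed
  from c assms have l: "(\<lambda>n. norm (x n)) \<longlonglongrightarrow> lim (\<lambda>n. norm (x n))" "(\<lambda>n. norm (y n)) \<longlonglongrightarrow> lim (\<lambda>n. norm (y n))"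
    by (auto simp: cauchy_equiv_def convergent_LIMSEQ_iff)
  then show "(\<lambda>n. norm (x n)) \<longlonglongrightarrow> lim (\<lambda>n. norm (x n))" by simp
  have "(\<lambda>n. norm (x n) - norm (y n)) \<longlonglongrightarrow> 0"
  proof (rule Lim_null_comparison)
    show "\<forall>\<^sub>F n in sequentially. norm (norm (x n) - norm (y n)) \<le> norm (x n - y n)"
      by (auto simp: norm_triangle_ineq3)
    show "(\<lambda>n. norm (x n - y n)) \<longlonglongrightarrow> 0"
      using assms by (auto simp: cauchy_equiv_def tendsto_norm_zero)
  qed
  from LIMSEQ_unique[OF tendsto_diff[OF l] this]
  show "lim (\<lambda>n. norm (x n)) = lim (\<lambda>n. norm (y n))" by simp
qed

instantiation banach_completion :: (real_normed_vector) real_vector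
begin

lift_definition zero_banach_completion :: "'a banach_completion" is "\<lambda>_. 0"
  by (simp add: cauchy_equiv_def Cauchy_const)

lift_definition plus_banach_completion :: "'a banach_completion \<Rightarrow> 'a banach_completion \<Rightarrow> 'a banach_completion"
  is "\<lambda>x y n. x n + y n"
proof -
  fix x x' y y' :: "nat \<Rightarrow> 'a"
  assume "cauchy_equiv x x'" "cauchy_equiv y y'"
  then show "cauchy_equiv (\<lambda>n. x n + y n) (\<lambda>n. x' n + y' n)"
    using tendsto_add[of "\<lambda>n. x n - x' n" 0 sequentially "\<lambda>n. y n - y' n" 0]
    by (auto simp: cauchy_equiv_def Cauchy_add algebra_simps)
qed

lift_definition uminus_banach_completion :: "'a banach_completion \<Rightarrow> 'a banach_completion" is "\<lambda>x n. - x n"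
  by (rule cauchy_equiv_lincomb) (auto intro: bounded_linear_minus bounded_linear_ident)

lift_definition minus_banach_completion :: "'a banach_completion \<Rightarrow> 'a banach_completion \<Rightarrow> 'a banach_completion"
  is "\<lambda>x y n. x n - y n"
proof -
  fix x x' y y' :: "nat \<Rightarrow> 'a"
  assume "cauchy_equiv x x'" "cauchy_equiv y y'"
  then show "cauchy_equiv (\<lambda>n. x n - y n) (\<lambda>n. x' n - y' n)"
    using tendsto_diff[of "\<lambda>n. x n - x' n" 0 sequentially "\<lambda>n. y n - y' n" 0]
      Cauchy_add[of x "\<lambda>n. - y n"] Cauchy_add[of x' "\<lambda>n. - y' n"]
      Cauchy_bounded_linear[OF bounded_linear_minus[OF bounded_linear_ident], of y]
      Cauchy_bounded_linear[OF bounded_linear_minus[OF bounded_linear_ident], of y']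
    by (auto simp: cauchy_equiv_def algebra_simps)
qed

lift_definition scaleR_banach_completion :: "real \<Rightarrow> 'a banach_completion \<Rightarrow> 'a banach_completion"
  is "\<lambda>r x n. r *\<^sub>R x n"
  by (rule cauchy_equiv_lincomb) (auto intro: bounded_linear_scaleR_right)

instance
proof
  fix x y z :: "'a banach_completion" and r s :: real
  show "x + y + z = x + (y + z)" by transfer (auto simp: cauchy_equiv_def algebra_simps intro!: Cauchy_add)
  show "x + y = y + x" by transfer (auto simp: cauchy_equiv_def algebra_simps intro!: Cauchy_add)
  show "0 + x = x" by transfer (auto simp: cauchy_equiv_def)
  show "- x + x = 0"
    by transfer (auto simp: cauchy_equiv_def convergent_Cauchy convergent_const)
  show "x - y = x + - y"
  proof transfer
    fix x y :: "nat \<Rightarrow> 'a"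
    assume "cauchy_equiv x x" "cauchy_equiv y y"
    then show "cauchy_equiv (\<lambda>n. x n - y n) (\<lambda>n. x n + - y n)"
      using Cauchy_add[of x "\<lambda>n. - y n"]
        Cauchy_bounded_linear[OF bounded_linear_minus[OF bounded_linear_ident], of y]
      by (auto simp: cauchy_equiv_def)
  qed
  show "r *\<^sub>R (x + y) = r *\<^sub>R x + r *\<^sub>R y"
    by transfer (auto simp: cauchy_equiv_def algebra_simps
        intro!: Cauchy_add Cauchy_bounded_linear[OF bounded_linear_scaleR_right])
  show "(r + s) *\<^sub>R x = r *\<^sub>R x + s *\<^sub>R x"
    by transfer (auto simp: cauchy_equiv_def algebra_simps
        intro!: Cauchy_add Cauchy_bounded_linear[OF bounded_linear_scaleR_right])
  show "r *\<^sub>R s *\<^sub>R x = (r * s) *\<^sub>R x"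
    by transfer (auto simp: cauchy_equiv_def
        intro!: Cauchy_bounded_linear[OF bounded_linear_scaleR_right])
  show "1 *\<^sub>R x = x" by transfer (auto simp: cauchy_equiv_def)
qed
end

instantiation banach_completion :: (real_normed_vector) real_normed_vector
begin

lift_definition norm_banach_completion :: "'a banach_completion \<Rightarrow> real" is "\<lambda>x. lim (\<lambda>n. norm (x n))"
  by (rule cauchy_equiv_norm)

definition dist_banach_completion :: "'a banach_completion \<Rightarrow> 'a banach_completion \<Rightarrow> real" where
  "dist_banach_completion x y = norm (x - y)"
definition sgn_banach_completion :: "'a banach_completion \<Rightarrow> 'a banach_completion" where
  "sgn_banach_completion x = scaleR (inverse (norm x)) x"
definition uniformity_banach_completion :: "('a banach_completion \<times> 'a banach_completion) filter" where
  "uniformity_banach_completion = (INF e\<in>{0 <..}. principal {(x, y). dist x y < e})"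
definition open_banach_completion :: "'a banach_completion set \<Rightarrow> bool" where
  "open_banach_completion U \<longleftrightarrow> (\<forall>x\<in>U. \<forall>\<^sub>F (x', y) in uniformity. x' = x \<longrightarrow> y \<in> U)"

instance
proof
  fix x y :: "'a banach_completion" and r :: real
  show "dist x y = norm (x - y)" by (rule dist_banach_completion_def)
  show "sgn x = x /\<^sub>R norm x" by (rule sgn_banach_completion_def)
  show "uniformity = (INF e\<in>{0<..}. principal {(x, y :: 'a banach_completion). dist x y < e})"
    by (rule uniformity_banach_completion_def)
  show "open U = (\<forall>x\<in>U. \<forall>\<^sub>F (x', y) in uniformity. x' = x \<longrightarrow> y \<in> U)"
    for U :: "'a banach_completion set" by (rule open_banach_completion_def)
  show "norm x = 0 \<longleftrightarrow> x = 0"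
  proof transfer
    fix x :: "nat \<Rightarrow> 'a" assume x: "cauchy_equiv x x"
    then have c: "Cauchy x" by (simp add: cauchy_equiv_def)
    show "lim (\<lambda>n. norm (x n)) = 0 \<longleftrightarrow> cauchy_equiv x (\<lambda>_. 0)"
    proof
      assume "lim (\<lambda>n. norm (x n)) = 0"
      with cauchy_equiv_norm(2)[OF x] have "(\<lambda>n. norm (x n)) \<longlonglongrightarrow> 0" by simp
      then have "x \<longlonglongrightarrow> 0" by (rule tendsto_norm_zero_cancel)
      with c show "cauchy_equiv x (\<lambda>_. 0)" by (simp add: cauchy_equiv_def Cauchy_const)
    next
      assume "cauchy_equiv x (\<lambda>_. 0)"
      then have "x \<longlonglongrightarrow> 0" by (simp add: cauchy_equiv_def)
      then show "lim (\<lambda>n. norm (x n)) = 0" by (intro limI tendsto_norm_zero)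
    qed
  qed
  show "norm (x + y) \<le> norm x + norm y"
  proof transfer
    fix x y :: "nat \<Rightarrow> 'a" assume x: "cauchy_equiv x x" and y: "cauchy_equiv y y"
    then have "cauchy_equiv (\<lambda>n. x n + y n) (\<lambda>n. x n + y n)"
      by (auto simp: cauchy_equiv_def Cauchy_add)
    from LIMSEQ_le[OF cauchy_equiv_norm(2)[OF this]
        tendsto_add[OF cauchy_equiv_norm(2)[OF x] cauchy_equiv_norm(2)[OF y]]]
    show "lim (\<lambda>n. norm (x n + y n)) \<le> lim (\<lambda>n. norm (x n)) + lim (\<lambda>n. norm (y n))"
      by (simp add: norm_triangle_ineq)
  qed
  show "norm (r *\<^sub>R x) = \<bar>r\<bar> * norm x"
    by transfer (simp add: limI[OF tendsto_mult_left[OF cauchy_equiv_norm(2)]])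
qed
end

lift_definition to_completion :: "'a::real_normed_vector \<Rightarrow> 'a banach_completion" is "\<lambda>x _. x"
  by (simp add: cauchy_equiv_def Cauchy_const)

lemma to_completion_add: "to_completion (x + y) = to_completion x + to_completion y"
  by transfer (auto simp: cauchy_equiv_def Cauchy_const)

lemma to_completion_diff: "to_completion (x - y) = to_completion x - to_completion y"
  by transfer (auto simp: cauchy_equiv_def Cauchy_const)

lemma to_completion_scaleR: "to_completion (r *\<^sub>R x) = r *\<^sub>R to_completion x"
  by transfer (auto simp: cauchy_equiv_def Cauchy_const)

lemma norm_to_completion [simp]: "norm (to_completion x) = norm x"
  by transfer simp

lemma bounded_linear_to_completion: "bounded_linear to_completion"
  by (rule bounded_linear_intro[where K = 1]) (auto simp: to_completion_add to_completion_scaleR)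

lemma to_completion_LIMSEQ:
  assumes "Cauchy x"
  shows "(\<lambda>n. to_completion (x n)) \<longlonglongrightarrow> abs_banach_completion x"
proof (rule LIMSEQ_I)
  fix e :: real assume e: "e > 0"
  obtain M where M: "\<And>m n. m \<ge> M \<Longrightarrow> n \<ge> M \<Longrightarrow> norm (x m - x n) < e / 2"
    using CauchyD[OF assms, of "e / 2"] e by auto
  have xx: "cauchy_equiv x x" using assms by (simp add: cauchy_equiv_def)
  have "norm (to_completion (x m) - abs_banach_completion x) \<le> e / 2" if "m \<ge> M" for m
  proof -
    have c: "cauchy_equiv (\<lambda>n. x m - x n) (\<lambda>n. x m - x n)"
      using Cauchy_diff[OF Cauchy_const assms] by (simp add: cauchy_equiv_def)
    have cm: "cauchy_equiv (\<lambda>_. x m) (\<lambda>_. x m)" by (simp add: cauchy_equiv_def Cauchy_const)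
    have "to_completion (x m) - abs_banach_completion x = abs_banach_completion (\<lambda>n. x m - x n)"
      by (simp add: to_completion.abs_eq minus_banach_completion.abs_eq cm xx)
    then have "norm (to_completion (x m) - abs_banach_completion x) = lim (\<lambda>n. norm (x m - x n))"
      by (simp add: norm_banach_completion.abs_eq c)
    also have "\<dots> \<le> e / 2"
      using M[OF that] by (intro LIMSEQ_le_const2[OF cauchy_equiv_norm(2)[OF c]]) (auto intro: less_imp_le)
    finally show ?thesis .
  qed
  then show "\<exists>no. \<forall>n\<ge>no. norm (to_completion (x n) - abs_banach_completion x) < e"
    using e by (intro exI[of _ M] allI impI) (smt (verit) field_sum_of_halves)
qed

lemma completion_dense:
  obtains x where "Cauchy x" "(\<lambda>n. to_completion (x n)) \<longlonglongrightarrow> X"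
proof -
  have "\<exists>x. cauchy_equiv x x \<and> abs_banach_completion x = X"
    by (rule exI[of _ "rep_banach_completion X"])
      (simp add: Quotient_abs_rep[OF Quotient_banach_completion] Quotient_rep_reflp[OF Quotient_banach_completion])
  then show ?thesis using that to_completion_LIMSEQ by (auto simp: cauchy_equiv_def)
qed

lemma completion_approx:
  assumes "e > 0" shows "\<exists>y. norm (X - to_completion y) < e"
proof -
  obtain x where "(\<lambda>n. to_completion (x n)) \<longlonglongrightarrow> X" using completion_dense by blast
  from LIMSEQ_D[OF this assms] obtain n where "norm (to_completion (x n) - X) < e" by blast
  then show ?thesis by (metis norm_minus_commute)
qed

instance banach_completion :: (real_normed_vector) banach
proof
  fix X :: "nat \<Rightarrow> 'a banach_completion" assume X: "Cauchy X"
  have "\<forall>n. \<exists>y. norm (X n - to_completion y) < 1 / Suc n"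
    by (auto intro!: completion_approx)
  from choice[OF this] obtain y where y: "\<And>n. norm (X n - to_completion (y n)) < 1 / Suc n" by blast
  have *: "(\<lambda>n. X n - to_completion (y n)) \<longlonglongrightarrow> 0"
  proof (rule Lim_null_comparison[OF _ LIMSEQ_inverse_real_of_nat])
    show "\<forall>\<^sub>F n in sequentially. norm (X n - to_completion (y n)) \<le> inverse (real (Suc n))"
      using y by (intro always_eventually allI less_imp_le) (simp only: inverse_eq_divide)
  qed
  have "Cauchy (\<lambda>n. - (X n - to_completion (y n)))"
    using tendsto_minus[OF *] by (intro convergent_Cauchy) (auto simp: convergent_def)
  from Cauchy_add[OF X this]
  have "Cauchy (\<lambda>n. to_completion (y n))" by simp
  then have "Cauchy y"
    unfolding Cauchy_iff to_completion_diff[symmetric] norm_to_completion .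
  from tendsto_add[OF * to_completion_LIMSEQ[OF this]] have "X \<longlonglongrightarrow> 0 + abs_banach_completion y"
    by simp
  then show "convergent X" by (rule convergentI)
qed

instantiation banach_completion :: (complex_normed_vector) complex_banach
begin
lift_definition scaleC_banach_completion :: "complex \<Rightarrow> 'a banach_completion \<Rightarrow> 'a banach_completion"
  is "\<lambda>r x n. r *\<^sub>C x n"
  by (rule cauchy_equiv_lincomb) (auto intro: bounded_linear_scaleC)
instance
proof
  fix x y :: "'a banach_completion" and a b :: complex and r :: real
  show "a *\<^sub>C (x + y) = a *\<^sub>C x + a *\<^sub>C y"
    by transfer (auto simp: cauchy_equiv_def scaleC_add_right
        intro!: Cauchy_add Cauchy_bounded_linear[OF bounded_linear_scaleC])
  show "(a + b) *\<^sub>C x = a *\<^sub>C x + b *\<^sub>C x"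
    by transfer (auto simp: cauchy_equiv_def scaleC_add_left
        intro!: Cauchy_add Cauchy_bounded_linear[OF bounded_linear_scaleC])
  show "a *\<^sub>C b *\<^sub>C x = (a * b) *\<^sub>C x"
    by transfer (auto simp: cauchy_equiv_def scaleC_scaleC
        intro!: Cauchy_bounded_linear[OF bounded_linear_scaleC])
  show "r *\<^sub>R x = complex_of_real r *\<^sub>C x"
    by transfer (auto simp: cauchy_equiv_def scaleR_scaleC
        intro!: Cauchy_bounded_linear[OF bounded_linear_scaleC])
  show "norm (a *\<^sub>C x) = cmod a * norm x"
    by transfer (simp add: norm_scaleC limI[OF tendsto_mult_left[OF cauchy_equiv_norm(2)]])
qed
end

lemma to_completion_scaleC: "to_completion (r *\<^sub>C x) = r *\<^sub>C to_completion x"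
  by transfer (auto simp: cauchy_equiv_def Cauchy_const)

instantiation banach_completion :: (real_normed_algebra) real_normed_algebra
begin
lift_definition times_banach_completion :: "'a banach_completion \<Rightarrow> 'a banach_completion \<Rightarrow> 'a banach_completion"
  is "\<lambda>x y n. x n * y n"
proof -
  fix x x' y y' :: "nat \<Rightarrow> 'a"
  assume a: "cauchy_equiv x x'" "cauchy_equiv y y'"
  from a have c: "Cauchy x" "Cauchy x'" "Cauchy y" "Cauchy y'"
    and z: "Zfun (\<lambda>n. x n - x' n) sequentially" "Zfun (\<lambda>n. y n - y' n) sequentially"
    by (simp_all add: cauchy_equiv_def tendsto_Zfun_iff)
  have "Zfun (\<lambda>n. (x n - x' n) * y n + x' n * (y n - y' n)) sequentially"
    by (intro Zfun_add bounded_bilinear.Zfun_prod_Bfun[OF bounded_bilinear_mult z(1) Cauchy_Bseq[OF c(3)]]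
        bounded_bilinear.Bfun_prod_Zfun[OF bounded_bilinear_mult Cauchy_Bseq[OF c(2)] z(2)])
  moreover have "(\<lambda>n. (x n - x' n) * y n + x' n * (y n - y' n)) = (\<lambda>n. x n * y n - x' n * y' n)"
    by (simp add: algebra_simps)
  ultimately show "cauchy_equiv (\<lambda>n. x n * y n) (\<lambda>n. x' n * y' n)"
    using c by (simp add: cauchy_equiv_def Cauchy_mult_alg tendsto_Zfun_iff)
qed
instance
proof
  fix x y z :: "'a banach_completion" and r :: real
  show "x * y * z = x * (y * z)"
    by transfer (auto simp: cauchy_equiv_def mult.assoc intro!: Cauchy_mult_alg)
  show "(x + y) * z = x * z + y * z"
    by transfer (auto simp: cauchy_equiv_def distrib_right intro!: Cauchy_mult_alg Cauchy_add)
  show "x * (y + z) = x * y + x * z"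
    by transfer (auto simp: cauchy_equiv_def distrib_left intro!: Cauchy_mult_alg Cauchy_add)
  show "(r *\<^sub>R x) * y = r *\<^sub>R (x * y)"
    by transfer (auto simp: cauchy_equiv_def intro!: Cauchy_mult_alg Cauchy_bounded_linear[OF bounded_linear_scaleR_right])
  show "x * (r *\<^sub>R y) = r *\<^sub>R (x * y)"
    by transfer (auto simp: cauchy_equiv_def intro!: Cauchy_mult_alg Cauchy_bounded_linear[OF bounded_linear_scaleR_right])
  show "norm (x * y) \<le> norm x * norm y"
  proof transfer
    fix x y :: "nat \<Rightarrow> 'a" assume x: "cauchy_equiv x x" and y: "cauchy_equiv y y"
    then have "cauchy_equiv (\<lambda>n. x n * y n) (\<lambda>n. x n * y n)"
      by (auto simp: cauchy_equiv_def Cauchy_mult_alg)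
    from LIMSEQ_le[OF cauchy_equiv_norm(2)[OF this]
        tendsto_mult[OF cauchy_equiv_norm(2)[OF x] cauchy_equiv_norm(2)[OF y]]]
    show "lim (\<lambda>n. norm (x n * y n)) \<le> lim (\<lambda>n. norm (x n)) * lim (\<lambda>n. norm (y n))"
      by (simp add: norm_mult_ineq)
  qed
qed
end

instantiation banach_completion :: (real_normed_algebra_1) real_normed_algebra_1
begin
lift_definition one_banach_completion :: "'a banach_completion" is "\<lambda>_. 1"
  by (simp add: cauchy_equiv_def Cauchy_const)
instance
proof
  fix x :: "'a banach_completion"
  show "1 * x = x" by transfer (auto simp: cauchy_equiv_def)
  show "x * 1 = x" by transfer (auto simp: cauchy_equiv_def)
  show "norm (1 :: 'a banach_completion) = 1" by transfer auto
  then show "(0 :: 'a banach_completion) \<noteq> 1" by (metis norm_zero zero_neq_one)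
qed
end

instance banach_completion :: (complex_normed_algebra) complex_banach_algebra
proof
  fix x y :: "'a banach_completion" and a :: complex
  show "(a *\<^sub>C x) * y = a *\<^sub>C (x * y)"
    by transfer (auto simp: cauchy_equiv_def mult_scaleC_left intro!: Cauchy_mult_alg Cauchy_bounded_linear[OF bounded_linear_scaleC])
  show "x * (a *\<^sub>C y) = a *\<^sub>C (x * y)"
    by transfer (auto simp: cauchy_equiv_def mult_scaleC_right intro!: Cauchy_mult_alg Cauchy_bounded_linear[OF bounded_linear_scaleC])
qed

lemma to_completion_mult: "to_completion (x * y) = to_completion x * to_completion y"
  by transfer (auto simp: cauchy_equiv_def Cauchy_const)

lemma to_completion_1: "to_completion 1 = 1"
  by transfer (auto simp: cauchy_equiv_def Cauchy_const)

subsection \<open>Algebraic tensor powers with the projective norm\<close>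

text \<open>With concatenation as addition, the library's convolution product turns the finitely supported
  functions on \<open>'v list\<close> into the free algebra on the set \<open>'v\<close>. A formal sum
  supported on lists of length \<open>k\<close> represents an element of the algebraic tensor power of degree
  \<open>k\<close>, the list \<open>[v1, ..., vk]\<close> standing for \<open>v1 \<otimes> ... \<otimes> vk\<close>.\<close>

instantiation list :: (type) monoid_add
begin
definition zero_list :: "'a list" where "zero_list = []"
definition plus_list :: "'a list \<Rightarrow> 'a list \<Rightarrow> 'a list" where "plus_list xs ys = xs @ ys"
instance by standard (auto simp: zero_list_def plus_list_def)
end

text \<open>The linear span of the relations that make \<open>v1 \<otimes> ... \<otimes> vk\<close> linear in each entry;
  the algebraic tensor powers are the quotients of the formal sums by this subspace.\<close>

inductive_set tensor_relations :: "('v::complex_normed_vector list \<Rightarrow>\<^sub>0 complex) set" where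
  zero: "0 \<in> tensor_relations"
| additive: "u \<in> tensor_relations \<Longrightarrow>
    u + (Poly_Mapping.single (xs @ (a + b) # ys) c
         - Poly_Mapping.single (xs @ a # ys) c - Poly_Mapping.single (xs @ b # ys) c) \<in> tensor_relations"
| homogeneous: "u \<in> tensor_relations \<Longrightarrow>
    u + (Poly_Mapping.single (xs @ (z *\<^sub>C a) # ys) c
         - Poly_Mapping.single (xs @ a # ys) (z * c)) \<in> tensor_relations"

definition formal_norm :: "('v::complex_normed_vector list \<Rightarrow>\<^sub>0 complex) \<Rightarrow> real" where
  "formal_norm u = (\<Sum>vs\<in>Poly_Mapping.keys u. cmod (Poly_Mapping.lookup u vs) * prod_list (map norm vs))"

text \<open>The infimum of \<open>\<Sum>i. \<bar>ci\<bar> * norm vi1 * ... * norm vik\<close> over all representations of the tensor.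
  All degrees are treated at once; the relations preserve the degree, and on a single tensor power
  this is the usual projective norm, see \<open>projective_norm_homogeneous\<close> below.\<close>

definition projective_norm :: "('v::complex_normed_vector list \<Rightarrow>\<^sub>0 complex) \<Rightarrow> real" where
  "projective_norm u = Inf {formal_norm w | w. u - w \<in> tensor_relations}"

abbreviation (input) fscale :: "complex \<Rightarrow> ('v list \<Rightarrow>\<^sub>0 complex) \<Rightarrow> ('v list \<Rightarrow>\<^sub>0 complex)" where
  "fscale c u \<equiv> Poly_Mapping.single 0 c * u"

lemma relations_add: "w \<in> tensor_relations \<Longrightarrow> u \<in> tensor_relations \<Longrightarrow> u + w \<in> tensor_relations"
  by (induction w rule: tensor_relations.induct)
     (auto simp flip: add.assoc intro: tensor_relations.intros)

lemma relations_sum: "(\<And>x. x \<in> A \<Longrightarrow> f x \<in> tensor_relations) \<Longrightarrow> sum f A \<in> tensor_relations"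
  by (induction A rule: infinite_finite_induct) (auto intro: relations_add tensor_relations.zero)

lemma relations_single_mult_left:
  "u \<in> tensor_relations \<Longrightarrow> Poly_Mapping.single vs d * u \<in> tensor_relations"
proof (induction u rule: tensor_relations.induct)
  case (additive u xs a b ys c)
  then show ?case
    using tensor_relations.additive[of "Poly_Mapping.single vs d * u" "vs @ xs" a b ys "d * c"]
    by (simp add: distrib_left right_diff_distrib mult_single plus_list_def)
next
  case (homogeneous u xs z a ys c)
  then show ?case
    using tensor_relations.homogeneous[of "Poly_Mapping.single vs d * u" "vs @ xs" z a ys "d * c"]
    by (simp add: distrib_left right_diff_distrib mult_single plus_list_def mult.left_commute)
qed (simp add: tensor_relations.zero)

lemma relations_single_mult_right:
  "u \<in> tensor_relations \<Longrightarrow> u * Poly_Mapping.single vs d \<in> tensor_relations"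
proof (induction u rule: tensor_relations.induct)
  case (additive u xs a b ys c)
  then show ?case
    using tensor_relations.additive[of "u * Poly_Mapping.single vs d" xs a b "ys @ vs" "c * d"]
    by (simp add: distrib_right left_diff_distrib mult_single plus_list_def)
next
  case (homogeneous u xs z a ys c)
  then show ?case
    using tensor_relations.homogeneous[of "u * Poly_Mapping.single vs d" xs z a "ys @ vs" "c * d"]
    by (simp add: distrib_right left_diff_distrib mult_single plus_list_def mult.assoc)
qed (simp add: tensor_relations.zero)

lemma sum_singles: "(u :: 'b \<Rightarrow>\<^sub>0 complex) = (\<Sum>vs\<in>Poly_Mapping.keys u. Poly_Mapping.single vs (Poly_Mapping.lookup u vs))"
proof (rule poly_mapping_eqI)
  fix k
  have "Poly_Mapping.lookup (\<Sum>vs\<in>Poly_Mapping.keys u. Poly_Mapping.single vs (Poly_Mapping.lookup u vs)) k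
      = (\<Sum>vs\<in>Poly_Mapping.keys u. if vs = k then Poly_Mapping.lookup u vs else 0)"
    by (simp add: lookup_sum lookup_single when_def)
  then show "Poly_Mapping.lookup u k = Poly_Mapping.lookup (\<Sum>vs\<in>Poly_Mapping.keys u. Poly_Mapping.single vs (Poly_Mapping.lookup u vs)) k"
    by (simp add: in_keys_iff)
qed

lemma single_zero_commute:
  fixes u :: "'b list \<Rightarrow>\<^sub>0 complex"
  shows "u * Poly_Mapping.single 0 c = Poly_Mapping.single 0 c * u"
proof -
  let ?U = "\<Sum>vs\<in>Poly_Mapping.keys u. Poly_Mapping.single vs (Poly_Mapping.lookup u vs)"
  have "?U * Poly_Mapping.single 0 c = Poly_Mapping.single 0 c * ?U"
    by (simp add: sum_distrib_left sum_distrib_right mult_single mult.commute)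
  then show ?thesis by (simp only: sum_singles[symmetric])
qed

lemma relations_mult_left: "u \<in> tensor_relations \<Longrightarrow> w * u \<in> tensor_relations"
  by (subst sum_singles[of w]) (simp add: sum_distrib_right relations_sum relations_single_mult_left)

lemma relations_mult_right: "u \<in> tensor_relations \<Longrightarrow> u * w \<in> tensor_relations"
  by (subst sum_singles[of w]) (simp add: sum_distrib_left relations_sum relations_single_mult_right)

lemma relations_minus: "u \<in> tensor_relations \<Longrightarrow> - u \<in> tensor_relations"
  using relations_mult_left[of u "-1"] by simp

lemma relations_diff: "u \<in> tensor_relations \<Longrightarrow> w \<in> tensor_relations \<Longrightarrow> u - w \<in> tensor_relations"
  using relations_add[OF relations_minus, of w u] by simp

lemma formal_norm_superset:
  assumes "finite S" "Poly_Mapping.keys u \<subseteq> S"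
  shows "formal_norm u = (\<Sum>vs\<in>S. cmod (Poly_Mapping.lookup u vs) * prod_list (map norm vs))"
  unfolding formal_norm_def
  by (rule sum.mono_neutral_left) (use assms in \<open>auto simp: in_keys_iff\<close>)

lemma prod_list_norm_nonneg [simp]: "0 \<le> prod_list (map norm (vs :: 'a::real_normed_vector list))"
  by (induction vs) auto

lemma formal_norm_nonneg [simp]: "0 \<le> formal_norm u"
  by (simp add: formal_norm_def sum_nonneg)

lemma formal_norm_single: "formal_norm (Poly_Mapping.single vs c) = cmod c * prod_list (map norm vs)"
  by (subst formal_norm_superset[of "{vs}"]) auto

lemma formal_norm_add: "formal_norm (u + w) \<le> formal_norm u + formal_norm w"
proof -
  let ?S = "Poly_Mapping.keys u \<union> Poly_Mapping.keys w"
  have "formal_norm (u + w) = (\<Sum>vs\<in>?S. cmod (Poly_Mapping.lookup u vs + Poly_Mapping.lookup w vs) * prod_list (map norm vs))"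
    using formal_norm_superset[of ?S "u + w"] keys_add[of u w] by (simp add: lookup_add)
  also have "\<dots> \<le> (\<Sum>vs\<in>?S. (cmod (Poly_Mapping.lookup u vs) + cmod (Poly_Mapping.lookup w vs)) * prod_list (map norm vs))"
    by (intro sum_mono mult_right_mono norm_triangle_ineq) auto
  also have "\<dots> = formal_norm u + formal_norm w"
    using formal_norm_superset[of ?S u] formal_norm_superset[of ?S w]
    by (simp add: distrib_right sum.distrib)
  finally show ?thesis .
qed

lemma formal_norm_0 [simp]: "formal_norm 0 = 0"
  by (simp add: formal_norm_def)

lemma formal_norm_sum: "formal_norm (sum f A) \<le> (\<Sum>x\<in>A. formal_norm (f x))"
proof (induction A rule: infinite_finite_induct)
  case (insert x A)
  then show ?case using formal_norm_add[of "f x" "sum f A"] by simp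
qed auto

lemma formal_norm_mult: "formal_norm (u * w) \<le> formal_norm u * formal_norm w"
proof -
  let ?s = "\<lambda>u vs. Poly_Mapping.single vs (Poly_Mapping.lookup u vs)"
  have "u * w = (\<Sum>xs\<in>Poly_Mapping.keys u. \<Sum>ys\<in>Poly_Mapping.keys w. ?s u xs * ?s w ys)"
    by (simp only: sum_product[symmetric] sum_singles[symmetric])
  then have "formal_norm (u * w) \<le> (\<Sum>xs\<in>Poly_Mapping.keys u. \<Sum>ys\<in>Poly_Mapping.keys w. formal_norm (?s u xs * ?s w ys))"
    by (auto intro!: order_trans[OF formal_norm_sum] sum_mono)
  also have "\<dots> = formal_norm u * formal_norm w"
    unfolding formal_norm_def[of u] formal_norm_def[of w] sum_product
    by (intro sum.cong refl) (simp add: mult_single formal_norm_single plus_list_def norm_mult)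
  finally show ?thesis .
qed

lemma projective_norm_set:
  "{formal_norm w | w. u - w \<in> tensor_relations} \<noteq> {}" "bdd_below {formal_norm w | w. u - w \<in> tensor_relations}"
  by (auto intro!: bdd_belowI[of _ 0] exI[of _ u] tensor_relations.zero)

lemma projective_norm_le: "u - w \<in> tensor_relations \<Longrightarrow> projective_norm u \<le> formal_norm w"
  unfolding projective_norm_def by (rule cInf_lower) (auto intro: projective_norm_set)

lemma projective_norm_less:
  assumes "projective_norm u < r" obtains w where "u - w \<in> tensor_relations" "formal_norm w < r"
  using cInf_lessD[OF projective_norm_set(1), of u r] assms unfolding projective_norm_def by auto

lemma projective_norm_nonneg [simp]: "0 \<le> projective_norm u"
  unfolding projective_norm_def by (rule cInf_greatest) (use projective_norm_set(1)[of u] in auto)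

lemma projective_norm_rel: "u \<in> tensor_relations \<Longrightarrow> projective_norm u = 0"
  using projective_norm_le[of u 0] by (simp add: antisym)

lemma projective_norm_add: "projective_norm (u + w) \<le> projective_norm u + projective_norm w"
proof (rule field_le_epsilon)
  fix e :: real assume e: "e > 0"
  obtain u' where u': "u - u' \<in> tensor_relations" "formal_norm u' < projective_norm u + e / 2"
    using projective_norm_less[of u "projective_norm u + e / 2"] e by auto
  obtain w' where w': "w - w' \<in> tensor_relations" "formal_norm w' < projective_norm w + e / 2"
    using projective_norm_less[of w "projective_norm w + e / 2"] e by auto
  have "(u + w) - (u' + w') \<in> tensor_relations"
    using relations_add[OF w'(1) u'(1)] by (simp add: algebra_simps)
  from projective_norm_le[OF this] formal_norm_add[of u' w'] u' w'
  show "projective_norm (u + w) \<le> projective_norm u + projective_norm w + e" by simp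
qed

lemma projective_norm_mult: "projective_norm (u * w) \<le> projective_norm u * projective_norm w"
proof -
  have *: "projective_norm (u * w) \<le> (projective_norm u + e) * (projective_norm w + e)" if e: "e > 0" for e
  proof -
    obtain u' where u': "u - u' \<in> tensor_relations" "formal_norm u' < projective_norm u + e"
      using projective_norm_less[of u "projective_norm u + e"] e by auto
    obtain w' where w': "w - w' \<in> tensor_relations" "formal_norm w' < projective_norm w + e"
      using projective_norm_less[of w "projective_norm w + e"] e by auto
    have "u * w - u' * w' = (u - u') * w + u' * (w - w')" by (simp add: algebra_simps)
    then have "u * w - u' * w' \<in> tensor_relations"
      using u'(1) w'(1) by (simp only: relations_add relations_mult_left relations_mult_right)
    from projective_norm_le[OF this] have "projective_norm (u * w) \<le> formal_norm (u' * w')" .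
    also have "\<dots> \<le> formal_norm u' * formal_norm w'" by (rule formal_norm_mult)
    also have "\<dots> \<le> (projective_norm u + e) * (projective_norm w + e)"
      using u' w' e by (intro mult_mono) auto
    finally show ?thesis .
  qed
  have "((\<lambda>e. (projective_norm u + e) * (projective_norm w + e)) \<longlongrightarrow> (projective_norm u + 0) * (projective_norm w + 0)) (at_right 0)"
    by (intro tendsto_intros)
  then have "projective_norm (u * w) \<le> (projective_norm u + 0) * (projective_norm w + 0)"
    by (rule tendsto_lowerbound) (auto simp: eventually_at_right_less intro!: eventually_at_rightI[of 0 1] *)
  then show ?thesis by simp
qed

lemma projective_norm_le_formal: "projective_norm u \<le> formal_norm u"
  by (rule projective_norm_le) (simp add: tensor_relations.zero)

lemma projective_norm_fscale:
  fixes u :: "'v::complex_normed_vector list \<Rightarrow>\<^sub>0 complex"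
  shows "projective_norm (fscale c u) = cmod c * projective_norm u"
proof -
  have *: "projective_norm (fscale c u) \<le> cmod c * projective_norm u"
    for c and u :: "'v list \<Rightarrow>\<^sub>0 complex"
  proof -
    have "projective_norm (Poly_Mapping.single 0 c :: 'v list \<Rightarrow>\<^sub>0 complex) \<le> cmod c"
      using projective_norm_le_formal[of "Poly_Mapping.single 0 c :: 'v list \<Rightarrow>\<^sub>0 complex"]
      by (simp add: formal_norm_single zero_list_def)
    from mult_right_mono[OF this projective_norm_nonneg[of u]]
    show ?thesis using projective_norm_mult[of "Poly_Mapping.single 0 c" u] by simp
  qed
  show ?thesis
  proof (cases "c = 0")
    case False
    have "projective_norm u = projective_norm (fscale (inverse c) (fscale c u))"
      using False by (simp add: mult_single flip: mult.assoc)
    also have "\<dots> \<le> inverse (cmod c) * projective_norm (fscale c u)"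
      using *[of "inverse c" "fscale c u"] by (simp add: norm_inverse)
    finally have "cmod c * projective_norm u \<le> projective_norm (fscale c u)"
      using False by (simp add: field_simps)
    with *[of c u] show ?thesis by simp
  qed (simp add: projective_norm_rel tensor_relations.zero)
qed

lemma projective_norm_minus: "projective_norm (- u) = projective_norm u"
  using projective_norm_fscale[of "-1" u] by (simp add: single_uminus)

definition multilinear :: "('v::complex_normed_vector list \<Rightarrow> 'w::complex_normed_vector) \<Rightarrow> bool" where
  "multilinear \<Phi> \<longleftrightarrow> (\<forall>xs ys a b z. \<Phi> (xs @ (a + b) # ys) = \<Phi> (xs @ a # ys) + \<Phi> (xs @ b # ys)
     \<and> \<Phi> (xs @ (z *\<^sub>C a) # ys) = z *\<^sub>C \<Phi> (xs @ a # ys))"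

definition formal_ext :: "('v list \<Rightarrow> 'w::complex_normed_vector) \<Rightarrow> ('v list \<Rightarrow>\<^sub>0 complex) \<Rightarrow> 'w" where
  "formal_ext \<Phi> u = (\<Sum>vs\<in>Poly_Mapping.keys u. Poly_Mapping.lookup u vs *\<^sub>C \<Phi> vs)"

lemma formal_ext_superset:
  assumes "finite S" "Poly_Mapping.keys u \<subseteq> S"
  shows "formal_ext \<Phi> u = (\<Sum>vs\<in>S. Poly_Mapping.lookup u vs *\<^sub>C \<Phi> vs)"
  unfolding formal_ext_def
  by (rule sum.mono_neutral_left) (use assms in \<open>auto simp: in_keys_iff\<close>)

lemma formal_ext_single: "formal_ext \<Phi> (Poly_Mapping.single vs c) = c *\<^sub>C \<Phi> vs"
  by (subst formal_ext_superset[of "{vs}"]) auto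

lemma formal_ext_add: "formal_ext \<Phi> (u + w) = formal_ext \<Phi> u + formal_ext \<Phi> w"
  using formal_ext_superset[of "Poly_Mapping.keys u \<union> Poly_Mapping.keys w" "u + w" \<Phi>] keys_add[of u w]
    formal_ext_superset[of "Poly_Mapping.keys u \<union> Poly_Mapping.keys w" u \<Phi>] formal_ext_superset[of "Poly_Mapping.keys u \<union> Poly_Mapping.keys w" w \<Phi>]
  by (simp add: lookup_add scaleC_add_left sum.distrib)

lemma formal_ext_0 [simp]: "formal_ext \<Phi> 0 = 0"
  by (simp add: formal_ext_def)

lemma formal_ext_diff: "formal_ext \<Phi> (u - w) = formal_ext \<Phi> u - formal_ext \<Phi> w"
  using formal_ext_add[of \<Phi> "u - w" w] by (simp add: algebra_simps)

lemma formal_ext_fscale: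
  fixes \<Phi> :: "'v list \<Rightarrow> 'w::complex_normed_vector"
  shows "formal_ext \<Phi> (fscale c u) = c *\<^sub>C formal_ext \<Phi> u"
proof -
  have s: "c *\<^sub>C sum f A = (\<Sum>x\<in>A. c *\<^sub>C f x)" for f :: "'v list \<Rightarrow> 'w" and A
    by (induction A rule: infinite_finite_induct) (auto simp: scaleC_add_right)
  have t: "formal_ext \<Phi> (sum f A) = (\<Sum>x\<in>A. formal_ext \<Phi> (f x))" for f :: "'v list \<Rightarrow> 'v list \<Rightarrow>\<^sub>0 complex" and A
    by (induction A rule: infinite_finite_induct) (auto simp: formal_ext_add)
  have "fscale c u = (\<Sum>vs\<in>Poly_Mapping.keys u. Poly_Mapping.single vs (c * Poly_Mapping.lookup u vs))"
    by (subst sum_singles[of u]) (simp add: sum_distrib_left mult_single)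
  then show ?thesis
    by (simp add: t s formal_ext_single formal_ext_def[of \<Phi> u] scaleC_scaleC)
qed

lemma formal_ext_relations:
  assumes "multilinear \<Phi>" "u \<in> tensor_relations" shows "formal_ext \<Phi> u = 0"
  using assms(2)
proof (induction u rule: tensor_relations.induct)
  case (additive u xs a b ys c)
  then show ?case using assms(1)
    by (simp add: formal_ext_add formal_ext_diff formal_ext_single multilinear_def scaleC_add_right)
next
  case (homogeneous u xs z a ys c)
  then show ?case using assms(1)
    by (simp add: formal_ext_add formal_ext_diff formal_ext_single multilinear_def scaleC_scaleC mult.commute)
qed simp

lemma norm_formal_ext_le:
  assumes \<Phi>: "multilinear \<Phi>" and C: "C \<ge> 0" "\<And>vs. norm (\<Phi> vs) \<le> C * prod_list (map norm vs)"
  shows "norm (formal_ext \<Phi> u) \<le> C * projective_norm u"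
proof -
  have 1: "norm (formal_ext \<Phi> w) \<le> C * formal_norm w" for w
  proof -
    have "norm (formal_ext \<Phi> w) \<le> (\<Sum>vs\<in>Poly_Mapping.keys w. cmod (Poly_Mapping.lookup w vs) * (C * prod_list (map norm vs)))"
      unfolding formal_ext_def
      by (auto intro!: sum_norm_le mult_left_mono C(2) simp: norm_scaleC)
    also have "\<dots> = C * formal_norm w"
      by (simp add: formal_norm_def sum_distrib_left mult_ac)
    finally show ?thesis .
  qed
  have 2: "norm (formal_ext \<Phi> u) \<le> C * formal_norm w" if "u - w \<in> tensor_relations" for w
    using formal_ext_relations[OF \<Phi> that] 1[of w] by (simp add: formal_ext_diff)
  have "norm (formal_ext \<Phi> u) \<le> C * projective_norm u + e" if "e > 0" for e
  proof -
    have "e / (C + 1) > 0" using that C by simp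
    then obtain w where w: "u - w \<in> tensor_relations" "formal_norm w < projective_norm u + e / (C + 1)"
      using projective_norm_less[of u "projective_norm u + e / (C + 1)"] by auto
    from 2[OF w(1)] have "norm (formal_ext \<Phi> u) \<le> C * (projective_norm u + e / (C + 1))"
      using mult_left_mono[OF less_imp_le[OF w(2)] C(1)] by simp
    also have "\<dots> \<le> C * projective_norm u + e"
      using C that by (simp add: field_simps)
    finally show ?thesis .
  qed
  then show ?thesis by (rule field_le_epsilon)
qed

lemma projective_norm_one: "projective_norm 1 = 1"
proof (rule antisym)
  have 1: "formal_norm (1 :: 'a list \<Rightarrow>\<^sub>0 complex) = 1"
    using formal_norm_single[of "0 :: 'a list" 1, unfolded single_one] by (simp add: zero_list_def)
  then show "projective_norm (1 :: 'a list \<Rightarrow>\<^sub>0 complex) \<le> 1"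
    using projective_norm_le_formal[of "1 :: 'a list \<Rightarrow>\<^sub>0 complex"] by simp
  let ?\<Phi> = "\<lambda>vs :: 'a list. if vs = [] then 1 else 0 :: complex"
  have m: "multilinear ?\<Phi>" by (auto simp: multilinear_def)
  have "formal_ext ?\<Phi> 1 = 1"
    using formal_ext_single[of ?\<Phi> 0 1, unfolded single_one] by (simp add: zero_list_def)
  moreover have "norm (formal_ext ?\<Phi> 1) \<le> 1 * projective_norm (1 :: 'a list \<Rightarrow>\<^sub>0 complex)"
    by (rule norm_formal_ext_le[OF m]) auto
  ultimately show "1 \<le> projective_norm (1 :: 'a list \<Rightarrow>\<^sub>0 complex)" by simp
qed

lemma equivp_tensor:
  "equivp (\<lambda>u w :: 'v::complex_normed_vector list \<Rightarrow>\<^sub>0 complex. projective_norm (u - w) = 0)"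
proof (rule equivpI)
  show "reflp (\<lambda>u w :: 'v list \<Rightarrow>\<^sub>0 complex. projective_norm (u - w) = 0)"
    by (auto intro!: reflpI projective_norm_rel tensor_relations.zero)
  show "symp (\<lambda>u w :: 'v list \<Rightarrow>\<^sub>0 complex. projective_norm (u - w) = 0)"
  proof (rule sympI)
    fix u w :: "'v list \<Rightarrow>\<^sub>0 complex"
    assume "projective_norm (u - w) = 0"
    then show "projective_norm (w - u) = 0" using projective_norm_minus[of "u - w"] by simp
  qed
  show "transp (\<lambda>u w :: 'v list \<Rightarrow>\<^sub>0 complex. projective_norm (u - w) = 0)"
  proof (rule transpI)
    fix u w v :: "'v list \<Rightarrow>\<^sub>0 complex"
    assume "projective_norm (u - w) = 0" "projective_norm (w - v) = 0"
    then show "projective_norm (u - v) = 0"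
      using projective_norm_add[of "u - w" "w - v"] projective_norm_nonneg[of "u - v"] by simp
  qed
qed

text \<open>The projective norm is a norm on the algebraic tensor powers, so this is the quotient by
  \<open>tensor_relations\<close>. Dividing by the null space instead makes the Hahn-Banach theorem unnecessary
  here; the completion below would identify these elements anyway.\<close>

quotient_type (overloaded) 'v alg_tensor = "'v::complex_normed_vector list \<Rightarrow>\<^sub>0 complex"
  / "\<lambda>u w. projective_norm (u - w) = 0"
  by (rule equivp_tensor)

lemma projective_norm_zero_add:
  "projective_norm u = 0 \<Longrightarrow> projective_norm w = 0 \<Longrightarrow> projective_norm (u + w) = 0"
  using projective_norm_add[of u w] projective_norm_nonneg[of "u + w"] by simp

lemma projective_norm_zero_mult:
  "projective_norm u = 0 \<or> projective_norm w = 0 \<Longrightarrow> projective_norm (u * w) = 0"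
  using projective_norm_mult[of u w] projective_norm_nonneg[of "u * w"] by (auto intro: antisym)

lemma projective_norm_zero [simp]: "projective_norm 0 = 0"
  by (simp add: projective_norm_rel tensor_relations.zero)

lemma projective_norm_cong:
  assumes "projective_norm (u - w) = 0" shows "projective_norm u = projective_norm w"
proof -
  have "projective_norm u \<le> projective_norm (u - w) + projective_norm w"
    using projective_norm_add[of "u - w" w] by simp
  moreover have "projective_norm w \<le> projective_norm (w - u) + projective_norm u"
    using projective_norm_add[of "w - u" u] by simp
  moreover have "projective_norm (w - u) = 0" using assms projective_norm_minus[of "u - w"] by simp
  ultimately show ?thesis using assms by simp
qed

instantiation alg_tensor :: (complex_normed_vector) "{scaleC, ring_1}"
begin
lift_definition zero_alg_tensor :: "'a alg_tensor" is 0 .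
lift_definition one_alg_tensor :: "'a alg_tensor" is 1 .
lift_definition plus_alg_tensor :: "'a alg_tensor \<Rightarrow> 'a alg_tensor \<Rightarrow> 'a alg_tensor" is "(+)"
  by (drule (1) projective_norm_zero_add) (simp add: algebra_simps)
lift_definition uminus_alg_tensor :: "'a alg_tensor \<Rightarrow> 'a alg_tensor" is "\<lambda>u. - u"
proof -
  fix u w :: "'a list \<Rightarrow>\<^sub>0 complex"
  assume "projective_norm (u - w) = 0"
  then show "projective_norm (- u - - w) = 0"
    using projective_norm_minus[of "u - w"] by simp
qed
lift_definition minus_alg_tensor :: "'a alg_tensor \<Rightarrow> 'a alg_tensor \<Rightarrow> 'a alg_tensor" is "(-)"
proof -
  fix u u' w w' :: "'a list \<Rightarrow>\<^sub>0 complex"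
  assume "projective_norm (u - u') = 0" "projective_norm (w - w') = 0"
  then show "projective_norm (u - w - (u' - w')) = 0"
    using projective_norm_zero_add[of "u - u'" "- (w - w')"] projective_norm_minus[of "w - w'"]
    by (simp add: algebra_simps)
qed
lift_definition times_alg_tensor :: "'a alg_tensor \<Rightarrow> 'a alg_tensor \<Rightarrow> 'a alg_tensor" is "(*)"
proof -
  fix u u' w w' :: "'a list \<Rightarrow>\<^sub>0 complex"
  assume "projective_norm (u - u') = 0" "projective_norm (w - w') = 0"
  then have "projective_norm ((u - u') * w + u' * (w - w')) = 0"
    by (intro projective_norm_zero_add projective_norm_zero_mult) auto
  then show "projective_norm (u * w - u' * w') = 0" by (simp add: algebra_simps)
qed
lift_definition scaleC_alg_tensor :: "complex \<Rightarrow> 'a alg_tensor \<Rightarrow> 'a alg_tensor"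
  is "\<lambda>c u. Poly_Mapping.single 0 c * u"
  by (simp add: projective_norm_fscale flip: right_diff_distrib)
lift_definition scaleR_alg_tensor :: "real \<Rightarrow> 'a alg_tensor \<Rightarrow> 'a alg_tensor"
  is "\<lambda>r u. Poly_Mapping.single 0 (complex_of_real r) * u"
  by (simp add: projective_norm_fscale flip: right_diff_distrib)
instance
proof
  fix x y z :: "'a alg_tensor"
  show "(0 :: 'a alg_tensor) \<noteq> 1"
    by transfer (simp add: projective_norm_minus projective_norm_one)
  show "x + y + z = x + (y + z)" by transfer (simp add: add.assoc)
  show "x + y = y + x" by transfer (simp add: add.commute)
  show "0 + x = x" by transfer simp
  show "- x + x = 0" by transfer simp
  show "x - y = x + - y" by transfer simp
  show "x * y * z = x * (y * z)" by transfer (simp add: mult.assoc)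
  show "1 * x = x" by transfer simp
  show "x * 1 = x" by transfer simp
  show "(x + y) * z = x * z + y * z" by transfer (simp add: distrib_right)
  show "x * (y + z) = x * y + x * z" by transfer (simp add: distrib_left)
qed
end

instantiation alg_tensor :: (complex_normed_vector) real_algebra_1
begin
instance
proof
  fix u w :: "'a alg_tensor" and r s :: real
  show "r *\<^sub>R (u + w) = r *\<^sub>R u + r *\<^sub>R w" by transfer (simp add: algebra_simps)
  show "(r + s) *\<^sub>R u = r *\<^sub>R u + s *\<^sub>R u" by transfer (simp add: single_add algebra_simps)
  show "r *\<^sub>R s *\<^sub>R u = (r * s) *\<^sub>R u" by transfer (simp add: mult_single flip: mult.assoc)
  show "1 *\<^sub>R u = u" by transfer simp
  show "(r *\<^sub>R u) * w = r *\<^sub>R (u * w)" by transfer (simp add: mult.assoc)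
  show "u * (r *\<^sub>R w) = r *\<^sub>R (u * w)"
  proof transfer
    fix r :: real and u w :: "'a list \<Rightarrow>\<^sub>0 complex"
    show "projective_norm (u * (Poly_Mapping.single 0 (complex_of_real r) * w)
        - Poly_Mapping.single 0 (complex_of_real r) * (u * w)) = 0"
      using single_zero_commute[of u] by (simp flip: mult.assoc)
  qed
qed
end

instantiation alg_tensor :: (complex_normed_vector) "{complex_normed_algebra, real_normed_algebra_1}"
begin
lift_definition norm_alg_tensor :: "'a alg_tensor \<Rightarrow> real" is projective_norm
  by (rule projective_norm_cong)
definition dist_alg_tensor :: "'a alg_tensor \<Rightarrow> 'a alg_tensor \<Rightarrow> real" where
  "dist_alg_tensor x y = norm (x - y)"
definition sgn_alg_tensor :: "'a alg_tensor \<Rightarrow> 'a alg_tensor" where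
  "sgn_alg_tensor x = x /\<^sub>R norm x"
definition uniformity_alg_tensor :: "('a alg_tensor \<times> 'a alg_tensor) filter" where
  "uniformity_alg_tensor = (INF e\<in>{0 <..}. principal {(x, y). dist x y < e})"
definition open_alg_tensor :: "'a alg_tensor set \<Rightarrow> bool" where
  "open_alg_tensor U \<longleftrightarrow> (\<forall>x\<in>U. \<forall>\<^sub>F (x', y) in uniformity. x' = x \<longrightarrow> y \<in> U)"
instance
proof
  fix u w :: "'a alg_tensor" and r :: real and a b :: complex
  show "dist u w = norm (u - w)" by (rule dist_alg_tensor_def)
  show "sgn u = u /\<^sub>R norm u" by (rule sgn_alg_tensor_def)
  show "uniformity = (INF e\<in>{0<..}. principal {(x, y :: 'a alg_tensor). dist x y < e})"
    by (rule uniformity_alg_tensor_def)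
  show "open U = (\<forall>x\<in>U. \<forall>\<^sub>F (x', y) in uniformity. x' = x \<longrightarrow> y \<in> U)"
    for U :: "'a alg_tensor set" by (rule open_alg_tensor_def)
  show "norm u = 0 \<longleftrightarrow> u = 0" by transfer simp
  show "norm (u + w) \<le> norm u + norm w" by transfer (rule projective_norm_add)
  show "norm (r *\<^sub>R u) = \<bar>r\<bar> * norm u" by transfer (simp add: projective_norm_fscale)
  show "norm (u * w) \<le> norm u * norm w" by transfer (rule projective_norm_mult)
  show "norm (1 :: 'a alg_tensor) = 1" by transfer (rule projective_norm_one)
  show "a *\<^sub>C (u + w) = a *\<^sub>C u + a *\<^sub>C w" by transfer (simp add: algebra_simps)
  show "(a + b) *\<^sub>C u = a *\<^sub>C u + b *\<^sub>C u" by transfer (simp add: single_add algebra_simps)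
  show "a *\<^sub>C b *\<^sub>C u = (a * b) *\<^sub>C u" by transfer (simp add: mult_single flip: mult.assoc)
  show "r *\<^sub>R u = complex_of_real r *\<^sub>C u" by transfer simp
  show "norm (a *\<^sub>C u) = cmod a * norm u" by transfer (simp add: projective_norm_fscale)
  show "(a *\<^sub>C u) * w = a *\<^sub>C (u * w)" by transfer (simp add: mult.assoc)
  show "u * (a *\<^sub>C w) = a *\<^sub>C (u * w)"
  proof transfer
    fix a :: complex and u w :: "'a list \<Rightarrow>\<^sub>0 complex"
    show "projective_norm (u * (Poly_Mapping.single 0 a * w) - Poly_Mapping.single 0 a * (u * w)) = 0"
      using single_zero_commute[of u] by (simp flip: mult.assoc)
  qed
qed
end

subsection \<open>Completed projective tensor powers\<close>

type_synonym 'v ptensor = "'v alg_tensor banach_completion"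

definition formal_tensor :: "('v::complex_normed_vector list \<Rightarrow>\<^sub>0 complex) \<Rightarrow> 'v ptensor" where
  "formal_tensor u = to_completion (abs_alg_tensor u)"

definition tensor :: "'v::complex_normed_vector list \<Rightarrow> 'v ptensor" where
  "tensor vs = formal_tensor (Poly_Mapping.single vs 1)"

text \<open>Type \<open>'v ptensor\<close> contains the completed projective tensor powers of all degrees of \<open>'v\<close>;
  \<open>ptensor_power k\<close> is the \<open>k\<close>-fold one. Being closed in a complete space it is the completion of
  the algebraic power. The product of \<open>'v ptensor\<close> is concatenation of tensors.\<close>

definition homogeneous :: "nat \<Rightarrow> ('v list \<Rightarrow>\<^sub>0 complex) \<Rightarrow> bool" where
  "homogeneous k u \<longleftrightarrow> (\<forall>vs\<in>Poly_Mapping.keys u. length vs = k)"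

definition ptensor_power :: "nat \<Rightarrow> 'v::complex_normed_vector ptensor set" where
  "ptensor_power k = closure (formal_tensor ` Collect (homogeneous k))"

lift_definition homogeneous_part :: "nat \<Rightarrow> ('v list \<Rightarrow>\<^sub>0 complex) \<Rightarrow> ('v list \<Rightarrow>\<^sub>0 complex)"
  is "\<lambda>k u vs. if length vs = k then u vs else 0"
  by (rule finite_subset[rotated]) auto

lemma homogeneous_part_diff: "homogeneous_part k (u - w) = homogeneous_part k u - homogeneous_part k w"
  by transfer auto

lemma homogeneous_part_add: "homogeneous_part k (u + w) = homogeneous_part k u + homogeneous_part k w"
  by transfer auto

lemma homogeneous_part_0 [simp]: "homogeneous_part k 0 = 0"
  by transfer auto

lemma homogeneous_part_single:
  "homogeneous_part k (Poly_Mapping.single vs c) = (if length vs = k then Poly_Mapping.single vs c else 0)"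
  by transfer (auto simp: when_def)

lemma lookup_homogeneous_part:
  "Poly_Mapping.lookup (homogeneous_part k u) vs = (if length vs = k then Poly_Mapping.lookup u vs else 0)"
  by transfer simp

lemma homogeneous_homogeneous_part: "homogeneous k (homogeneous_part k u)"
  by (auto simp: homogeneous_def in_keys_iff lookup_homogeneous_part simp del: lookup_not_eq_zero_eq_in_keys split: if_splits)

lemma homogeneous_part_id: "homogeneous k u \<Longrightarrow> homogeneous_part k u = u"
  by (rule poly_mapping_eqI) (auto simp: homogeneous_def in_keys_iff lookup_homogeneous_part)

lemma homogeneous_part_relations: "u \<in> tensor_relations \<Longrightarrow> homogeneous_part k u \<in> tensor_relations"
proof (induction u rule: tensor_relations.induct)
  case (additive u xs a b ys c)
  then show ?case using tensor_relations.additive[of "homogeneous_part k u" xs a b ys c]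
    by (auto simp: homogeneous_part_diff homogeneous_part_add homogeneous_part_single)
next
  case (homogeneous u xs z a ys c)
  then show ?case using tensor_relations.homogeneous[of "homogeneous_part k u" xs z a ys c]
    by (auto simp: homogeneous_part_diff homogeneous_part_add homogeneous_part_single)
qed (simp add: tensor_relations.zero)

lemma formal_norm_homogeneous_part: "formal_norm (homogeneous_part k u) \<le> formal_norm u"
proof -
  have "formal_norm (homogeneous_part k u)
      = (\<Sum>vs\<in>Poly_Mapping.keys u. cmod (Poly_Mapping.lookup (homogeneous_part k u) vs) * prod_list (map norm vs))"
    by (rule formal_norm_superset) (auto simp: in_keys_iff lookup_homogeneous_part simp del: lookup_not_eq_zero_eq_in_keys split: if_splits)
  also have "\<dots> \<le> formal_norm u"
    unfolding formal_norm_def by (intro sum_mono) (auto simp: lookup_homogeneous_part)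
  finally show ?thesis .
qed

text \<open>The norm of an element of the algebraic tensor power is computed by representations of the
  same degree, so it is the usual projective norm of that power.\<close>

lemma projective_norm_homogeneous:
  assumes "homogeneous k u"
  shows "projective_norm u = Inf {formal_norm w | w. homogeneous k w \<and> u - w \<in> tensor_relations}"
proof (rule antisym)
  have b: "bdd_below {formal_norm w | w. homogeneous k w \<and> u - w \<in> tensor_relations}"
    by (auto intro!: bdd_belowI[of _ 0])
  show "projective_norm u \<le> Inf {formal_norm w | w. homogeneous k w \<and> u - w \<in> tensor_relations}"
    by (rule cInf_greatest)
       (use assms in \<open>auto intro!: projective_norm_le exI[of _ u] tensor_relations.zero\<close>)
  show "Inf {formal_norm w | w. homogeneous k w \<and> u - w \<in> tensor_relations} \<le> projective_norm u"
    unfolding projective_norm_def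
  proof (rule cInf_greatest[OF projective_norm_set(1)])
    fix r assume "r \<in> {formal_norm w | w. u - w \<in> tensor_relations}"
    then obtain w where w: "r = formal_norm w" "u - w \<in> tensor_relations" by auto
    have "u - homogeneous_part k w \<in> tensor_relations"
      using homogeneous_part_relations[OF w(2), of k] assms
      by (simp add: homogeneous_part_diff homogeneous_part_id)
    then have "Inf {formal_norm w | w. homogeneous k w \<and> u - w \<in> tensor_relations}
        \<le> formal_norm (homogeneous_part k w)"
      by (intro cInf_lower b) (auto intro!: exI[of _ "homogeneous_part k w"] homogeneous_homogeneous_part)
    with formal_norm_homogeneous_part[of k w] w show
      "Inf {formal_norm w | w. homogeneous k w \<and> u - w \<in> tensor_relations} \<le> r" by simp
  qed
qed

lemma formal_tensor_add: "formal_tensor (u + w) = formal_tensor u + formal_tensor w"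
  unfolding formal_tensor_def to_completion_add[symmetric]
  by (simp add: plus_alg_tensor.abs_eq)

lemma formal_tensor_mult: "formal_tensor (u * w) = formal_tensor u * formal_tensor w"
  unfolding formal_tensor_def to_completion_mult[symmetric]
  by (simp add: times_alg_tensor.abs_eq)

lemma formal_tensor_fscale: "formal_tensor (fscale c u) = c *\<^sub>C formal_tensor u"
  unfolding formal_tensor_def to_completion_scaleC[symmetric]
  by (simp add: scaleC_alg_tensor.abs_eq)

lemma formal_tensor_0: "formal_tensor 0 = 0"
  using formal_tensor_add[of 0 0] by simp

lemma formal_tensor_1: "formal_tensor 1 = 1"
  unfolding formal_tensor_def to_completion_1[symmetric]
  by (simp add: one_alg_tensor_def)

lemma norm_formal_tensor: "norm (formal_tensor u) = projective_norm u"
  by (simp add: formal_tensor_def norm_alg_tensor.abs_eq)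

lemma formal_tensor_sum: "formal_tensor (sum f A) = (\<Sum>x\<in>A. formal_tensor (f x))"
  by (induction A rule: infinite_finite_induct) (auto simp: formal_tensor_add formal_tensor_0)

lemma formal_tensor_eq_sum:
  "formal_tensor u = (\<Sum>vs\<in>Poly_Mapping.keys u. Poly_Mapping.lookup u vs *\<^sub>C tensor vs)"
proof -
  have *: "formal_tensor (Poly_Mapping.single vs c) = c *\<^sub>C tensor vs" for vs :: "'a list" and c
    unfolding tensor_def formal_tensor_fscale[symmetric] by (simp add: mult_single)
  show ?thesis
    by (subst sum_singles[of u]) (simp only: formal_tensor_sum *)
qed

lemma formal_tensor_relations: "u \<in> tensor_relations \<Longrightarrow> formal_tensor u = 0"
  using norm_formal_tensor[of u] by (simp add: projective_norm_rel)

lemma multilinear_tensor: "multilinear (tensor :: 'v::complex_normed_vector list \<Rightarrow> _)"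
  unfolding multilinear_def
proof (intro allI conjI)
  fix xs ys :: "'v list" and a b :: 'v and z :: complex
  have "formal_tensor (Poly_Mapping.single (xs @ (a + b) # ys) 1)
      = formal_tensor (0 + (Poly_Mapping.single (xs @ (a + b) # ys) 1
         - Poly_Mapping.single (xs @ a # ys) 1 - Poly_Mapping.single (xs @ b # ys) 1))
       + formal_tensor (Poly_Mapping.single (xs @ a # ys) 1) + formal_tensor (Poly_Mapping.single (xs @ b # ys) 1)"
    unfolding formal_tensor_add[symmetric] by simp
  also have "formal_tensor (0 + (Poly_Mapping.single (xs @ (a + b) # ys) 1
         - Poly_Mapping.single (xs @ a # ys) 1 - Poly_Mapping.single (xs @ b # ys) 1)) = 0"
    by (intro formal_tensor_relations tensor_relations.additive tensor_relations.zero)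
  finally show "tensor (xs @ (a + b) # ys) = tensor (xs @ a # ys) + tensor (xs @ b # ys)"
    by (simp add: tensor_def)
  have "formal_tensor (Poly_Mapping.single (xs @ (z *\<^sub>C a) # ys) 1)
      = formal_tensor (0 + (Poly_Mapping.single (xs @ (z *\<^sub>C a) # ys) 1
         - Poly_Mapping.single (xs @ a # ys) (z * 1)))
       + formal_tensor (fscale z (Poly_Mapping.single (xs @ a # ys) 1))"
    unfolding formal_tensor_add[symmetric] by (simp add: mult_single)
  also have "formal_tensor (0 + (Poly_Mapping.single (xs @ (z *\<^sub>C a) # ys) 1
         - Poly_Mapping.single (xs @ a # ys) (z * 1))) = 0"
    by (intro formal_tensor_relations tensor_relations.homogeneous tensor_relations.zero)
  finally show "tensor (xs @ (z *\<^sub>C a) # ys) = z *\<^sub>C tensor (xs @ a # ys)"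
    by (simp add: tensor_def formal_tensor_fscale)
qed

lemma norm_tensor_le: "norm (tensor vs) \<le> prod_list (map norm vs)"
  using projective_norm_le_formal[of "Poly_Mapping.single vs 1"]
  by (simp add: tensor_def norm_formal_tensor formal_norm_single)

lemma tensor_append: "tensor xs * tensor ys = tensor (xs @ ys)"
  unfolding tensor_def formal_tensor_mult[symmetric] by (simp add: mult_single plus_list_def)

lemma homogeneous_add: "homogeneous k u \<Longrightarrow> homogeneous k w \<Longrightarrow> homogeneous k (u + w)"
  using keys_add[of u w] by (auto simp: homogeneous_def)

lemma homogeneous_single: "homogeneous (length vs) (Poly_Mapping.single vs c)"
  by (simp add: homogeneous_def)

lemma homogeneous_mult: "homogeneous k u \<Longrightarrow> homogeneous l w \<Longrightarrow> homogeneous (k + l) (u * w)"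
  using keys_mult[of u w] by (fastforce simp: homogeneous_def plus_list_def)

lemma homogeneous_fscale: "homogeneous k u \<Longrightarrow> homogeneous k (fscale c u)"
  using homogeneous_mult[of 0 "Poly_Mapping.single 0 c" k u] by (simp add: homogeneous_def zero_list_def)

lemma ptensor_power_sequence:
  "x \<in> ptensor_power k \<longleftrightarrow> (\<exists>u. (\<forall>n. homogeneous k (u n)) \<and> (\<lambda>n. formal_tensor (u n)) \<longlonglongrightarrow> x)"
proof
  assume "x \<in> ptensor_power k"
  then obtain f where f: "\<And>n. f n \<in> formal_tensor ` Collect (homogeneous k)" "f \<longlonglongrightarrow> x"
    unfolding ptensor_power_def closure_sequential by blast
  then have "\<forall>n. \<exists>u. homogeneous k u \<and> f n = formal_tensor u" by blast
  from choice[OF this] obtain u where u: "\<And>n. homogeneous k (u n)" "\<And>n. f n = formal_tensor (u n)" by blast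
  from u(2) have "f = (\<lambda>n. formal_tensor (u n))" by blast
  with u f show "\<exists>u. (\<forall>n. homogeneous k (u n)) \<and> (\<lambda>n. formal_tensor (u n)) \<longlonglongrightarrow> x" by blast
next
  assume "\<exists>u. (\<forall>n. homogeneous k (u n)) \<and> (\<lambda>n. formal_tensor (u n)) \<longlonglongrightarrow> x"
  then obtain u where "\<And>n. homogeneous k (u n)" "(\<lambda>n. formal_tensor (u n)) \<longlonglongrightarrow> x" by blast
  then show "x \<in> ptensor_power k"
    unfolding ptensor_power_def closure_sequential by (intro exI[of _ "\<lambda>n. formal_tensor (u n)"]) auto
qed

lemma formal_tensor_in_power: "homogeneous k u \<Longrightarrow> formal_tensor u \<in> ptensor_power k"
  unfolding ptensor_power_def by (rule subsetD[OF closure_subset]) auto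

lemma tensor_in_power: "tensor vs \<in> ptensor_power (length vs)"
  unfolding tensor_def by (intro formal_tensor_in_power homogeneous_single)

lemma closed_ptensor_power: "closed (ptensor_power k)"
  by (simp add: ptensor_power_def)

lemma ptensor_power_0 [simp]: "0 \<in> ptensor_power k"
  using formal_tensor_in_power[of k 0] by (simp add: formal_tensor_0 homogeneous_def)

lemma ptensor_power_1: "1 \<in> ptensor_power 0"
  using formal_tensor_in_power[of 0 1] by (simp add: formal_tensor_1 homogeneous_def zero_list_def)

lemma ptensor_power_add:
  assumes "x \<in> ptensor_power k" "y \<in> ptensor_power k" shows "x + y \<in> ptensor_power k"
proof -
  from assms obtain u w where h: "\<And>n. homogeneous k (u n)" "\<And>n. homogeneous k (w n)"
    and l: "(\<lambda>n. formal_tensor (u n)) \<longlonglongrightarrow> x" "(\<lambda>n. formal_tensor (w n)) \<longlonglongrightarrow> y"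
    unfolding ptensor_power_sequence by blast
  have "(\<lambda>n. formal_tensor (u n + w n)) \<longlonglongrightarrow> x + y"
    unfolding formal_tensor_add by (rule tendsto_add[OF l])
  then show ?thesis unfolding ptensor_power_sequence
    using homogeneous_add[OF h]
    by (intro exI[of _ "\<lambda>n. u n + w n"]) simp
qed

lemma ptensor_power_scaleC:
  assumes "x \<in> ptensor_power k" shows "c *\<^sub>C x \<in> ptensor_power k"
proof -
  from assms obtain u where h: "\<And>n. homogeneous k (u n)" and l: "(\<lambda>n. formal_tensor (u n)) \<longlonglongrightarrow> x"
    unfolding ptensor_power_sequence by blast
  have "(\<lambda>n. formal_tensor (fscale c (u n))) \<longlonglongrightarrow> c *\<^sub>C x"
    unfolding formal_tensor_fscale by (rule bounded_linear.tendsto[OF bounded_linear_scaleC l])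
  then show ?thesis unfolding ptensor_power_sequence
    using homogeneous_fscale[OF h]
    by (intro exI[of _ "\<lambda>n. fscale c (u n)"]) simp
qed

lemma ptensor_power_mult:
  assumes "x \<in> ptensor_power k" "y \<in> ptensor_power l" shows "x * y \<in> ptensor_power (k + l)"
proof -
  from assms obtain u w where h: "\<And>n. homogeneous k (u n)" "\<And>n. homogeneous l (w n)"
    and l: "(\<lambda>n. formal_tensor (u n)) \<longlonglongrightarrow> x" "(\<lambda>n. formal_tensor (w n)) \<longlonglongrightarrow> y"
    unfolding ptensor_power_sequence by blast
  have "(\<lambda>n. formal_tensor (u n * w n)) \<longlonglongrightarrow> x * y"
    unfolding formal_tensor_mult by (rule tendsto_mult[OF l])
  then show ?thesis unfolding ptensor_power_sequence
    using homogeneous_mult[OF h]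
    by (intro exI[of _ "\<lambda>n. u n * w n"]) simp
qed

lemma ptensor_power_minus: "x \<in> ptensor_power k \<Longrightarrow> - x \<in> ptensor_power k"
  using ptensor_power_scaleC[of x k "-1"] by (simp add: scaleC_minus1)

lemma ptensor_power_scaleR: "x \<in> ptensor_power k \<Longrightarrow> r *\<^sub>R x \<in> ptensor_power k"
  unfolding scaleR_scaleC by (rule ptensor_power_scaleC)

lemma ptensor_power_sum: "(\<And>x. x \<in> A \<Longrightarrow> f x \<in> ptensor_power k) \<Longrightarrow> sum f A \<in> ptensor_power k"
  by (induction A rule: infinite_finite_induct) (auto intro: ptensor_power_add)

subsection \<open>Bounded linear maps on subspaces and duals\<close>

definition bounded_clinear_on ::
    "'a::complex_normed_vector set \<Rightarrow> ('a \<Rightarrow> 'b::complex_normed_vector) \<Rightarrow> bool" where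
  "bounded_clinear_on S f \<longleftrightarrow>
     (\<forall>x\<in>S. \<forall>y\<in>S. f (x + y) = f x + f y) \<and> (\<forall>c. \<forall>x\<in>S. f (c *\<^sub>C x) = c *\<^sub>C f x) \<and>
     (\<exists>K. \<forall>x\<in>S. norm (f x) \<le> K * norm x)"

lemma formal_ext_alg:
  fixes \<Phi> :: "'v::complex_normed_vector list \<Rightarrow> 'w::complex_normed_vector"
  assumes \<Phi>: "multilinear \<Phi>" and C: "C \<ge> 0" "\<And>vs. norm (\<Phi> vs) \<le> C * prod_list (map norm vs)"
  obtains F where "\<And>x y. F (x + y) = F x + F y" "\<And>c x. F (c *\<^sub>C x) = c *\<^sub>C F x"
    "\<And>x. norm (F x) \<le> C * norm x" "\<And>u. F (abs_alg_tensor u) = formal_ext \<Phi> u"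
proof -
  define F where "F x = formal_ext \<Phi> (rep_alg_tensor x)" for x
  have r: "\<exists>u. x = abs_alg_tensor u" for x :: "'v alg_tensor"
    by (rule exI[of _ "rep_alg_tensor x"]) (simp add: Quotient3_abs_rep[OF Quotient3_alg_tensor])
  have F: "F (abs_alg_tensor u) = formal_ext \<Phi> u" for u
  proof -
    have "projective_norm (rep_alg_tensor (abs_alg_tensor u) - u) = 0"
      using Quotient3_rep_abs[OF Quotient3_alg_tensor, of u] by simp
    then have "norm (formal_ext \<Phi> (rep_alg_tensor (abs_alg_tensor u) - u)) \<le> 0"
      using norm_formal_ext_le[OF assms, of "rep_alg_tensor (abs_alg_tensor u) - u"] by simp
    then show ?thesis by (simp add: F_def formal_ext_diff)
  qed
  show ?thesis
  proof (rule that[of F])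
    fix x y :: "'v alg_tensor" and c
    obtain u w where [simp]: "x = abs_alg_tensor u" "y = abs_alg_tensor w" using r by blast
    have "x + y = abs_alg_tensor (u + w)" "c *\<^sub>C x = abs_alg_tensor (fscale c u)"
      by (simp_all add: plus_alg_tensor.abs_eq scaleC_alg_tensor.abs_eq)
    then show "F (x + y) = F x + F y" "F (c *\<^sub>C x) = c *\<^sub>C F x"
      by (simp_all add: F formal_ext_add formal_ext_fscale)
    have "norm x = projective_norm u" by (simp add: norm_alg_tensor.abs_eq)
    then show "norm (F x) \<le> C * norm x" using norm_formal_ext_le[OF assms, of u] by (simp add: F)
  qed (rule F)
qed

lemma completion_ext:
  fixes f :: "'a::complex_normed_vector \<Rightarrow> 'w::complex_banach"
  assumes f: "\<And>x y. f (x + y) = f x + f y" "\<And>c x. f (c *\<^sub>C x) = c *\<^sub>C f x" "\<And>x. norm (f x) \<le> C * norm x"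
  obtains F where "\<And>x y. F (x + y) = F x + F y" "\<And>c x. F (c *\<^sub>C x) = c *\<^sub>C F x"
    "\<And>x. norm (F x) \<le> C * norm x" "\<And>x. F (to_completion x) = f x"
proof -
  have bl: "bounded_linear f"
    by (rule bounded_linear_intro[where K = C]) (use f in \<open>auto simp: scaleR_scaleC mult.commute\<close>)
  define F where "F X = (THE L. \<forall>x. Cauchy x \<longrightarrow> (\<lambda>n. to_completion (x n)) \<longlonglongrightarrow> X \<longrightarrow> (\<lambda>n. f (x n)) \<longlonglongrightarrow> L)" for X
  have F: "(\<lambda>n. f (x n)) \<longlonglongrightarrow> F X" if x: "Cauchy x" "(\<lambda>n. to_completion (x n)) \<longlonglongrightarrow> X" for x X
  proof -
    have "Cauchy (\<lambda>n. f (x n))" by (rule Cauchy_bounded_linear[OF bl x(1)])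
    then obtain L where L: "(\<lambda>n. f (x n)) \<longlonglongrightarrow> L" by (auto simp: Cauchy_convergent_iff convergent_def)
    have L': "(\<lambda>n. f (y n)) \<longlonglongrightarrow> L" if y: "Cauchy y" "(\<lambda>n. to_completion (y n)) \<longlonglongrightarrow> X" for y
    proof -
      have "(\<lambda>n. to_completion (y n) - to_completion (x n)) \<longlonglongrightarrow> 0"
        using tendsto_diff[OF y(2) x(2)] by simp
      then have "(\<lambda>n. to_completion (y n - x n)) \<longlonglongrightarrow> 0" by (simp only: to_completion_diff)
      from tendsto_norm_zero[OF this] have "(\<lambda>n. norm (y n - x n)) \<longlonglongrightarrow> 0" by simp
      then have "(\<lambda>n. y n - x n) \<longlonglongrightarrow> 0" by (rule tendsto_norm_zero_cancel)
      from bounded_linear.tendsto_zero[OF bl this] have "(\<lambda>n. f (y n) - f (x n)) \<longlonglongrightarrow> 0"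
        by (simp add: linear_diff[OF bounded_linear.linear[OF bl]])
      from tendsto_add[OF this L] show ?thesis by simp
    qed
    have "F X = L" unfolding F_def
    proof (rule the_equality)
      show "\<forall>x. Cauchy x \<longrightarrow> (\<lambda>n. to_completion (x n)) \<longlonglongrightarrow> X \<longrightarrow> (\<lambda>n. f (x n)) \<longlonglongrightarrow> L"
        using L' by blast
    next
      fix M assume "\<forall>x. Cauchy x \<longrightarrow> (\<lambda>n. to_completion (x n)) \<longlonglongrightarrow> X \<longrightarrow> (\<lambda>n. f (x n)) \<longlonglongrightarrow> M"
      then have "(\<lambda>n. f (x n)) \<longlonglongrightarrow> M" using x by blast
      then show "M = L" using L by (rule LIMSEQ_unique)
    qed
    with L show ?thesis by simp
  qed
  show ?thesis
  proof (rule that[of F])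
    fix X Y :: "'a banach_completion" and c
    obtain x where x: "Cauchy x" "(\<lambda>n. to_completion (x n)) \<longlonglongrightarrow> X" by (rule completion_dense)
    obtain y where y: "Cauchy y" "(\<lambda>n. to_completion (y n)) \<longlonglongrightarrow> Y" by (rule completion_dense)
    have "(\<lambda>n. to_completion (x n + y n)) \<longlonglongrightarrow> X + Y"
      unfolding to_completion_add by (rule tendsto_add[OF x(2) y(2)])
    from F[OF Cauchy_add[OF x(1) y(1)] this] have "(\<lambda>n. f (x n) + f (y n)) \<longlonglongrightarrow> F (X + Y)"
      by (simp only: f(1))
    from LIMSEQ_unique[OF this tendsto_add[OF F[OF x] F[OF y]]] show "F (X + Y) = F X + F Y" .
    have "(\<lambda>n. to_completion (c *\<^sub>C x n)) \<longlonglongrightarrow> c *\<^sub>C X"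
      unfolding to_completion_scaleC by (rule bounded_linear.tendsto[OF bounded_linear_scaleC x(2)])
    from F[OF Cauchy_bounded_linear[OF bounded_linear_scaleC x(1)] this]
    have "(\<lambda>n. c *\<^sub>C f (x n)) \<longlonglongrightarrow> F (c *\<^sub>C X)" by (simp only: f(2))
    from LIMSEQ_unique[OF this bounded_linear.tendsto[OF bounded_linear_scaleC F[OF x]]]
    show "F (c *\<^sub>C X) = c *\<^sub>C F X" .
    have "(\<lambda>n. norm (x n)) \<longlonglongrightarrow> norm X" using tendsto_norm[OF x(2)] by simp
    from LIMSEQ_le[OF tendsto_norm[OF F[OF x]] tendsto_mult_left[OF this, of C]] f(3)
    show "norm (F X) \<le> C * norm X" by blast
  next
    fix x
    have "(\<lambda>n. f x) \<longlonglongrightarrow> F (to_completion x)" by (rule F) (auto simp: Cauchy_const)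
    then show "F (to_completion x) = f x" using LIMSEQ_unique tendsto_const by blast
  qed
qed

definition multilinear_at :: "nat \<Rightarrow> ('v::complex_normed_vector list \<Rightarrow> 'w::complex_normed_vector) \<Rightarrow> bool" where
  "multilinear_at k \<Phi> \<longleftrightarrow> (\<forall>xs ys a b z. length xs + length ys + 1 = k \<longrightarrow>
     \<Phi> (xs @ (a + b) # ys) = \<Phi> (xs @ a # ys) + \<Phi> (xs @ b # ys)
     \<and> \<Phi> (xs @ (z *\<^sub>C a) # ys) = z *\<^sub>C \<Phi> (xs @ a # ys))"

context
  fixes G :: "'v::complex_normed_vector ptensor \<Rightarrow> 'w::complex_normed_vector" and k :: nat
  assumes G: "bounded_clinear_on (ptensor_power k) G"
begin

lemma bounded_clinear_on_zero: "G 0 = 0"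
proof -
  have "G (0 *\<^sub>C 0) = 0 *\<^sub>C G 0" using G ptensor_power_0 unfolding bounded_clinear_on_def by blast
  then show ?thesis by simp
qed

lemma bounded_clinear_on_tensor_sum:
  assumes "\<And>vs. vs \<in> A \<Longrightarrow> length vs = k"
  shows "G (\<Sum>vs\<in>A. c vs *\<^sub>C tensor vs) = (\<Sum>vs\<in>A. c vs *\<^sub>C G (tensor vs))"
  using assms
proof (induction A rule: infinite_finite_induct)
  case (insert vs A)
  have t: "tensor vs \<in> ptensor_power k" using tensor_in_power[of vs] insert by auto
  have s: "(\<Sum>vs\<in>A. c vs *\<^sub>C tensor vs) \<in> ptensor_power k"
    using insert tensor_in_power by (intro ptensor_power_sum ptensor_power_scaleC) auto
  from G t s ptensor_power_scaleC[OF t]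
  have "G (c vs *\<^sub>C tensor vs + (\<Sum>vs\<in>A. c vs *\<^sub>C tensor vs))
      = c vs *\<^sub>C G (tensor vs) + G (\<Sum>vs\<in>A. c vs *\<^sub>C tensor vs)"
    unfolding bounded_clinear_on_def by metis
  then show ?case using insert by simp
qed (auto simp: bounded_clinear_on_zero)

lemma bounded_clinear_on_formal_tensor:
  assumes "homogeneous k u"
  shows "G (formal_tensor u) = (\<Sum>vs\<in>Poly_Mapping.keys u. Poly_Mapping.lookup u vs *\<^sub>C G (tensor vs))"
  using assms unfolding formal_tensor_eq_sum
  by (intro bounded_clinear_on_tensor_sum) (auto simp: homogeneous_def)

lemma bounded_clinear_on_diff:
  assumes "x \<in> ptensor_power k" "y \<in> ptensor_power k"
  shows "G (x - y) = G x - G y"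
proof -
  have "G ((x + - y) + y) = G (x + - y) + G y"
    using G assms ptensor_power_add[OF assms(1) ptensor_power_minus[OF assms(2)]]
    unfolding bounded_clinear_on_def by blast
  then show ?thesis by simp
qed

lemma bounded_clinear_on_LIMSEQ:
  assumes x: "x \<in> ptensor_power k" and u: "\<And>n. homogeneous k (u n)" "(\<lambda>n. formal_tensor (u n)) \<longlonglongrightarrow> x"
  shows "(\<lambda>n. G (formal_tensor (u n))) \<longlonglongrightarrow> G x"
proof -
  obtain K where K: "\<And>x. x \<in> ptensor_power k \<Longrightarrow> norm (G x) \<le> K * norm x"
    using G unfolding bounded_clinear_on_def by blast
  have "(\<lambda>n. G (formal_tensor (u n)) - G x) \<longlonglongrightarrow> 0"
  proof (rule Lim_null_comparison)
    show "\<forall>\<^sub>F n in sequentially. norm (G (formal_tensor (u n)) - G x) \<le> K * norm (formal_tensor (u n) - x)"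
    proof (intro always_eventually allI)
      fix n
      have m: "formal_tensor (u n) \<in> ptensor_power k" by (rule formal_tensor_in_power[OF u(1)])
      have "formal_tensor (u n) - x \<in> ptensor_power k"
        using ptensor_power_add[OF m ptensor_power_minus[OF x]] by simp
      from K[OF this] show "norm (G (formal_tensor (u n)) - G x) \<le> K * norm (formal_tensor (u n) - x)"
        by (simp add: bounded_clinear_on_diff[OF m x])
    qed
    have "(\<lambda>n. formal_tensor (u n) - x) \<longlonglongrightarrow> 0" using u(2) by (simp add: LIM_zero)
    from tendsto_mult_left[OF tendsto_norm_zero[OF this], of K]
    show "(\<lambda>n. K * norm (formal_tensor (u n) - x)) \<longlonglongrightarrow> 0" by simp
  qed
  then show ?thesis by (rule LIM_zero_cancel)
qed

end

lemma bounded_clinear_on_ptensor_power_unique: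
  assumes D: "bounded_clinear_on (ptensor_power k) D" and E: "bounded_clinear_on (ptensor_power k) E"
    and eq: "\<And>vs. length vs = k \<Longrightarrow> D (tensor vs) = E (tensor vs)" and x: "x \<in> ptensor_power k"
  shows "D x = E x"
proof -
  have ft: "D (formal_tensor u) = E (formal_tensor u)" if "homogeneous k u" for u
    using that eq unfolding bounded_clinear_on_formal_tensor[OF D that] bounded_clinear_on_formal_tensor[OF E that]
    by (intro sum.cong) (auto simp: homogeneous_def)
  from x obtain u where u: "\<And>n. homogeneous k (u n)" "(\<lambda>n. formal_tensor (u n)) \<longlonglongrightarrow> x"
    unfolding ptensor_power_sequence by blast
  from bounded_clinear_on_LIMSEQ[OF D x u] bounded_clinear_on_LIMSEQ[OF E x u] show ?thesis
    unfolding ft[OF u(1)] by (rule LIMSEQ_unique)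
qed

lemma bounded_clinear_on_ptensor_power_range:
  fixes D :: "'v::complex_normed_vector ptensor \<Rightarrow> 'w::complex_normed_vector ptensor"
  assumes D: "bounded_clinear_on (ptensor_power k) D"
    and r: "\<And>vs. length vs = k \<Longrightarrow> D (tensor vs) \<in> ptensor_power l" and x: "x \<in> ptensor_power k"
  shows "D x \<in> ptensor_power l"
proof -
  from x obtain u where u: "\<And>n. homogeneous k (u n)" "(\<lambda>n. formal_tensor (u n)) \<longlonglongrightarrow> x"
    unfolding ptensor_power_sequence by blast
  have "D (formal_tensor (u n)) \<in> ptensor_power l" for n
    unfolding bounded_clinear_on_formal_tensor[OF D u(1)]
    using u(1)[of n] by (intro ptensor_power_sum ptensor_power_scaleC r) (simp add: homogeneous_def)
  then show ?thesis
    by (intro closed_sequentially[OF closed_ptensor_power _ bounded_clinear_on_LIMSEQ[OF D x u]])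
qed

text \<open>The universal property of the completed projective tensor power: bounded \<open>k\<close>-linear maps
  extend uniquely to bounded linear maps.\<close>

lemma ptensor_power_universal:
  fixes \<Phi> :: "'v::complex_normed_vector list \<Rightarrow> 'w::complex_banach"
  assumes \<Phi>: "multilinear_at k \<Phi>" and C: "\<And>vs. length vs = k \<Longrightarrow> norm (\<Phi> vs) \<le> C * prod_list (map norm vs)"
  shows "\<exists>!D. bounded_clinear_on (ptensor_power k) D \<and> (\<forall>x. x \<notin> ptensor_power k \<longrightarrow> D x = 0) \<and>
    (\<forall>vs. length vs = k \<longrightarrow> D (tensor vs) = \<Phi> vs)"
proof (rule ex_ex1I)
  let ?\<Phi> = "\<lambda>vs. if length vs = k then \<Phi> vs else 0"
  have m: "multilinear ?\<Phi>"
    using \<Phi> by (auto simp: multilinear_def multilinear_at_def)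
  have b: "norm (?\<Phi> vs) \<le> max C 0 * prod_list (map norm vs)" for vs
  proof (cases "length vs = k")
    case True
    from C[OF this] have "norm (\<Phi> vs) \<le> C * prod_list (map norm vs)" .
    also have "\<dots> \<le> max C 0 * prod_list (map norm vs)" by (intro mult_right_mono) auto
    finally show ?thesis using True by simp
  qed (auto intro!: mult_nonneg_nonneg)
  obtain f where f: "\<And>x y. f (x + y) = f x + f y" "\<And>c x. f (c *\<^sub>C x) = c *\<^sub>C f x"
    "\<And>x. norm (f x) \<le> max C 0 * norm x" "\<And>u. f (abs_alg_tensor u) = formal_ext ?\<Phi> u"
    by (rule formal_ext_alg[OF m _ b]) auto
  obtain F where F: "\<And>x y. F (x + y) = F x + F y" "\<And>c x. F (c *\<^sub>C x) = c *\<^sub>C F x"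
    "\<And>x. norm (F x) \<le> max C 0 * norm x" "\<And>x. F (to_completion x) = f x"
    by (rule completion_ext[OF f(1-3)]) auto
  have "F (tensor vs) = ?\<Phi> vs" for vs
    by (simp add: tensor_def formal_tensor_def F f formal_ext_single)
  then show "\<exists>D. bounded_clinear_on (ptensor_power k) D \<and> (\<forall>x. x \<notin> ptensor_power k \<longrightarrow> D x = 0) \<and>
    (\<forall>vs. length vs = k \<longrightarrow> D (tensor vs) = \<Phi> vs)"
    using tensor_in_power F(3)
    by (intro exI[of _ "\<lambda>x. if x \<in> ptensor_power k then F x else 0"])
       (auto simp: bounded_clinear_on_def F(1,2) ptensor_power_add ptensor_power_scaleC)
next
  fix D E :: "'v ptensor \<Rightarrow> 'w"
  assume D: "bounded_clinear_on (ptensor_power k) D \<and> (\<forall>x. x \<notin> ptensor_power k \<longrightarrow> D x = 0) \<and>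
    (\<forall>vs. length vs = k \<longrightarrow> D (tensor vs) = \<Phi> vs)"
    and E: "bounded_clinear_on (ptensor_power k) E \<and> (\<forall>x. x \<notin> ptensor_power k \<longrightarrow> E x = 0) \<and>
    (\<forall>vs. length vs = k \<longrightarrow> E (tensor vs) = \<Phi> vs)"
  show "D = E"
  proof
    fix x show "D x = E x"
    proof (cases "x \<in> ptensor_power k")
      case True
      then show ?thesis using D E by (intro bounded_clinear_on_ptensor_power_unique[of k D E x]) auto
    qed (use D E in auto)
  qed
qed

subsection \<open>The tensor algebra\<close>

text \<open>The l1-direct sum of the completed projective tensor powers; the product is the Cauchy
  product of the concatenation maps.\<close>

typedef (overloaded) 'v tensor_algebra =
  "{x :: nat \<Rightarrow> 'v::complex_normed_vector ptensor. (\<forall>k. x k \<in> ptensor_power k) \<and> summable (\<lambda>k. norm (x k))}"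
  morphisms component Abs_tensor_algebra
  by (rule exI[of _ "\<lambda>_. 0"]) auto

setup_lifting type_definition_tensor_algebra

lemma component_in_power: "component x k \<in> ptensor_power k"
  and component_summable: "summable (\<lambda>k. norm (component x k))"
  using component[of x] by auto

lemma tensor_algebra_eqI: "(\<And>k. component x k = component y k) \<Longrightarrow> x = y"
  by (simp add: component_inject[symmetric] fun_eq_iff)

lemma summable_norm_add:
  fixes f g :: "nat \<Rightarrow> 'a::real_normed_vector"
  assumes "summable (\<lambda>k. norm (f k))" "summable (\<lambda>k. norm (g k))"
  shows "summable (\<lambda>k. norm (f k + g k))"
  by (rule summable_comparison_test'[OF summable_add[OF assms]]) (simp add: norm_triangle_ineq)

instantiation tensor_algebra :: (complex_normed_vector) "{scaleC, real_vector}"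
begin
lift_definition zero_tensor_algebra :: "'a tensor_algebra" is "\<lambda>_. 0" by auto
lift_definition plus_tensor_algebra :: "'a tensor_algebra \<Rightarrow> 'a tensor_algebra \<Rightarrow> 'a tensor_algebra"
  is "\<lambda>x y k. x k + y k"
  by (auto intro: ptensor_power_add summable_norm_add)
lift_definition uminus_tensor_algebra :: "'a tensor_algebra \<Rightarrow> 'a tensor_algebra" is "\<lambda>x k. - x k"
  by (auto intro: ptensor_power_minus)
lift_definition minus_tensor_algebra :: "'a tensor_algebra \<Rightarrow> 'a tensor_algebra \<Rightarrow> 'a tensor_algebra"
  is "\<lambda>x y k. x k + - y k"
  by (auto simp del: add_uminus_conv_diff intro!: ptensor_power_add ptensor_power_minus summable_norm_add)
lift_definition scaleC_tensor_algebra :: "complex \<Rightarrow> 'a tensor_algebra \<Rightarrow> 'a tensor_algebra"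
  is "\<lambda>c x k. c *\<^sub>C x k"
  by (auto simp: norm_scaleC intro: ptensor_power_scaleC summable_mult)
lift_definition scaleR_tensor_algebra :: "real \<Rightarrow> 'a tensor_algebra \<Rightarrow> 'a tensor_algebra"
  is "\<lambda>r x k. r *\<^sub>R x k"
  by (auto intro: ptensor_power_scaleR summable_mult)
instance
  by standard (transfer; simp add: algebra_simps)+
end

instantiation tensor_algebra :: (complex_normed_vector) real_algebra_1
begin
lift_definition one_tensor_algebra :: "'a tensor_algebra" is "\<lambda>k. if k = 0 then 1 else 0"
  by (auto simp: ptensor_power_1 intro!: summable_finite[of "{0}"] split: if_splits)
lift_definition times_tensor_algebra :: "'a tensor_algebra \<Rightarrow> 'a tensor_algebra \<Rightarrow> 'a tensor_algebra"
  is "\<lambda>x y k. \<Sum>i\<le>k. x i * y (k - i)"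
proof (intro conjI allI)
  fix x y :: "nat \<Rightarrow> 'a ptensor" and k
  assume x: "(\<forall>k. x k \<in> ptensor_power k) \<and> summable (\<lambda>k. norm (x k))"
    and y: "(\<forall>k. y k \<in> ptensor_power k) \<and> summable (\<lambda>k. norm (y k))"
  show "(\<Sum>i\<le>k. x i * y (k - i)) \<in> ptensor_power k"
  proof (rule ptensor_power_sum)
    fix i assume "i \<in> {..k}"
    with ptensor_power_mult[of "x i" i "y (k - i)" "k - i"] x y
    show "x i * y (k - i) \<in> ptensor_power k" by simp
  qed
  show "summable (\<lambda>k. norm (\<Sum>i\<le>k. x i * y (k - i)))"
  proof (rule summable_comparison_test')
    show "summable (\<lambda>k. \<Sum>i\<le>k. norm (x i) * norm (y (k - i)))"
      using x y by (intro summable_Cauchy_product) auto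
    show "norm (norm (\<Sum>i\<le>k. x i * y (k - i))) \<le> (\<Sum>i\<le>k. norm (x i) * norm (y (k - i)))" if "k \<ge> 0" for k
      by (auto intro!: sum_norm_le norm_mult_ineq)
  qed
qed
instance
proof
  fix x y z :: "'a tensor_algebra" and r :: real
  show "x * y * z = x * (y * z)"
  proof transfer
    fix x y z :: "nat \<Rightarrow> 'a ptensor"
    show "(\<lambda>k. \<Sum>i\<le>k. (\<Sum>j\<le>i. x j * y (i - j)) * z (k - i))
        = (\<lambda>k. \<Sum>i\<le>k. x i * (\<Sum>j\<le>k - i. y j * z (k - i - j)))"
    proof
      fix n
      show "(\<Sum>i\<le>n. (\<Sum>j\<le>i. x j * y (i - j)) * z (n - i))
        = (\<Sum>i\<le>n. x i * (\<Sum>j\<le>n - i. y j * z (n - i - j)))"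
        using fps_mult_assoc_lemma[of "\<lambda>i j k. x i * y j * z k" n n]
        by (simp add: sum_distrib_left sum_distrib_right mult.assoc atMost_atLeast0)
    qed
  qed
  show "1 * x = x"
  proof transfer
    fix x :: "nat \<Rightarrow> 'a ptensor"
    show "(\<lambda>k. \<Sum>i\<le>k. (if i = 0 then 1 else 0) * x (k - i)) = x"
      by (simp add: if_distrib[of "\<lambda>a. a * _"] cong: if_cong)
  qed
  show "x * 1 = x"
  proof transfer
    fix x :: "nat \<Rightarrow> 'a ptensor"
    show "(\<lambda>k. \<Sum>i\<le>k. x i * (if k - i = 0 then 1 else 0)) = x"
    proof
      fix k
      have "(\<Sum>i\<le>k. x i * (if k - i = 0 then 1 else 0)) = (\<Sum>i\<le>k. if i = k then x i else 0)"
        by (intro sum.cong) auto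
      then show "(\<Sum>i\<le>k. x i * (if k - i = 0 then 1 else 0)) = x k" by simp
    qed
  qed
  show "(x + y) * z = x * z + y * z" by transfer (simp add: distrib_right sum.distrib)
  show "x * (y + z) = x * y + x * z" by transfer (simp add: distrib_left sum.distrib)
  show "(r *\<^sub>R x) * y = r *\<^sub>R (x * y)" by transfer (simp add: scaleR_sum_right)
  show "x * (r *\<^sub>R y) = r *\<^sub>R (x * y)" by transfer (simp add: scaleR_sum_right)
  show "(0 :: 'a tensor_algebra) \<noteq> 1" by transfer (auto simp: fun_eq_iff)
qed
end

lemma component_add: "component (x + y) k = component x k + component y k" by transfer simp
lemma component_diff: "component (x - y) k = component x k - component y k" by transfer simp
lemma component_mult: "component (x * y) k = (\<Sum>i\<le>k. component x i * component y (k - i))" by transfer simp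
lemma component_scaleR: "component (r *\<^sub>R x) k = r *\<^sub>R component x k" by transfer simp
lemma component_scaleC: "component (c *\<^sub>C x) k = c *\<^sub>C component x k" by transfer simp
lemma component_0: "component 0 k = 0" by transfer simp
lemma component_1: "component 1 k = (if k = 0 then 1 else 0)" by transfer simp

lemma scaleC_sum_right: "c *\<^sub>C sum f A = (\<Sum>x\<in>A. c *\<^sub>C f x :: 'a::complex_normed_vector)"
  by (induction A rule: infinite_finite_induct) (auto simp: scaleC_add_right)

instantiation tensor_algebra :: (complex_normed_vector) "{complex_normed_algebra, real_normed_algebra_1}"
begin
definition norm_tensor_algebra :: "'a tensor_algebra \<Rightarrow> real" where
  "norm_tensor_algebra x = suminf (\<lambda>k. norm (component x k))"
definition dist_tensor_algebra :: "'a tensor_algebra \<Rightarrow> 'a tensor_algebra \<Rightarrow> real" where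
  "dist_tensor_algebra x y = norm (x - y)"
definition sgn_tensor_algebra :: "'a tensor_algebra \<Rightarrow> 'a tensor_algebra" where
  "sgn_tensor_algebra x = x /\<^sub>R norm x"
definition uniformity_tensor_algebra :: "('a tensor_algebra \<times> 'a tensor_algebra) filter" where
  "uniformity_tensor_algebra = (INF e\<in>{0 <..}. principal {(x, y). dist x y < e})"
definition open_tensor_algebra :: "'a tensor_algebra set \<Rightarrow> bool" where
  "open_tensor_algebra U \<longleftrightarrow> (\<forall>x\<in>U. \<forall>\<^sub>F (x', y) in uniformity. x' = x \<longrightarrow> y \<in> U)"
instance
proof
  fix u w :: "'a tensor_algebra" and r :: real and a b :: complex
  show "dist u w = norm (u - w)" by (rule dist_tensor_algebra_def)
  show "sgn u = u /\<^sub>R norm u" by (rule sgn_tensor_algebra_def)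
  show "uniformity = (INF e\<in>{0<..}. principal {(x, y :: 'a tensor_algebra). dist x y < e})"
    by (rule uniformity_tensor_algebra_def)
  show "open U = (\<forall>x\<in>U. \<forall>\<^sub>F (x', y) in uniformity. x' = x \<longrightarrow> y \<in> U)"
    for U :: "'a tensor_algebra set" by (rule open_tensor_algebra_def)
  show "norm u = 0 \<longleftrightarrow> u = 0"
    using suminf_eq_zero_iff[OF component_summable[of u]]
    by (auto simp: norm_tensor_algebra_def component_0 intro!: tensor_algebra_eqI)
  show "norm (u + w) \<le> norm u + norm w"
    unfolding norm_tensor_algebra_def suminf_add[OF component_summable component_summable]
    by (intro suminf_le component_summable summable_add) (simp add: component_add norm_triangle_ineq)
  show "norm (r *\<^sub>R u) = \<bar>r\<bar> * norm u"
    unfolding norm_tensor_algebra_def by (simp add: component_scaleR suminf_mult component_summable)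
  show "norm (u * w) \<le> norm u * norm w"
  proof -
    have "norm u * norm w = suminf (\<lambda>k. \<Sum>i\<le>k. norm (component u i) * norm (component w (k - i)))"
      unfolding norm_tensor_algebra_def
      by (rule Cauchy_product) (simp_all add: component_summable)
    moreover have "norm (u * w) \<le> suminf (\<lambda>k. \<Sum>i\<le>k. norm (component u i) * norm (component w (k - i)))"
      unfolding norm_tensor_algebra_def
      by (intro suminf_le component_summable summable_Cauchy_product)
         (auto simp: component_mult component_summable intro!: sum_norm_le norm_mult_ineq)
    ultimately show ?thesis by simp
  qed
  show "norm (1 :: 'a tensor_algebra) = 1"
  proof -
    have "(\<lambda>k. norm (component (1 :: 'a tensor_algebra) k)) = (\<lambda>k. if k = 0 then 1 else 0)"
      by (simp add: component_1 fun_eq_iff)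
    then show ?thesis using sums_unique[OF sums_single[of 0 "\<lambda>_. 1 :: real"]]
      by (simp add: norm_tensor_algebra_def)
  qed
  show "a *\<^sub>C (u + w) = a *\<^sub>C u + a *\<^sub>C w" by transfer (simp add: scaleC_add_right)
  show "(a + b) *\<^sub>C u = a *\<^sub>C u + b *\<^sub>C u" by transfer (simp add: scaleC_add_left)
  show "a *\<^sub>C b *\<^sub>C u = (a * b) *\<^sub>C u" by transfer (simp add: scaleC_scaleC)
  show "r *\<^sub>R u = complex_of_real r *\<^sub>C u" by transfer (simp add: scaleR_scaleC)
  show "norm (a *\<^sub>C u) = cmod a * norm u"
    unfolding norm_tensor_algebra_def
    by (simp add: component_scaleC norm_scaleC suminf_mult component_summable)
  show "(a *\<^sub>C u) * w = a *\<^sub>C (u * w)" by transfer (simp add: mult_scaleC_left scaleC_sum_right)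
  show "u * (a *\<^sub>C w) = a *\<^sub>C (u * w)" by transfer (simp add: mult_scaleC_right scaleC_sum_right)
qed
end

lemma norm_component_le: "(\<Sum>k<n. norm (component x k)) \<le> norm x"
  unfolding norm_tensor_algebra_def by (rule sum_le_suminf) (auto simp: component_summable)

instance tensor_algebra :: (complex_normed_vector) complex_banach_algebra
proof
  fix X :: "nat \<Rightarrow> 'a tensor_algebra" assume X: "Cauchy X"
  have "Cauchy (\<lambda>n. component (X n) k)" for k
  proof (rule CauchyI)
    fix e :: real assume "e > 0"
    from CauchyD[OF X this] obtain M where M: "\<forall>m\<ge>M. \<forall>n\<ge>M. norm (X m - X n) < e" by blast
    have "norm (component (X m) k - component (X n) k) \<le> norm (X m - X n)" for m n
      using norm_component_le[where n = "Suc k" and x = "X m - X n"]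
        sum_nonneg[of "{..<k}" "\<lambda>k. norm (component (X m - X n) k)"]
      by (simp add: component_diff)
    with M show "\<exists>M. \<forall>m\<ge>M. \<forall>n\<ge>M. norm (component (X m) k - component (X n) k) < e"
      by (meson le_less_trans)
  qed
  then have "\<forall>k. \<exists>l. (\<lambda>n. component (X n) k) \<longlonglongrightarrow> l"
    by (simp add: Cauchy_convergent_iff convergent_def)
  from choice[OF this] obtain L where L: "\<And>k. (\<lambda>n. component (X n) k) \<longlonglongrightarrow> L k" by blast
  have Lp: "L k \<in> ptensor_power k" for k
    by (rule closed_sequentially[OF closed_ptensor_power _ L]) (rule component_in_power)
  have est: "\<exists>N. \<forall>n\<ge>N. \<forall>K. (\<Sum>k<K. norm (component (X n) k - L k)) \<le> e" if e: "e > 0" for e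
  proof -
    from CauchyD[OF X e] obtain N where N: "\<And>m n. m \<ge> N \<Longrightarrow> n \<ge> N \<Longrightarrow> norm (X m - X n) < e" by blast
    have "(\<Sum>k<K. norm (component (X n) k - L k)) \<le> e" if n: "n \<ge> N" for n K
    proof (rule LIMSEQ_le_const2)
      show "(\<lambda>m. \<Sum>k<K. norm (component (X n) k - component (X m) k))
          \<longlonglongrightarrow> (\<Sum>k<K. norm (component (X n) k - L k))"
        by (intro tendsto_sum tendsto_norm tendsto_diff tendsto_const L)
      have "(\<Sum>k<K. norm (component (X n) k - component (X m) k)) \<le> e" if "m \<ge> N" for m
        using norm_component_le[where n = K and x = "X n - X m"] N[OF n that] by (simp add: component_diff)
      then show "\<exists>N. \<forall>m\<ge>N. (\<Sum>k<K. norm (component (X n) k - component (X m) k)) \<le> e" by blast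
    qed
    then show ?thesis by blast
  qed
  have Ls: "summable (\<lambda>k. norm (L k))"
  proof -
    obtain N where "\<And>K. (\<Sum>k<K. norm (component (X N) k - L k)) \<le> 1" using est[of 1] by auto
    then have "summable (\<lambda>k. norm (component (X N) k - L k))"
      by (intro summableI_nonneg_bounded) auto
    from summable_add[OF this component_summable[of "X N"]] show ?thesis
    proof (rule summable_comparison_test')
      fix k :: nat
      show "norm (norm (L k)) \<le> norm (component (X N) k - L k) + norm (component (X N) k)"
        using norm_triangle_ineq4[of "component (X N) k" "component (X N) k - L k"] by simp
    qed
  qed
  define Y where "Y = Abs_tensor_algebra L"
  have Y: "component Y = L" using Lp Ls by (simp add: Y_def Abs_tensor_algebra_inverse)
  have "X \<longlonglongrightarrow> Y"
  proof (rule LIMSEQ_I)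
    fix e :: real assume "e > 0"
    then obtain N where N: "\<And>n K. n \<ge> N \<Longrightarrow> (\<Sum>k<K. norm (component (X n) k - L k)) \<le> e / 2"
      using est[of "e / 2"] by auto
    have "norm (X n - Y) \<le> e / 2" if "n \<ge> N" for n
      unfolding norm_tensor_algebra_def
      by (rule suminf_le_const[OF component_summable]) (use N[OF that] in \<open>simp add: component_diff Y\<close>)
    then show "\<exists>no. \<forall>n\<ge>no. norm (X n - Y) < e" using \<open>e > 0\<close> by (intro exI[of _ N]) fastforce
  qed
  then show "convergent X" by (rule convergentI)
qed

subsection \<open>Simplicial cohomology\<close>

text \<open>Functionals on a subspace are extended by 0, so that equality of functions is equality of
  functionals.\<close>

definition dual_space :: "'a::complex_normed_vector set \<Rightarrow> ('a \<Rightarrow> complex) set" where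
  "dual_space S = {f. bounded_clinear_on S f \<and> (\<forall>x. x \<notin> S \<longrightarrow> f x = 0)}"

definition dual_norm :: "'a::complex_normed_vector set \<Rightarrow> ('a \<Rightarrow> complex) \<Rightarrow> real" where
  "dual_norm S f = (SUP x\<in>{x\<in>S. norm x \<le> 1}. cmod (f x))"

definition hochschild_formula :: "nat \<Rightarrow> 'a::complex_banach_algebra list \<Rightarrow> 'a ptensor" where
  "hochschild_formula n as =
     tensor (tl (butlast as) @ [last as * hd as]) +
     (\<Sum>j = 1..n + 1. (- 1) ^ j *\<^sub>C tensor (take (j - 1) as @ [as ! (j - 1) * as ! j] @ drop (j + 1) as))"

text \<open>Cf. \<open>hochschild_d_characterization\<close> below for existence and uniqueness.\<close>

definition hochschild_d :: "nat \<Rightarrow> 'a::complex_banach_algebra ptensor \<Rightarrow> 'a ptensor" where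
  "hochschild_d n = (THE D. bounded_clinear_on (ptensor_power (n + 2)) D \<and>
     (\<forall>x. x \<notin> ptensor_power (n + 2) \<longrightarrow> D x = 0) \<and>
     (\<forall>as. length as = n + 2 \<longrightarrow> D (tensor as) = hochschild_formula n as))"

lemma multilinear_atI:
  fixes \<Phi> :: "'a::complex_normed_algebra list \<Rightarrow> 'w::complex_normed_vector"
  assumes \<Psi>: "multilinear \<Psi>"
    and eq: "\<And>xs ys. length xs + length ys + 1 = k \<Longrightarrow> \<exists>us ws m.
      (\<forall>c. \<Phi> (xs @ c # ys) = \<Psi> (us @ c # ws)) \<or> (\<forall>c. \<Phi> (xs @ c # ys) = \<Psi> (us @ (m * c) # ws)) \<or>
      (\<forall>c. \<Phi> (xs @ c # ys) = \<Psi> (us @ (c * m) # ws))"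
  shows "multilinear_at k \<Phi>"
  unfolding multilinear_at_def
proof (intro allI impI)
  fix xs ys :: "'a list" and a b :: 'a and z assume "length xs + length ys + 1 = k"
  from eq[OF this] obtain us ws m where
    "(\<forall>c. \<Phi> (xs @ c # ys) = \<Psi> (us @ c # ws)) \<or> (\<forall>c. \<Phi> (xs @ c # ys) = \<Psi> (us @ (m * c) # ws)) \<or>
      (\<forall>c. \<Phi> (xs @ c # ys) = \<Psi> (us @ (c * m) # ws))" by blast
  then show "\<Phi> (xs @ (a + b) # ys) = \<Phi> (xs @ a # ys) + \<Phi> (xs @ b # ys)
     \<and> \<Phi> (xs @ (z *\<^sub>C a) # ys) = z *\<^sub>C \<Phi> (xs @ a # ys)"
    using \<Psi> unfolding multilinear_def
    by (elim disjE) (simp_all add: distrib_left distrib_right mult_scaleC_left mult_scaleC_right)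
qed

lemma multilinear_at_cyclic:
  "multilinear_at (n + 2) (\<lambda>as :: 'a::complex_normed_algebra list. tensor (tl (butlast as) @ [last as * hd as]))"
proof (rule multilinear_atI[where \<Psi> = tensor, OF multilinear_tensor])
  fix xs ys :: "'a list" assume l: "length xs + length ys + 1 = n + 2"
  let ?\<Phi> = "\<lambda>as. tensor (tl (butlast as) @ [last as * hd as])"
  show "\<exists>us ws m. (\<forall>c. ?\<Phi> (xs @ c # ys) = tensor (us @ c # ws)) \<or> (\<forall>c. ?\<Phi> (xs @ c # ys) = tensor (us @ (m * c) # ws)) \<or>
      (\<forall>c. ?\<Phi> (xs @ c # ys) = tensor (us @ (c * m) # ws))"
  proof (cases "xs = []")
    case True
    with l have "ys \<noteq> []" by auto
    with True show ?thesis
      by (intro exI[of _ "butlast ys"] exI[of _ "[]"] exI[of _ "last ys"]) simp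
  next
    case xs: False
    show ?thesis
    proof (cases "ys = []")
      case True
      with xs show ?thesis
        by (intro exI[of _ "tl xs"] exI[of _ "[]"] exI[of _ "hd xs"]) simp
    next
      case False
      with xs show ?thesis
        by (intro exI[of _ "tl xs"] exI[of _ "butlast ys @ [last ys * hd xs]"] exI[of _ 0]) (simp add: butlast_append)
    qed
  qed
qed

lemma multilinear_at_face:
  assumes j: "j < n + 1"
  shows "multilinear_at (n + 2) (\<lambda>as :: 'a::complex_normed_algebra list.
    tensor (take j as @ as ! j * as ! Suc j # drop (j + 2) as))"
proof (rule multilinear_atI[where \<Psi> = tensor, OF multilinear_tensor])
  fix xs ys :: "'a list" assume l: "length xs + length ys + 1 = n + 2"
  let ?\<Phi> = "\<lambda>as. tensor (take j as @ as ! j * as ! Suc j # drop (j + 2) as)"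
  consider "length xs < j" | "length xs = j" | "length xs = Suc j" | "length xs > Suc j" by linarith
  then show "\<exists>us ws m. (\<forall>c. ?\<Phi> (xs @ c # ys) = tensor (us @ c # ws)) \<or> (\<forall>c. ?\<Phi> (xs @ c # ys) = tensor (us @ (m * c) # ws)) \<or>
      (\<forall>c. ?\<Phi> (xs @ c # ys) = tensor (us @ (c * m) # ws))"
  proof cases
    case 1
    then obtain i where i: "j = Suc (length xs + i)" using less_imp_Suc_add by blast
    show ?thesis
      by (rule exI[of _ xs], rule exI[of _ "take i ys @ ys ! i * ys ! Suc i # drop (i + 2) ys"], rule exI[of _ 0])
         (simp add: i nth_append numeral_3_eq_3)
  next
    case 2
    show ?thesis
      by (intro exI[of _ xs] exI[of _ "drop 1 ys"] exI[of _ "ys ! 0"]) (simp add: 2[symmetric] nth_append)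
  next
    case 3
    show ?thesis
      by (intro exI[of _ "take j xs"] exI[of _ ys] exI[of _ "xs ! j"]) (simp add: 3 nth_append)
  next
    case 4
    then have "drop (j + 2) (xs @ c # ys) = drop (j + 2) xs @ c # ys" for c by simp
    with 4 show ?thesis
      by (intro exI[of _ "take j xs @ xs ! j * xs ! Suc j # drop (j + 2) xs"] exI[of _ ys] exI[of _ 0])
         (simp add: nth_append)
  qed
qed

lemma hochschild_formula_bound:
  fixes as :: "'a::complex_banach_algebra list"
  assumes l: "length as = n + 2"
  shows "norm (hochschild_formula n as) \<le> real (n + 2) * prod_list (map norm as)"
proof -
  have cyc: "norm (tensor (tl (butlast as) @ [last as * hd as])) \<le> prod_list (map norm as)"
  proof -
    obtain a bs where a: "as = a # bs" "length bs = Suc n" using l by (cases as) auto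
    then have "bs = butlast bs @ [last bs]" by (intro append_butlast_last_id[symmetric]) auto
    with a obtain cs b where b: "as = a # cs @ [b]" by metis
    have "norm (tensor (cs @ [b * a])) \<le> prod_list (map norm cs) * norm (b * a)"
      using norm_tensor_le[of "cs @ [b * a]"] by simp
    also have "\<dots> \<le> prod_list (map norm cs) * (norm b * norm a)"
      by (intro mult_left_mono norm_mult_ineq) simp
    finally show ?thesis by (simp add: b mult_ac butlast_append)
  qed
  have face: "norm ((- 1) ^ j *\<^sub>C tensor (take (j - 1) as @ [as ! (j - 1) * as ! j] @ drop (j + 1) as))
      \<le> prod_list (map norm as)" if j: "j \<in> {1..n + 1}" for j
  proof -
    from j obtain i where i: "j = Suc i" "i < n + 1" by (cases j) auto
    have as: "as = take i as @ as ! i # as ! Suc i # drop (i + 2) as"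
      using l i by (metis Cons_nth_drop_Suc Suc_eq_plus1 add_2_eq_Suc' id_take_nth_drop less_SucI add_less_cancel_right
        Suc_lessI add_Suc_right less_trans_Suc nat_neq_iff)
    have "norm (tensor (take i as @ as ! i * as ! Suc i # drop (i + 2) as))
        \<le> prod_list (map norm (take i as)) * (norm (as ! i * as ! Suc i) * prod_list (map norm (drop (i + 2) as)))"
      using norm_tensor_le[of "take i as @ as ! i * as ! Suc i # drop (i + 2) as"] by simp
    also have "\<dots> \<le> prod_list (map norm (take i as)) * ((norm (as ! i) * norm (as ! Suc i)) * prod_list (map norm (drop (i + 2) as)))"
      by (intro mult_left_mono mult_right_mono norm_mult_ineq) simp_all
    also have "\<dots> = prod_list (map norm (take i as @ as ! i # as ! Suc i # drop (i + 2) as))"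
      by (simp add: mult_ac)
    also have "\<dots> = prod_list (map norm as)" using as by metis
    finally show ?thesis by (simp add: i norm_scaleC norm_power)
  qed
  have "norm (hochschild_formula n as) \<le> prod_list (map norm as) + (\<Sum>j = 1..n + 1. prod_list (map norm as))"
    unfolding hochschild_formula_def
    by (intro norm_triangle_le add_mono cyc sum_norm_le face)
  then show ?thesis by (simp add: algebra_simps)
qed

lemma hochschild_formula_in_power:
  assumes "length as = n + 2" shows "hochschild_formula n as \<in> ptensor_power (n + 1)"
proof -
  have "tensor bs \<in> ptensor_power (n + 1)" if "length bs = n + 1" for bs :: "'a list"
    using tensor_in_power[of bs] that by simp
  then show ?thesis using assms unfolding hochschild_formula_def
    by (intro ptensor_power_add ptensor_power_sum ptensor_power_scaleC) auto
qed

lemma multilinear_at_hochschild_formula: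
  "multilinear_at (n + 2) (hochschild_formula n :: 'a::complex_banach_algebra list \<Rightarrow> _)"
proof -
  have "multilinear_at (n + 2) (\<lambda>as :: 'a list. tensor (take (j - 1) as @ [as ! (j - 1) * as ! j] @ drop (j + 1) as))"
    if "j \<in> {1..n + 1}" for j
  proof -
    from that obtain i where "j = Suc i" "i < n + 1" by (cases j) auto
    then show ?thesis using multilinear_at_face[of i n] by simp
  qed
  then show ?thesis
    using multilinear_at_cyclic[of n] unfolding multilinear_at_def hochschild_formula_def
    by (simp add: scaleC_add_right scaleC_sum_right sum.distrib scaleC_scaleC mult.commute)
qed

lemma hochschild_d_characterization:
  fixes n :: nat
  defines "D \<equiv> (hochschild_d n :: 'a::complex_banach_algebra ptensor \<Rightarrow> 'a ptensor)"
  shows "bounded_clinear_on (ptensor_power (n + 2)) D"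
    and "\<And>x. x \<notin> ptensor_power (n + 2) \<Longrightarrow> D x = 0"
    and "\<And>as. length as = n + 2 \<Longrightarrow> D (tensor as) = hochschild_formula n as"
    and "\<And>x. x \<in> ptensor_power (n + 2) \<Longrightarrow> D x \<in> ptensor_power (n + 1)"
proof -
  have *: "bounded_clinear_on (ptensor_power (n + 2)) D \<and>
     (\<forall>x. x \<notin> ptensor_power (n + 2) \<longrightarrow> D x = 0) \<and>
     (\<forall>as. length as = n + 2 \<longrightarrow> D (tensor as) = hochschild_formula n as)"
    unfolding D_def hochschild_d_def
    by (rule theI'[OF ptensor_power_universal[OF multilinear_at_hochschild_formula hochschild_formula_bound]])
  then show "bounded_clinear_on (ptensor_power (n + 2)) D"
    and "\<And>x. x \<notin> ptensor_power (n + 2) \<Longrightarrow> D x = 0"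
    and "\<And>as. length as = n + 2 \<Longrightarrow> D (tensor as) = hochschild_formula n as" by auto
  show "\<And>x. x \<in> ptensor_power (n + 2) \<Longrightarrow> D x \<in> ptensor_power (n + 1)"
    by (rule bounded_clinear_on_ptensor_power_range)
       (use * hochschild_formula_in_power in auto)
qed

text \<open>The space of chains in degree \<open>n\<close> is \<open>ptensor_power (n + 1)\<close>. A cohomology class is a coset of the
  space of coboundaries, and there are no cochains in negative degrees.\<close>

definition cochains :: "nat \<Rightarrow> ('a::complex_banach_algebra ptensor \<Rightarrow> complex) set" where
  "cochains n = dual_space (ptensor_power (n + 1))"

definition coboundary :: "nat \<Rightarrow> ('a::complex_banach_algebra ptensor \<Rightarrow> complex) \<Rightarrow> 'a ptensor \<Rightarrow> complex" where
  "coboundary n f = f \<circ> hochschild_d n"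

definition cocycles :: "nat \<Rightarrow> ('a::complex_banach_algebra ptensor \<Rightarrow> complex) set" where
  "cocycles n = {f \<in> cochains n. coboundary n f = (\<lambda>_. 0)}"

fun coboundaries :: "nat \<Rightarrow> ('a::complex_banach_algebra ptensor \<Rightarrow> complex) set" where
  "coboundaries 0 = {\<lambda>_. 0}"
| "coboundaries (Suc n) = coboundary n ` cochains n"

definition cohomology_class ::
    "nat \<Rightarrow> ('a::complex_banach_algebra ptensor \<Rightarrow> complex) \<Rightarrow> ('a ptensor \<Rightarrow> complex) set" where
  "cohomology_class n f = (\<lambda>g x. f x + g x) ` coboundaries n"

definition simplicial_cohomology ::
    "'a::complex_banach_algebra itself \<Rightarrow> nat \<Rightarrow> ('a ptensor \<Rightarrow> complex) set set" where
  "simplicial_cohomology A n = cohomology_class n ` cocycles n"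

text \<open>The quotient seminorm on cohomology.\<close>

definition class_norm :: "nat \<Rightarrow> ('a::complex_banach_algebra ptensor \<Rightarrow> complex) set \<Rightarrow> real" where
  "class_norm n X = (INF f\<in>X. dual_norm (ptensor_power (n + 1)) f)"

text \<open>An isomorphism of seminormed spaces, linear and bounded in both directions, from the cohomology
  onto a space \<open>S\<close> of functionals on the algebra.\<close>

definition cohomology_iso ::
    "nat \<Rightarrow> ('a::complex_banach_algebra \<Rightarrow> complex) set \<Rightarrow> (('a ptensor \<Rightarrow> complex) set \<Rightarrow> 'a \<Rightarrow> complex) \<Rightarrow> bool"
  where
  "cohomology_iso n S \<Theta> \<longleftrightarrow>
     bij_betw \<Theta> (simplicial_cohomology TYPE('a) n) S \<and>
     (\<forall>f\<in>cocycles n. \<forall>g\<in>cocycles n.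
        \<Theta> (cohomology_class n (\<lambda>x. f x + g x)) =
        (\<lambda>a. \<Theta> (cohomology_class n f) a + \<Theta> (cohomology_class n g) a)) \<and>
     (\<forall>c. \<forall>f\<in>cocycles n.
        \<Theta> (cohomology_class n (\<lambda>x. c * f x)) = (\<lambda>a. c * \<Theta> (cohomology_class n f) a)) \<and>
     (\<exists>K. \<forall>X\<in>simplicial_cohomology TYPE('a) n.
        dual_norm UNIV (\<Theta> X) \<le> K * class_norm n X \<and> class_norm n X \<le> K * dual_norm UNIV (\<Theta> X))"

definition traces :: "('a::complex_banach_algebra \<Rightarrow> complex) set" where
  "traces = {\<tau> \<in> dual_space UNIV. \<forall>a b. \<tau> (a * b) = \<tau> (b * a)}"

end

(*
Let h split each tensor factor a_i, with the sign (-1)^i, at every letter of the word a_i, and let N be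
the total number of letters of a chain. Then d h + h d = N up to terms in which a_1 = a' a'' has been
split and a' has moved around the cycle to the last factor; those are the two terms of a cyclic
rotation, and appending the unit to the rotated chain is a homotopy R which removes them. As h and R
have at most N terms, (h + R) / N is bounded with norm at most 2, and it contracts the complex in
degrees at least 2; the part N = 0 is the complex of the complex numbers. In degree 1 the term
(1/N) sum a'' a_2 a' (x) 1 remains, and a cocycle f takes there the value (k/N) f(a_1 a_2 (x) 1), where k
is the degree of a_1. Hence f is determined up to coboundaries by the trace f(. (x) 1), and conversely
(a, b) |-> (k/N) tau(ab) is a bounded cocycle for every trace tau that vanishes at the unit.
Bounded functionals on the tensor powers of T(V) are determined by their values on tensors of words, so
all of this is a computation with functions of lists of words.
*)
theory Submission
  imports Defs
begin

subsection \<open>Signed sums over mergings and splittings of lists of words\<close>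

text \<open>The letter count is in general unbounded on T(V), and so are h and R. Only the quotient
  makes sense as a bounded map, and it has to be formed where the count is constant. Lists of words
  of given lengths are such pieces, and faces keep the count since concatenation adds lengths. This
  dictates the cuts: a word is cut after each of its letters, the last included, so that it has as
  many cuts as letters. Interior cuts alone would be one fewer for each nonempty word, a number that
  changes when words are merged. The return from words to bounded cochains rests on the l1-norm and
  the projective norms: a function of lists of words that is multilinear in the letters and bounded
  by one constant times the product of the norms of all letters extends with the same constant. A
  homotopy is therefore given by its formula on words and one estimate, and the constant survives up
  to the norms of cohomology classes.\<close>

text \<open>A function \<open>P\<close> of lists of words stands for a cochain restricted to tensors of words. The operators
  below are the precompositions with the inner faces of the Hochschild differential (\<open>merging\<close>), its
  cyclic face (\<open>wrapping\<close>), and the homotopies \<open>h\<close> (\<open>splitting\<close>) and, up to sign, \<open>R\<close> (\<open>rotation\<close>).\<close>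

fun merging :: "('a list list \<Rightarrow> 'b::comm_ring_1) \<Rightarrow> 'a list list \<Rightarrow> 'b" where
  "merging P (a # b # as) = - P ((a @ b) # as) - merging (\<lambda>xs. P (a # xs)) (b # as)"
| "merging P _ = 0"

fun splitting :: "('a list list \<Rightarrow> 'b::comm_ring_1) \<Rightarrow> 'a list list \<Rightarrow> 'b" where
  "splitting P [] = 0"
| "splitting P (a # as) =
     - (\<Sum>j=1..length a. P (take j a # drop j a # as)) - splitting (\<lambda>xs. P (a # xs)) as"

definition wrapping :: "('a list list \<Rightarrow> 'b::comm_ring_1) \<Rightarrow> 'a list list \<Rightarrow> 'b" where
  "wrapping P as = P (tl (butlast as) @ [last as @ hd as])"

lemma wrapping_append: "wrapping P (a # m @ [z]) = P (m @ [z @ a])"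
  by (simp add: wrapping_def butlast_append)

definition boundary :: "('a list list \<Rightarrow> 'b::comm_ring_1) \<Rightarrow> 'a list list \<Rightarrow> 'b" where
  "boundary P as = wrapping P as + merging P as"

fun rotation :: "('a list list \<Rightarrow> 'b::comm_ring_1) \<Rightarrow> 'a list list \<Rightarrow> 'b" where
  "rotation P (a # b # as) =
     (\<Sum>j=1..length a. P (drop j a # butlast (b # as) @ [last (b # as) @ take j a, []]))"
| "rotation P _ = 0"

text \<open>The sign turns the commutator of \<open>rotation\<close> with the boundary into an
  anticommutator, since the boundary changes the length by one. Its parity is the one for which the
  two error sums of \<open>splitting_boundary\<close> cancel against those of
  \<open>rotation_boundary\<close>.\<close>

definition contraction :: "('a list list \<Rightarrow> 'b::comm_ring_1) \<Rightarrow> 'a list list \<Rightarrow> 'b" where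
  "contraction P as = splitting P as + (- 1) ^ length as * rotation P as"

section \<open>Congruence and linearity of the operators\<close>

lemma merging_cong:
  "(\<And>xs. Suc (length xs) = length as \<Longrightarrow> length (concat xs) = length (concat as) \<Longrightarrow> P xs = Q xs) \<Longrightarrow>
    merging P as = merging Q as"
  by (induction P as arbitrary: Q rule: merging.induct) (auto intro!: arg_cong2[where f = "(-)"])

lemma splitting_cong:
  "(\<And>xs. length xs = Suc (length as) \<Longrightarrow> P xs = Q xs) \<Longrightarrow> splitting P as = splitting Q as"
  by (induction P as arbitrary: Q rule: splitting.induct) (auto intro!: arg_cong2[where f = "(-)"] sum.cong)

lemma merging_add: "merging (\<lambda>xs. P xs + Q xs) as = merging P as + merging Q as"
  by (induction P as arbitrary: Q rule: merging.induct) auto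

lemma merging_cmult: "merging (\<lambda>xs. c * P xs) as = c * merging P as"
  by (induction P as rule: merging.induct) (auto simp: algebra_simps)

lemma merging_0 [simp]: "merging (\<lambda>xs. 0) as = 0"
  using merging_cmult[of 0 "\<lambda>xs. 0" as] by simp

lemma merging_minus: "merging (\<lambda>xs. - P xs) as = - merging P as"
  using merging_cmult[of "-1" P as] by simp

lemma merging_diff: "merging (\<lambda>xs. P xs - Q xs) as = merging P as - merging Q as"
  using merging_add[of P "\<lambda>xs. - Q xs" as] by (simp add: merging_minus)

lemma merging_sum: "merging (\<lambda>xs. \<Sum>j\<in>J. P j xs) as = (\<Sum>j\<in>J. merging (P j) as)"
  by (induction J rule: infinite_finite_induct) (auto simp: merging_add)

lemma splitting_add: "splitting (\<lambda>xs. P xs + Q xs) as = splitting P as + splitting Q as"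
  by (induction P as arbitrary: Q rule: splitting.induct) (auto simp: sum.distrib)

lemma splitting_cmult: "splitting (\<lambda>xs. c * P xs) as = c * splitting P as"
  by (induction P as rule: splitting.induct) (auto simp: algebra_simps sum_distrib_left)

lemma splitting_minus: "splitting (\<lambda>xs. - P xs) as = - splitting P as"
  using splitting_cmult[of "-1" P as] by simp

lemma splitting_diff: "splitting (\<lambda>xs. P xs - Q xs) as = splitting P as - splitting Q as"
  using splitting_add[of P "\<lambda>xs. - Q xs" as] by (simp add: splitting_minus)

text \<open>A cut of \<open>a @ b\<close> lies in \<open>a\<close> or in \<open>b\<close>: the cut
  at the seam is the one after the last letter of \<open>a\<close>, and no cut precedes the first
  letter of \<open>b\<close>.\<close>

lemma sum_split_append:
  "(\<Sum>j=1..length (a @ b). f (take j (a @ b)) (drop j (a @ b))) =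
     (\<Sum>j=1..length a. f (take j a) (drop j a @ b)) + (\<Sum>j=1..length b. f (a @ take j b) (drop j b))"
proof -
  have "(\<Sum>j=1..length (a @ b). f (take j (a @ b)) (drop j (a @ b))) =
     (\<Sum>j=1..length a. f (take j (a @ b)) (drop j (a @ b))) +
     (\<Sum>j=length a + 1..length a + length b. f (take j (a @ b)) (drop j (a @ b)))"
    by (subst sum.ub_add_nat[symmetric]) auto
  also have "(\<Sum>j=length a + 1..length a + length b. f (take j (a @ b)) (drop j (a @ b))) =
      (\<Sum>j=1..length b. f (a @ take j b) (drop j b))"
    using sum.shift_bounds_cl_nat_ivl[of "\<lambda>j. f (take j (a @ b)) (drop j (a @ b))" 1 "length a" "length b"]
    by (simp add: add.commute)
  finally show ?thesis by simp
qed

text \<open>Cutting a word and merging the two pieces again gives the list back, once for each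
  letter. Every other pair of a cut and an inner face occurs in both orders with opposite
  signs.\<close>

lemma splitting_merging:
  fixes P :: "'a list list \<Rightarrow> 'b::comm_ring_1"
  shows "splitting (merging P) as + merging (splitting P) as = of_nat (length (concat as)) * P as"
proof (induction as arbitrary: P)
  case (Cons a as)
  show ?case
  proof (cases as)
    case Nil
    then show ?thesis by simp
  next
    case (Cons b c)
    let ?M = "\<Sum>j=1..length a. merging (\<lambda>xs. P (take j a # drop j a # xs)) (b # c)"
    \<comment> \<open>The first inner face joins \<open>a\<close> to whatever heads the list after
      the cut; \<open>hd\<close> and \<open>tl\<close> keep it a single function to which
      \<open>splitting\<close> applies.\<close>
    have 1: "splitting (\<lambda>xs. merging P (a # xs)) (b # c) =
        - splitting (\<lambda>xs. P ((a @ hd xs) # tl xs)) (b # c) - splitting (merging (\<lambda>xs. P (a # xs))) (b # c)"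
      unfolding splitting_minus[symmetric] splitting_diff[symmetric]
    proof (rule splitting_cong)
      fix xs :: "'a list list" assume "length xs = Suc (length (b # c))"
      then show "merging P (a # xs) = - P ((a @ hd xs) # tl xs) - merging (\<lambda>xs. P (a # xs)) xs"
        by (cases xs) auto
    qed
    have 2: "(\<Sum>j=1..length a. merging P (take j a # drop j a # b # c)) =
        - of_nat (length a) * P (a # b # c) + (\<Sum>j=1..length a. P (take j a # (drop j a @ b) # c)) + ?M"
      by (simp add: sum_subtractf sum.distrib algebra_simps)
    have 3: "merging (\<lambda>xs. splitting P (a # xs)) (b # c) =
        - ?M - merging (splitting (\<lambda>xs. P (a # xs))) (b # c)"
      by (simp add: merging_minus merging_diff merging_sum)
    \<comment> \<open>The cuts in \<open>a\<close> cancel with the second sum of fact 2; the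
      remaining terms cancel with fact 5, which enters through fact 1.\<close>
    have 4: "splitting P ((a @ b) # c) = - (\<Sum>j=1..length a. P (take j a # (drop j a @ b) # c))
        - (\<Sum>j=1..length b. P ((a @ take j b) # drop j b # c)) - splitting (\<lambda>xs. P ((a @ b) # xs)) c"
      unfolding splitting.simps sum_split_append[of "\<lambda>x y. P (x # y # c)"] by simp
    have IH: "splitting (merging (\<lambda>xs. P (a # xs))) (b # c) =
        of_nat (length (concat (b # c))) * P (a # b # c) - merging (splitting (\<lambda>xs. P (a # xs))) (b # c)"
      using Cons.IH[of "\<lambda>xs. P (a # xs)"] Cons by (simp add: algebra_simps)
    have 5: "splitting (\<lambda>xs. P ((a @ hd xs) # tl xs)) (b # c) =
        - (\<Sum>j=1..length b. P ((a @ take j b) # drop j b # c)) - splitting (\<lambda>xs. P ((a @ b) # xs)) c"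
      by simp
    have "splitting (merging P) (a # b # c) + merging (splitting P) (a # b # c) =
        - (\<Sum>j=1..length a. merging P (take j a # drop j a # b # c)) - splitting (\<lambda>xs. merging P (a # xs)) (b # c)
        - splitting P ((a @ b) # c) - merging (\<lambda>xs. splitting P (a # xs)) (b # c)"
      by (simp only: splitting.simps merging.simps) simp
    then show ?thesis
      unfolding 1 2 3 4 5 IH Cons by (simp add: algebra_simps)
  qed
qed simp

section \<open>Interaction of the homotopies with the cyclic face\<close>

lemma splitting_snoc:
  "splitting P (m @ [z @ a]) = splitting (\<lambda>xs. P (butlast xs @ [last xs @ a])) (m @ [z])
     + (- 1) ^ Suc (length m) * (\<Sum>j=1..length a. P (m @ [z @ take j a, drop j a]))"
proof (induction m arbitrary: P)
  case Nil
  show ?case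
    using sum_split_append[of "\<lambda>x y. P [x, y]" z a] by simp
next
  case (Cons b m)
  have "splitting (\<lambda>xs. P (b # butlast xs @ [last xs @ a])) (m @ [z]) =
      splitting (\<lambda>xs. P (butlast (b # xs) @ [last (b # xs) @ a])) (m @ [z])"
    by (rule splitting_cong) auto
  then show ?case
    unfolding append_Cons splitting.simps Cons.IH by (simp add: algebra_simps butlast_append)
qed

lemma merging_snoc:
  "merging P (m @ [z @ a]) = merging (\<lambda>xs. P (butlast xs @ [last xs @ a])) (m @ [z])"
proof (induction m arbitrary: P)
  case (Cons b m)
  show ?case
  proof (cases m)
    case (Cons c m')
    have "merging (\<lambda>xs. P (b # butlast xs @ [last xs @ a])) (m @ [z]) =
        merging (\<lambda>xs. P (butlast (b # xs) @ [last (b # xs) @ a])) (m @ [z])"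
      by (rule merging_cong) (auto simp: Cons)
    with Cons.IH[of "\<lambda>xs. P (b # xs)"] Cons show ?thesis
      by (simp add: butlast_append)
  qed simp
qed simp

text \<open>Isolates the last inner face; for \<open>w = []\<close> it is the one that deletes an
  appended unit.\<close>

lemma merging_snoc2:
  "merging P (m @ [z, w]) = merging (\<lambda>xs. P (xs @ [w])) (m @ [z]) + (- 1) ^ Suc (length m) * P (m @ [z @ w])"
proof (induction m arbitrary: P)
  case (Cons b m)
  from Cons.IH[of "\<lambda>xs. P (b # xs)"] show ?case
    by (cases m) (simp_all add: algebra_simps)
qed simp

text \<open>Only the cuts of the first word feel the order of cutting and turning. If
  \<open>a\<close> moves to the end before it is cut, both pieces stay there, which gives the first
  sum; if it is cut before, only its front piece moves, which gives the second.\<close>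

lemma splitting_wrapping:
  "splitting (wrapping P) (a # m @ [z]) + wrapping (splitting P) (a # m @ [z]) =
     (- 1) ^ Suc (length m) * (\<Sum>j=1..length a. P (m @ [z @ take j a, drop j a]))
     - (\<Sum>j=1..length a. P (drop j a # m @ [z @ take j a]))"
proof -
  have "splitting (\<lambda>xs. wrapping P (a # xs)) (m @ [z]) =
      splitting (\<lambda>xs. P (butlast xs @ [last xs @ a])) (m @ [z])"
    by (rule splitting_cong) (auto simp: wrapping_def)
  then show ?thesis
    by (simp add: splitting_snoc wrapping_def butlast_append)
qed

text \<open>On a rotated chain with the unit appended, the cyclic face puts \<open>drop j a\<close>
  in the place of the unit, and the last inner face deletes the unit. Up to sign these are the two
  error sums of \<open>splitting_wrapping\<close>; the other inner faces form the middle
  sum.\<close>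

lemma rotation_boundary:
  "rotation (boundary P) (a # m @ [z]) =
     (\<Sum>j=1..length a. P (m @ [z @ take j a, drop j a]))
     + (\<Sum>j=1..length a. merging (\<lambda>xs. P (xs @ [[]])) (drop j a # m @ [z @ take j a]))
     + (- 1) ^ length m * (\<Sum>j=1..length a. P (drop j a # m @ [z @ take j a]))"
proof -
  obtain b as where b: "m @ [z] = b # as" by (cases "m @ [z]") auto
  have l: "butlast (b # as) = m" "last (b # as) = z" by (simp_all flip: b)
  have "boundary P (drop j a # m @ [z @ take j a, []]) =
      P (m @ [z @ take j a, drop j a]) + merging (\<lambda>xs. P (xs @ [[]])) (drop j a # m @ [z @ take j a])
      + (- 1) ^ length m * P (drop j a # m @ [z @ take j a])" for j
    using merging_snoc2[of P "drop j a # m" "z @ take j a" "[]"]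
    by (simp add: boundary_def wrapping_def butlast_append)
  then show ?thesis
    unfolding b rotation.simps l by (simp add: sum.distrib sum_distrib_left)
qed

text \<open>The cyclic face and the first inner face both produce the cuts of \<open>b\<close>, with
  opposite signs. The cuts of \<open>a\<close> remain, and for these rotation commutes with the
  inner faces.\<close>

lemma boundary_rotation:
  fixes P :: "'a list list \<Rightarrow> 'b::comm_ring_1"
  shows "boundary (rotation P) (a # b # m @ [z]) =
     (\<Sum>j=1..length a. merging (\<lambda>xs. P (xs @ [[]])) (drop j a # b # m @ [z @ take j a]))"
proof -
  have R: "rotation P (x # m @ [y]) = (\<Sum>j=1..length x. P (drop j x # m @ [y @ take j x, []]))" for x y
  proof -
    obtain b as where b: "m @ [y] = b # as" by (cases "m @ [y]") auto
    have "butlast (b # as) = m" "last (b # as) = y" by (simp_all flip: b)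
    then show ?thesis unfolding b by simp
  qed
  have 1: "wrapping (rotation P) (a # b # m @ [z]) = (\<Sum>j=1..length b. P (drop j b # m @ [z @ a @ take j b, []]))"
    using R[of b "z @ a"] by (simp add: wrapping_def butlast_append)
  have 2: "rotation P ((a @ b) # m @ [z]) =
      (\<Sum>j=1..length a. P ((drop j a @ b) # m @ [z @ take j a, []])) +
      (\<Sum>j=1..length b. P (drop j b # m @ [z @ a @ take j b, []]))"
    unfolding R sum_split_append[of "\<lambda>x y. P (y # m @ [z @ x, []])"] by simp
  have "merging (\<lambda>xs. rotation P (a # xs)) (b # m @ [z]) =
      merging (\<lambda>xs. \<Sum>j=1..length a. P (drop j a # butlast xs @ [last xs @ take j a, []])) (b # m @ [z])"
  proof (rule merging_cong)
    fix xs :: "'a list list" assume "Suc (length xs) = length (b # m @ [z])"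
    then show "rotation P (a # xs) = (\<Sum>j=1..length a. P (drop j a # butlast xs @ [last xs @ take j a, []]))"
      by (cases xs) simp_all
  qed
  also have "\<dots> = (\<Sum>j=1..length a. merging (\<lambda>xs. P (drop j a # xs @ [[]])) (b # m @ [z @ take j a]))"
    unfolding merging_sum
  proof (intro sum.cong refl)
    fix j
    show "merging (\<lambda>xs. P (drop j a # butlast xs @ [last xs @ take j a, []])) (b # m @ [z]) =
        merging (\<lambda>xs. P (drop j a # xs @ [[]])) (b # m @ [z @ take j a])"
      using merging_snoc[of "\<lambda>xs. P (drop j a # xs @ [[]])" "b # m" z "take j a"] by simp
  qed
  finally show ?thesis
    unfolding boundary_def 1 merging.simps(1)[of _ a b "m @ [z]"] 2
    by (simp add: sum.distrib sum_subtractf sum_negf)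
qed

lemma splitting_boundary:
  "splitting (boundary P) (a # m @ [z]) + boundary (splitting P) (a # m @ [z]) =
     of_nat (length (concat (a # m @ [z]))) * P (a # m @ [z]) +
     (- 1) ^ Suc (length m) * (\<Sum>j=1..length a. P (m @ [z @ take j a, drop j a]))
     - (\<Sum>j=1..length a. P (drop j a # m @ [z @ take j a]))"
proof -
  have "splitting (boundary P) (a # m @ [z]) =
      splitting (wrapping P) (a # m @ [z]) + splitting (merging P) (a # m @ [z])"
    using splitting_add[of "wrapping P" "merging P" "a # m @ [z]"] unfolding boundary_def .
  moreover have "boundary (splitting P) (a # m @ [z]) =
      wrapping (splitting P) (a # m @ [z]) + merging (splitting P) (a # m @ [z])"
    by (simp add: boundary_def)
  moreover have "splitting (wrapping P) (a # m @ [z]) =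
     (- 1) ^ Suc (length m) * (\<Sum>j=1..length a. P (m @ [z @ take j a, drop j a]))
     - (\<Sum>j=1..length a. P (drop j a # m @ [z @ take j a])) - wrapping (splitting P) (a # m @ [z])"
    unfolding splitting_wrapping[symmetric] by simp
  moreover have "splitting (merging P) (a # m @ [z]) =
      of_nat (length (concat (a # m @ [z]))) * P (a # m @ [z]) - merging (splitting P) (a # m @ [z])"
    unfolding splitting_merging[symmetric] by simp
  ultimately show ?thesis by simp
qed

theorem contraction_boundary:
  fixes P :: "'a list list \<Rightarrow> 'b::comm_ring_1"
  assumes "length as \<ge> 3"
  shows "contraction (boundary P) as + boundary (contraction P) as = of_nat (length (concat as)) * P as"
proof -
  obtain a b c where "as = a # b # c" "c \<noteq> []"
    using assms by (cases as; cases "tl as"; cases "tl (tl as)") auto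
  then obtain m z where as: "as = a # b # m @ [z]"
    by (metis append_butlast_last_id)
  \<comment> \<open>Every face shortens the list by one, which reverses the sign in
    \<open>contraction\<close>.\<close>
  have w: "wrapping (contraction P) as = wrapping (splitting P) as - (- 1) ^ length as * wrapping (rotation P) as"
    unfolding as wrapping_def by (simp add: contraction_def)
  have "merging (contraction P) as = merging (\<lambda>xs. splitting P xs + (- 1) ^ Suc (length as) * rotation P xs) as"
  proof (rule merging_cong)
    fix xs :: "'a list list" assume "Suc (length xs) = length as"
    then show "contraction P xs = splitting P xs + (- 1) ^ Suc (length as) * rotation P xs"
      by (simp add: contraction_def flip: \<open>Suc (length xs) = length as\<close>)
  qed
  then have "merging (contraction P) as = merging (splitting P) as - (- 1) ^ length as * merging (rotation P) as"
    unfolding merging_add merging_cmult by simp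
  then have "boundary (contraction P) as = boundary (splitting P) as - (- 1) ^ length as * boundary (rotation P) as"
    unfolding boundary_def w by (simp add: distrib_left)
  then have "contraction (boundary P) as + boundary (contraction P) as =
      (splitting (boundary P) as + boundary (splitting P) as) + (- 1) ^ length as * (rotation (boundary P) as - boundary (rotation P) as)"
    by (simp add: contraction_def algebra_simps)
  also have "\<dots> = of_nat (length (concat as)) * P as"
    using splitting_boundary[of P a "b # m" z] rotation_boundary[of P a "b # m" z] boundary_rotation[of P a b m z]
    by (simp add: as distrib_left right_diff_distrib flip: mult.assoc power_add
         del: rotation.simps splitting.simps merging.simps)
  finally show ?thesis .
qed

lemma boundary_cong:
  assumes "length as \<ge> 2"
    "\<And>xs. Suc (length xs) = length as \<Longrightarrow> length (concat xs) = length (concat as) \<Longrightarrow> P xs = Q xs"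
  shows "boundary P as = boundary Q as"
proof -
  obtain a m z where as: "as = a # m @ [z]"
    using assms(1) by (cases as; cases "tl as" rule: rev_cases) auto
  have "wrapping P as = wrapping Q as"
    unfolding wrapping_def by (rule assms(2)) (auto simp: as butlast_append)
  then show ?thesis
    using merging_cong[of as P Q] assms(2) by (simp add: boundary_def)
qed

text \<open>After a face only one word is left, on which \<open>rotation\<close> vanishes. So
  nothing cancels the inner face that joins the two words of a rotated pair, and the cyclic
  rotations of \<open>a @ z\<close> at the cuts of \<open>a\<close> remain.\<close>

lemma contraction_boundary_pair:
  "contraction (boundary P) [a, z] + boundary (contraction P) [a, z] =
     of_nat (length (a @ z)) * P [a, z] - (\<Sum>j=1..length a. P [drop j a @ z @ take j a, []])"
proof -
  have "boundary (contraction P) [a, z] = boundary (splitting P) [a, z]"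
    by (rule boundary_cong) (auto simp: contraction_def length_Suc_conv)
  moreover have "rotation (boundary P) [a, z] = (\<Sum>j=1..length a. P [z @ take j a, drop j a])
      + (\<Sum>j=1..length a. P [drop j a, z @ take j a]) - (\<Sum>j=1..length a. P [drop j a @ z @ take j a, []])"
    using rotation_boundary[of P a "[]" z] by (simp add: sum_negf del: rotation.simps)
  moreover have "splitting (boundary P) [a, z] = of_nat (length (a @ z)) * P [a, z]
      - (\<Sum>j=1..length a. P [z @ take j a, drop j a]) - (\<Sum>j=1..length a. P [drop j a, z @ take j a])
      - boundary (splitting P) [a, z]"
    using splitting_boundary[of P a "[]" z] by (simp add: algebra_simps del: splitting.simps)
  ultimately show ?thesis
    by (simp add: contraction_def del: splitting.simps rotation.simps)
qed

section \<open>Lists of empty words and primitives of cocycles\<close>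

lemma contraction_0 [simp]: "contraction (\<lambda>xs. 0 :: 'b::comm_ring_1) as = 0"
proof -
  have "splitting (\<lambda>xs. 0) as = (0 :: 'b)"
    using splitting_cmult[of 0 "\<lambda>xs. 0" as] by simp
  moreover have "rotation (\<lambda>xs. 0) as = (0 :: 'b)"
    by (cases as; cases "tl as") auto
  ultimately show ?thesis by (simp add: contraction_def)
qed

lemma contraction_cong:
  assumes "\<And>xs. length xs = Suc (length as) \<Longrightarrow> P xs = Q xs"
  shows "contraction P as = contraction Q as"
proof -
  have "rotation P as = rotation Q as"
    using assms by (cases "(P, as)" rule: rotation.cases) auto
  then show ?thesis
    using splitting_cong[of as P Q] assms by (simp add: contraction_def)
qed

text \<open>On empty words all inner faces agree, so their alternating sum is 0 or a single
  term.\<close>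

lemma merging_replicate:
  "merging P (replicate (Suc n) []) = (if even n then 0 else - P (replicate n []))"
proof (induction n arbitrary: P)
  case (Suc n)
  from Suc[of "\<lambda>xs. P ([] # xs)"] show ?case by (cases n) auto
qed simp

lemma boundary_replicate:
  fixes P :: "'a list list \<Rightarrow> 'b::comm_ring_1"
  shows "boundary P (replicate (Suc (Suc n)) []) = (if even n then 0 else P (replicate (Suc n) []))"
proof -
  have e: "replicate (Suc (Suc n)) ([] :: 'a list) = [] # replicate n [] @ [[]]"
    by (simp add: replicate_append_same)
  have "wrapping P (replicate (Suc (Suc n)) []) = P (replicate n [] @ [[]])"
    unfolding e wrapping_append by simp
  then have "wrapping P (replicate (Suc (Suc n)) []) = P (replicate (Suc n) [])"
    by (simp add: replicate_append_same)
  then show ?thesis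
    unfolding boundary_def merging_replicate by simp
qed

text \<open>On lists of empty words the differential is alternately 0 and the removal of one entry.\<close>

definition primitive :: "('a list list \<Rightarrow> 'b::field_char_0) \<Rightarrow> 'a list list \<Rightarrow> 'b" where
  "primitive P as = (if concat as = [] then if even (length as) then P ([] # as) else 0
     else contraction P as / of_nat (length (concat as)))"

lemma concat_eq_Nil_replicate: "concat as = [] \<longleftrightarrow> as = replicate (length as) []"
  by (induction as) auto

text \<open>On an even number of empty words the cocycle condition one length higher forces
  \<open>P\<close> to vanish. On an odd number the boundary removes one entry, and this undoes the
  insertion made by \<open>primitive\<close>.\<close>

lemma boundary_primitive_Nil:
  assumes "\<And>xs. length xs = Suc (length as) \<Longrightarrow> boundary P xs = 0" "length as \<ge> 2" "concat as = []"
  shows "boundary (primitive P) as = P as"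
proof -
  obtain n where n: "length as = Suc (Suc n)"
    using assms(2) by (metis Suc_le_D numeral_2_eq_2 Suc_le_mono)
  then have as: "as = replicate (Suc (Suc n)) []" using assms(3) by (metis concat_eq_Nil_replicate)
  have "boundary P (replicate (Suc (Suc (Suc n))) []) = 0" by (rule assms(1)) (simp only: n length_replicate)
  then have "odd n \<or> P (replicate (Suc (Suc n)) []) = 0"
    unfolding boundary_replicate[of P "Suc n"] by (simp split: if_splits)
  moreover have "primitive P (replicate (Suc n) []) = (if odd n then P (replicate (Suc (Suc n)) []) else 0)"
    by (simp add: primitive_def)
  ultimately show ?thesis
    unfolding as boundary_replicate by (cases "even n") (simp_all del: replicate.simps)
qed

text \<open>The divisor in \<open>primitive\<close> depends on the list, but the faces keep the
  number of letters, so it is one constant on all lists that the boundary at \<open>as\<close>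
  involves.\<close>

lemma boundary_primitive_aux:
  assumes "\<And>xs. length xs = Suc (length as) \<Longrightarrow> boundary P xs = 0" "length as \<ge> 2" "concat as \<noteq> []"
  shows "boundary (primitive P) as * of_nat (length (concat as)) =
    contraction (boundary P) as + boundary (contraction P) as"
proof -
  define c :: 'b where "c = 1 / of_nat (length (concat as))"
  have c: "c * of_nat (length (concat as)) = 1" using assms(3) unfolding c_def by auto
  have "boundary (primitive P) as = boundary (\<lambda>xs. c * contraction P xs) as"
  proof (rule boundary_cong[OF assms(2)])
    fix xs :: "'a list list" assume l: "length (concat xs) = length (concat as)"
    then have "concat xs \<noteq> []" using assms(3) by (metis length_0_conv)
    then show "primitive P xs = c * contraction P xs"
      unfolding primitive_def l c_def by (simp only: if_False times_divide_eq_left mult_1_left)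
  qed
  then have "boundary (primitive P) as = c * boundary (contraction P) as"
    unfolding boundary_def merging_cmult by (simp add: wrapping_def distrib_left)
  moreover have "contraction (boundary P) as = 0"
    using contraction_cong[of as "boundary P" "\<lambda>xs. 0"] assms(1) by simp
  ultimately show ?thesis using c by simp
qed

theorem boundary_primitive:
  assumes "\<And>xs. length xs = Suc (length as) \<Longrightarrow> boundary P xs = 0" "length as \<ge> 3"
  shows "boundary (primitive P) as = P as"
proof (cases "concat as = []")
  case False
  have "boundary (primitive P) as * of_nat (length (concat as)) = of_nat (length (concat as)) * P as"
    using boundary_primitive_aux[OF assms(1) _ False] contraction_boundary[OF assms(2), of P] assms(2) by simp
  then show ?thesis using False by (simp del: length_concat concat_eq_Nil_conv)
next
  case True
  show ?thesis
    by (rule boundary_primitive_Nil) (use assms True in auto)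
qed

theorem boundary_primitive_pair:
  assumes "\<And>xs. length xs = 3 \<Longrightarrow> boundary P xs = 0"
  shows "boundary (primitive P) [a, z] =
    P [a, z] - (\<Sum>j=1..length a. P [drop j a @ z @ take j a, []]) / of_nat (length (a @ z))"
proof (cases "a @ z = []")
  case False
  have "boundary (primitive P) [a, z] * of_nat (length (concat [a, z])) =
      contraction (boundary P) [a, z] + boundary (contraction P) [a, z]"
    by (rule boundary_primitive_aux) (use assms False in auto)
  then have "boundary (primitive P) [a, z] * of_nat (length (a @ z)) =
      of_nat (length (a @ z)) * P [a, z] - (\<Sum>j=1..length a. P [drop j a @ z @ take j a, []])"
    unfolding contraction_boundary_pair by simp
  moreover have "of_nat (length (a @ z)) \<noteq> (0 :: 'b)"
    using False by (simp del: of_nat_add length_append)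
  ultimately show ?thesis
    by (simp add: field_simps del: of_nat_add length_append)
next
  case True
  have "boundary (primitive P) [a, z] = P [a, z]"
    by (rule boundary_primitive_Nil) (use assms True in auto)
  \<comment> \<open>Here the correction is an empty sum.\<close>
  with True show ?thesis by simp
qed

subsection \<open>Functionals on the tensor algebra and its tensor powers\<close>

text \<open>Arguments outside the \<open>k\<close>-th power go to 0, which makes the inclusion of
  that power a total function.\<close>

lift_definition homogeneous_element :: "nat \<Rightarrow> 'v::complex_normed_vector ptensor \<Rightarrow> 'v tensor_algebra"
  is "\<lambda>k x i. if i = k \<and> x \<in> ptensor_power k then x else 0"
  by (auto intro!: summable_finite[of "{k}" for k] split: if_splits)

definition word :: "'v::complex_normed_vector list \<Rightarrow> 'v tensor_algebra" where
  "word w = homogeneous_element (length w) (tensor w)"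

lemma component_homogeneous:
  "x \<in> ptensor_power k \<Longrightarrow> component (homogeneous_element k x) i = (if i = k then x else 0)"
  by transfer simp

lemma component_word: "component (word w) i = (if i = length w then tensor w else 0)"
  by (simp add: word_def component_homogeneous tensor_in_power)

lemma norm_homogeneous:
  assumes "x \<in> ptensor_power k" shows "norm (homogeneous_element k x) = norm x"
proof -
  have "(\<lambda>i. norm (component (homogeneous_element k x) i)) = (\<lambda>i. if i = k then norm x else 0)"
    using assms by (auto simp: component_homogeneous)
  then show ?thesis
    using sums_unique[OF sums_single[of k "\<lambda>_. norm x"]] by (simp add: norm_tensor_algebra_def)
qed

lemma norm_word_le: "norm (word w) \<le> prod_list (map norm w)"
  unfolding word_def by (simp add: norm_homogeneous tensor_in_power norm_tensor_le)

lemma tensor_Nil: "tensor [] = 1"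
  unfolding formal_tensor_1[symmetric] tensor_def by (simp flip: zero_list_def)

lemma word_Nil: "word [] = 1"
  by (rule tensor_algebra_eqI) (simp add: component_word component_1 tensor_Nil)

text \<open>Only one term of the Cauchy product is nonzero. With \<open>word_Nil\<close> this makes
  \<open>word\<close> a monoid homomorphism, which turns the Hochschild faces into operations on
  lists of words.\<close>

lemma word_append: "word (xs @ ys) = word xs * word ys"
proof (rule tensor_algebra_eqI)
  fix k
  have "component (word xs * word ys) k =
      (\<Sum>i\<le>k. if i = length xs then (if k = length xs + length ys then tensor (xs @ ys) else 0) else 0)"
    unfolding component_mult by (intro sum.cong) (auto simp: component_word tensor_append)
  then show "component (word (xs @ ys)) k = component (word xs * word ys) k"
    by (auto simp: component_word)
qed

lemma multilinear_word: "multilinear (word :: 'v::complex_normed_vector list \<Rightarrow> _)"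
  using multilinear_tensor[where 'v = 'v]
  by (auto simp: multilinear_def component_word component_add component_scaleC intro!: tensor_algebra_eqI)

section \<open>Bounded linear maps on the tensor algebra as functions of words\<close>

lemma bounded_clinear_onD:
  assumes "bounded_clinear_on UNIV g"
  shows "g (x + y) = g x + g y" "g (c *\<^sub>C x) = c *\<^sub>C g x"
  using assms by (auto simp: bounded_clinear_on_def)

lemma bounded_clinear_on_imp_bounded_linear:
  assumes "bounded_clinear_on UNIV g" shows "bounded_linear g"
proof -
  obtain K where "\<And>x. norm (g x) \<le> K * norm x" using assms by (auto simp: bounded_clinear_on_def)
  with bounded_clinear_onD[OF assms] show ?thesis
    by (intro bounded_linear_intro[where K = K]) (auto simp: scaleR_scaleC mult.commute)
qed

text \<open>In an l1-sum the norm of a tail is exactly the whole norm minus the partial sum of the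
  norms.\<close>

lemma homogeneous_elements_sums:
  "(\<lambda>n. \<Sum>k<n. homogeneous_element k (component a k)) \<longlonglongrightarrow> a"
proof -
  let ?S = "\<lambda>n. \<Sum>k<n. homogeneous_element k (component a k)"
  have c: "component (?S n) i = (if i < n then component a i else 0)" for n i
    by (induction n) (auto simp: component_0 component_add component_homogeneous component_in_power less_Suc_eq)
  have n: "norm (?S n - a) = norm a - (\<Sum>k<n. norm (component a k))" for n
  proof -
    have "(\<lambda>i. norm (component (?S n - a) i)) =
        (\<lambda>i. norm (component a i) - (if i \<in> {..<n} then norm (component a i) else 0))"
      by (auto simp: component_diff c)
    moreover have "(\<lambda>i. norm (component a i) - (if i \<in> {..<n} then norm (component a i) else 0)) sums
        (norm a - (\<Sum>k<n. norm (component a k)))"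
      unfolding norm_tensor_algebra_def
      by (intro sums_diff summable_sums component_summable sums_If_finite_set) auto
    ultimately show ?thesis
      unfolding norm_tensor_algebra_def[of "?S n - a"] by (simp add: sums_iff)
  qed
  have "(\<lambda>n. \<Sum>k<n. norm (component a k)) \<longlonglongrightarrow> norm a"
    unfolding norm_tensor_algebra_def by (rule summable_LIMSEQ[OF component_summable])
  from tendsto_diff[OF tendsto_const[of "norm a"] this]
  have "(\<lambda>n. norm (?S n - a)) \<longlonglongrightarrow> 0" by (simp add: n)
  then show ?thesis by (simp add: LIM_zero_iff tendsto_norm_zero_iff)
qed

text \<open>The span of the words is dense: elementary tensors span a dense subspace of each power,
  and truncations converge.\<close>

lemma word_functional_unique:
  fixes g h :: "'v::complex_normed_vector tensor_algebra \<Rightarrow> 'w::complex_normed_vector"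
  assumes g: "bounded_clinear_on UNIV g" and h: "bounded_clinear_on UNIV h"
    and eq: "\<And>w. g (word w) = h (word w)"
  shows "g = h"
proof
  have ho: "bounded_clinear_on (ptensor_power k) (\<lambda>x. f (homogeneous_element k x))"
    if f: "bounded_clinear_on UNIV f" for f :: "'v tensor_algebra \<Rightarrow> 'w" and k
    unfolding bounded_clinear_on_def
  proof (intro conjI ballI allI)
    fix x y :: "'v ptensor" and c assume x: "x \<in> ptensor_power k" and y: "y \<in> ptensor_power k"
    have "homogeneous_element k (x + y) = homogeneous_element k x + homogeneous_element k y"
      using x y ptensor_power_add[OF x y]
      by (auto intro!: tensor_algebra_eqI simp: component_homogeneous component_add)
    then show "f (homogeneous_element k (x + y)) = f (homogeneous_element k x) + f (homogeneous_element k y)"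
      by (simp add: bounded_clinear_onD[OF f])
  next
    fix x :: "'v ptensor" and c assume x: "x \<in> ptensor_power k"
    have "homogeneous_element k (c *\<^sub>C x) = c *\<^sub>C homogeneous_element k x"
      using x ptensor_power_scaleC[OF x]
      by (auto intro!: tensor_algebra_eqI simp: component_homogeneous component_scaleC)
    then show "f (homogeneous_element k (c *\<^sub>C x)) = c *\<^sub>C f (homogeneous_element k x)"
      by (simp add: bounded_clinear_onD[OF f])
  next
    obtain K where K: "\<And>x. norm (f x) \<le> K * norm x" using f by (auto simp: bounded_clinear_on_def)
    have "norm (f (homogeneous_element k x)) \<le> K * norm x" if "x \<in> ptensor_power k" for x
      using K[of "homogeneous_element k x"] that by (simp add: norm_homogeneous)
    then show "\<exists>K. \<forall>x\<in>ptensor_power k. norm (f (homogeneous_element k x)) \<le> K * norm x" by blast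
  qed
  have he: "g (homogeneous_element k x) = h (homogeneous_element k x)" if "x \<in> ptensor_power k" for k x
  proof -
    have "g (homogeneous_element k (tensor vs)) = h (homogeneous_element k (tensor vs))" if "length vs = k" for vs
      using eq[of vs] unfolding word_def that .
    then show ?thesis
      using bounded_clinear_on_ptensor_power_unique[of k "\<lambda>x. g (homogeneous_element k x)" "\<lambda>x. h (homogeneous_element k x)" x]
        ho[OF g, of k] ho[OF h, of k] \<open>x \<in> ptensor_power k\<close> by blast
  qed
  interpret g: bounded_linear g by (rule bounded_clinear_on_imp_bounded_linear[OF g])
  interpret h: bounded_linear h by (rule bounded_clinear_on_imp_bounded_linear[OF h])
  fix a
  have e: "h (\<Sum>k<n. homogeneous_element k (component a k)) = g (\<Sum>k<n. homogeneous_element k (component a k))" for n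
    unfolding g.sum h.sum by (intro sum.cong refl he[symmetric] component_in_power)
  show "g a = h a"
    using g.tendsto[OF homogeneous_elements_sums[of a]] h.tendsto[OF homogeneous_elements_sums[of a]]
    unfolding e by (rule LIMSEQ_unique)
qed

text \<open>The universal property of the l1-sum: the bound \<open>C\<close> is the same in all
  degrees, so the images of the components are summable, with total norm at most
  \<open>C * norm a\<close>.\<close>

lemma word_functional_exists:
  fixes f :: "'v::complex_normed_vector list \<Rightarrow> 'w::complex_banach"
  assumes f: "multilinear f" and C: "C \<ge> 0" "\<And>w. norm (f w) \<le> C * prod_list (map norm w)"
  obtains g where "bounded_clinear_on UNIV g" "\<And>a. norm (g a) \<le> C * norm a" "\<And>w. g (word w) = f w"
proof -
  obtain f' where f': "\<And>x y. f' (x + y) = f' x + f' y" "\<And>c x. f' (c *\<^sub>C x) = c *\<^sub>C f' x"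
    "\<And>x. norm (f' x) \<le> C * norm x" "\<And>u. f' (abs_alg_tensor u) = formal_ext f u"
    by (rule formal_ext_alg[OF f C]) auto
  obtain F where F: "\<And>x y. F (x + y) = F x + F y" "\<And>c x. F (c *\<^sub>C x) = c *\<^sub>C F x"
    "\<And>x. norm (F x) \<le> C * norm x" "\<And>x. F (to_completion x) = f' x"
    by (rule completion_ext[OF f'(1-3)]) auto
  have Ft: "F (tensor w) = f w" for w
    by (simp add: tensor_def formal_tensor_def F f' formal_ext_single)
  have F0: "F 0 = 0" using F(3)[of 0] by simp
  have sn: "summable (\<lambda>k. norm (F (component a k)))" for a
    by (rule summable_comparison_test'[OF summable_mult[OF component_summable[of a], of C]]) (simp add: F(3))
  have s: "summable (\<lambda>k. F (component a k))" for a
    by (rule summable_norm_cancel[OF sn])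
  define g where "g a = suminf (\<lambda>k. F (component a k))" for a
  have n: "norm (g a) \<le> C * norm a" for a
  proof -
    have "norm (g a) \<le> suminf (\<lambda>k. norm (F (component a k)))"
      unfolding g_def by (rule summable_norm[OF sn])
    also have "\<dots> \<le> suminf (\<lambda>k. C * norm (component a k))"
      by (intro suminf_le F(3) sn summable_mult component_summable)
    also have "\<dots> = C * norm a"
      unfolding norm_tensor_algebra_def by (rule suminf_mult[OF component_summable])
    finally show ?thesis .
  qed
  show ?thesis
  proof (rule that[OF _ n])
    show "bounded_clinear_on UNIV g"
      unfolding bounded_clinear_on_def
    proof (intro conjI ballI allI exI)
      fix a b c
      show "g (a + b) = g a + g b"
        unfolding g_def component_add F by (rule suminf_add[OF s s, symmetric])
      show "g (c *\<^sub>C a) = c *\<^sub>C g a"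
        unfolding g_def component_scaleC F
        using bounded_linear.suminf[OF bounded_linear_scaleC s] by metis
      show "norm (g a) \<le> C * norm a" by (rule n)
    qed
    fix w
    have "(\<lambda>k. F (component (word w) k)) = (\<lambda>k. if k = length w then f w else 0)"
      by (auto simp: component_word Ft F0)
    then show "g (word w) = f w"
      using sums_unique[OF sums_single[of "length w" "\<lambda>_. f w"]] by (simp add: g_def)
  qed
qed

text \<open>A definite description is total in \<open>f\<close>, so \<open>multi_extension\<close>
  can recurse through it before the functions involved are known to be multilinear.\<close>

definition word_extension :: "('v::complex_normed_vector list \<Rightarrow> 'w::complex_banach) \<Rightarrow> 'v tensor_algebra \<Rightarrow> 'w" where
  "word_extension f = (THE g. bounded_clinear_on UNIV g \<and> (\<forall>w. g (word w) = f w))"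

lemma word_extension_eq:
  assumes "bounded_clinear_on UNIV g" "\<And>w. g (word w) = f w"
  shows "word_extension f = g"
  unfolding word_extension_def using assms by (intro the_equality) (auto intro!: word_functional_unique)

lemma word_extension:
  fixes f :: "'v::complex_normed_vector list \<Rightarrow> 'w::complex_banach"
  assumes "multilinear f" "C \<ge> 0" "\<And>w. norm (f w) \<le> C * prod_list (map norm w)"
  shows "bounded_clinear_on UNIV (word_extension f)" "norm (word_extension f a) \<le> C * norm a"
    "word_extension f (word w) = f w"
proof -
  obtain g where g: "bounded_clinear_on UNIV g" "\<And>a. norm (g a) \<le> C * norm a" "\<And>w. g (word w) = f w"
    using word_functional_exists[OF assms] by blast
  with word_extension_eq[of g f] show "bounded_clinear_on UNIV (word_extension f)"
    "norm (word_extension f a) \<le> C * norm a" "word_extension f (word w) = f w" by auto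
qed

section \<open>Extension of bounded forms in several words\<close>

lemma bounded_clinear_on_combination:
  assumes "bounded_clinear_on S f" "bounded_clinear_on S g"
  shows "bounded_clinear_on S (\<lambda>x. c *\<^sub>C f x + d *\<^sub>C g x)"
proof -
  obtain K where K: "\<And>x. x \<in> S \<Longrightarrow> norm (f x) \<le> K * norm x"
    using assms(1) unfolding bounded_clinear_on_def by blast
  obtain L where L: "\<And>x. x \<in> S \<Longrightarrow> norm (g x) \<le> L * norm x"
    using assms(2) unfolding bounded_clinear_on_def by blast
  have "norm (c *\<^sub>C f x + d *\<^sub>C g x) \<le> (cmod c * K + cmod d * L) * norm x" if "x \<in> S" for x
  proof -
    have "norm (c *\<^sub>C f x + d *\<^sub>C g x) \<le> cmod c * norm (f x) + cmod d * norm (g x)"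
      by (rule norm_triangle_le) (simp add: norm_scaleC)
    also have "\<dots> \<le> cmod c * (K * norm x) + cmod d * (L * norm x)"
      by (intro add_mono mult_left_mono K L that) auto
    finally show ?thesis by (simp add: algebra_simps)
  qed
  moreover have "c *\<^sub>C f (x + y) + d *\<^sub>C g (x + y) = (c *\<^sub>C f x + d *\<^sub>C g x) + (c *\<^sub>C f y + d *\<^sub>C g y)"
    if "x \<in> S" "y \<in> S" for x y
    using assms that by (simp add: bounded_clinear_on_def scaleC_add_right)
  moreover have "c *\<^sub>C f (z *\<^sub>C x) + d *\<^sub>C g (z *\<^sub>C x) = z *\<^sub>C (c *\<^sub>C f x + d *\<^sub>C g x)" if "x \<in> S" for x z
    using assms that by (simp add: bounded_clinear_on_def scaleC_add_right scaleC_scaleC mult.commute)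
  ultimately show ?thesis unfolding bounded_clinear_on_def by blast
qed

definition entrywise_multilinear :: "('v::complex_normed_vector list list \<Rightarrow> 'w::complex_normed_vector) \<Rightarrow> bool" where
  "entrywise_multilinear P \<longleftrightarrow> (\<forall>us vs. multilinear (\<lambda>w. P (us @ w # vs)))"

text \<open>In each length, these are the restrictions to words of bounded functionals on the tensor
  power, by \<open>word_form_on_words\<close> and \<open>word_form_functional\<close>.\<close>

definition word_form :: "real \<Rightarrow> ('v::complex_normed_vector list list \<Rightarrow> complex) \<Rightarrow> bool" where
  "word_form C P \<longleftrightarrow> entrywise_multilinear P \<and> (\<forall>ws. cmod (P ws) \<le> C * prod_list (map norm (concat ws)))"

lemma word_form_multilinear: "word_form C P \<Longrightarrow> multilinear (\<lambda>w. P (us @ w # vs))"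
  by (simp add: word_form_def entrywise_multilinear_def)

lemma word_form_bound: "word_form C P \<Longrightarrow> cmod (P ws) \<le> C * prod_list (map norm (concat ws))"
  by (simp add: word_form_def)

lemma word_form_nonneg: "word_form C P \<Longrightarrow> C \<ge> 0"
  using order_trans[OF norm_ge_zero word_form_bound[of C P "[]"]] by simp

lemma word_form_Cons:
  assumes "word_form C P"
  shows "word_form (C * prod_list (map norm w)) (\<lambda>ws. P (w # ws))"
  unfolding word_form_def entrywise_multilinear_def
proof (intro conjI allI)
  fix us vs ws
  show "multilinear (\<lambda>x. P (w # us @ x # vs))"
    using word_form_multilinear[OF assms, of "w # us" vs] by simp
  show "cmod (P (w # ws)) \<le> C * prod_list (map norm w) * prod_list (map norm (concat ws))"
    using word_form_bound[OF assms, of "w # ws"] by (simp add: mult_ac)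
qed

text \<open>\<open>E\<close> stands for the extension in the remaining arguments. It is kept
  abstract because the fact is used inside the induction of \<open>multi_extension_aux\<close>,
  where linearity is the induction hypothesis, and again afterwards.\<close>

lemma multilinear_first_word:
  fixes E :: "('v::complex_normed_vector list list \<Rightarrow> complex) \<Rightarrow> complex"
  assumes P: "word_form C P"
    and lin: "\<And>C D P Q c d. word_form C P \<Longrightarrow> word_form D Q \<Longrightarrow> E (\<lambda>ws. c * P ws + d * Q ws) = c * E P + d * E Q"
  shows "multilinear (\<lambda>w. E (\<lambda>ws. P (w # ws)))"
  unfolding multilinear_def
proof (intro allI conjI)
  fix xs ys :: "'v list" and a b and z :: complex
  have m: "multilinear (\<lambda>w. P (w # ws))" for ws
    using word_form_multilinear[OF P, of "[]" ws] by simp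
  have "(\<lambda>ws. P ((xs @ (a + b) # ys) # ws)) = (\<lambda>ws. 1 * P ((xs @ a # ys) # ws) + 1 * P ((xs @ b # ys) # ws))"
    using m by (simp add: multilinear_def)
  then show "E (\<lambda>ws. P ((xs @ (a + b) # ys) # ws)) = E (\<lambda>ws. P ((xs @ a # ys) # ws)) + E (\<lambda>ws. P ((xs @ b # ys) # ws))"
    using lin[OF word_form_Cons[OF P, of "xs @ a # ys"] word_form_Cons[OF P, of "xs @ b # ys"], of 1 1] by simp
  have "(\<lambda>ws. P ((xs @ (z *\<^sub>C a) # ys) # ws)) = (\<lambda>ws. z * P ((xs @ a # ys) # ws) + 0 * P ((xs @ a # ys) # ws))"
    using m by (simp add: multilinear_def scaleC_complex_def)
  then show "E (\<lambda>ws. P ((xs @ (z *\<^sub>C a) # ys) # ws)) = z *\<^sub>C E (\<lambda>ws. P ((xs @ a # ys) # ws))"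
    using lin[OF word_form_Cons[OF P, of "xs @ a # ys"] word_form_Cons[OF P, of "xs @ a # ys"], of z 0]
    by (simp add: scaleC_complex_def)
qed

fun multi_extension :: "('v::complex_normed_vector list list \<Rightarrow> complex) \<Rightarrow> 'v tensor_algebra list \<Rightarrow> complex" where
  "multi_extension P [] = P []"
| "multi_extension P (a # as) = word_extension (\<lambda>w. multi_extension (\<lambda>ws. P (w # ws)) as) a"

text \<open>Bound and linearity in \<open>P\<close> depend on each other: to extend in the first
  argument, the extension in the others must be bounded and multilinear as a function of the first
  word, and this multilinearity comes from linearity in \<open>P\<close>.\<close>

lemma multi_extension_aux:
  "(\<forall>C P. word_form C P \<longrightarrow> cmod (multi_extension P as) \<le> C * prod_list (map norm as)) \<and>
   (\<forall>C D P Q c d. word_form C P \<longrightarrow> word_form D Q \<longrightarrow>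
     multi_extension (\<lambda>ws. c * P ws + d * Q ws) as = c * multi_extension P as + d * multi_extension Q as)"
   (is "?bound as \<and> ?linear as")
proof (induction as)
  case (Cons a as)
  let ?f = "\<lambda>P w. multi_extension (\<lambda>ws. P (w # ws)) as"
  have ml: "multilinear (?f P)" if "word_form C P" for C P
    by (rule multilinear_first_word[OF that]) (rule Cons.IH[THEN conjunct2, rule_format])
  have bd: "cmod (?f P w) \<le> (C * prod_list (map norm as)) * prod_list (map norm w)" if P: "word_form C P" for C P w
    using Cons.IH[THEN conjunct1, rule_format, OF word_form_Cons[OF P, of w]] by (simp add: mult_ac)
  have nn: "0 \<le> C * prod_list (map norm as)" if P: "word_form C P" for C and P :: "'a list list \<Rightarrow> complex"
    using word_form_nonneg[OF P] by simp
  note we = word_extension[OF ml nn bd]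
  show ?case
  proof (intro conjI allI impI)
    fix C and P :: "'a list list \<Rightarrow> complex" assume P: "word_form C P"
    show "cmod (multi_extension P (a # as)) \<le> C * prod_list (map norm (a # as))"
      using we(2)[OF P P P, of a] by (simp add: mult_ac)
  next
    fix C D c d and P Q :: "'a list list \<Rightarrow> complex" assume P: "word_form C P" and Q: "word_form D Q"
    let ?g = "\<lambda>x. c *\<^sub>C word_extension (?f P) x + d *\<^sub>C word_extension (?f Q) x"
    \<comment> \<open>Both sides are bounded linear in the first argument and agree on
      words.\<close>
    have "word_extension (\<lambda>w. ?f (\<lambda>ws. c * P ws + d * Q ws) w) = ?g"
    proof (rule word_extension_eq)
      show "bounded_clinear_on UNIV ?g"
        by (intro bounded_clinear_on_combination we(1)[OF P P P] we(1)[OF Q Q Q])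
      fix w
      have "?f (\<lambda>ws. c * P ws + d * Q ws) w = c * ?f P w + d * ?f Q w"
        by (rule Cons.IH[THEN conjunct2, rule_format, OF word_form_Cons[OF P] word_form_Cons[OF Q]])
      then show "?g (word w) = ?f (\<lambda>ws. c * P ws + d * Q ws) w"
        by (simp add: we(3)[OF P P P] we(3)[OF Q Q Q] scaleC_complex_def)
    qed
    then show "multi_extension (\<lambda>ws. c * P ws + d * Q ws) (a # as) =
        c * multi_extension P (a # as) + d * multi_extension Q (a # as)"
      by (simp add: scaleC_complex_def)
  qed
next
  case Nil
  have "cmod (P []) \<le> C" if "word_form C P" for C and P :: "'a list list \<Rightarrow> complex"
    using word_form_bound[OF that, of "[]"] by simp
  then show ?case by simp
qed

lemma multi_extension_bound:
  "word_form C P \<Longrightarrow> cmod (multi_extension P as) \<le> C * prod_list (map norm as)"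
  by (rule multi_extension_aux[THEN conjunct1, rule_format])

lemma multi_extension_combination:
  "word_form C P \<Longrightarrow> word_form D Q \<Longrightarrow>
     multi_extension (\<lambda>ws. c * P ws + d * Q ws) as = c * multi_extension P as + d * multi_extension Q as"
  by (rule multi_extension_aux[THEN conjunct2, rule_format])

lemma multi_extension_Cons:
  assumes P: "word_form C P"
  shows "multilinear (\<lambda>w. multi_extension (\<lambda>ws. P (w # ws)) as)"
    and "bounded_clinear_on UNIV (\<lambda>a. multi_extension P (a # as))"
    and "multi_extension P (word w # as) = multi_extension (\<lambda>ws. P (w # ws)) as"
proof -
  let ?f = "\<lambda>w. multi_extension (\<lambda>ws. P (w # ws)) as"
  show m: "multilinear ?f"
    by (rule multilinear_first_word[OF P]) (rule multi_extension_combination)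
  have b: "cmod (?f w) \<le> (C * prod_list (map norm as)) * prod_list (map norm w)" for w
    using multi_extension_bound[OF word_form_Cons[OF P, of w], of as] by (simp add: mult_ac)
  have n: "0 \<le> C * prod_list (map norm as)"
    using word_form_nonneg[OF P] by simp
  show "bounded_clinear_on UNIV (\<lambda>a. multi_extension P (a # as))"
    using word_extension(1)[OF m n b] by simp
  show "multi_extension P (word w # as) = ?f w"
    using word_extension(3)[OF m n b] by simp
qed

lemma multi_extension_words: "word_form C P \<Longrightarrow> multi_extension P (map word ws) = P ws"
proof (induction ws arbitrary: C P)
  case (Cons w ws)
  then show ?case
    using Cons.IH[OF word_form_Cons[OF Cons.prems]] by (simp only: list.map multi_extension_Cons(3)[OF Cons.prems])
qed simp

text \<open>In the first argument this is linearity of \<open>word_extension\<close>. In a later one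
  it holds by induction when the first argument is a word, and uniqueness of the extension carries
  it to all first arguments.\<close>

lemma multi_extension_multilinear: "word_form C P \<Longrightarrow> multilinear (multi_extension P)"
proof -
  have "multi_extension P (xs @ (a + b) # ys) = multi_extension P (xs @ a # ys) + multi_extension P (xs @ b # ys) \<and>
      multi_extension P (xs @ (z *\<^sub>C a) # ys) = z *\<^sub>C multi_extension P (xs @ a # ys)"
    if "word_form C P" for xs a b ys z C and P :: "'a list list \<Rightarrow> complex"
    using that
  proof (induction xs arbitrary: C P)
    case Nil
    show ?case
      using bounded_clinear_onD[OF multi_extension_Cons(2)[OF Nil]] by (simp only: append_Nil)
  next
    case (Cons x xs)
    let ?f = "\<lambda>c w. multi_extension (\<lambda>ws. P (w # ws)) (xs @ c # ys)"
    let ?e = "\<lambda>c. word_extension (?f c)"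
    have e: "multi_extension P ((x # xs) @ c # ys) = ?e c x" for c by simp
    have w: "?e c (word w) = ?f c w" for c w
      using multi_extension_Cons(3)[OF Cons.prems, of w "xs @ c # ys"] by simp
    have bl: "bounded_clinear_on UNIV (?e c)" for c
      using multi_extension_Cons(2)[OF Cons.prems, of "xs @ c # ys"] by simp
    have "?e (a + b) = (\<lambda>x. 1 *\<^sub>C ?e a x + 1 *\<^sub>C ?e b x)"
      by (rule word_extension_eq[OF bounded_clinear_on_combination[OF bl bl]])
         (simp only: w scaleC_one Cons.IH[OF word_form_Cons[OF Cons.prems]])
    moreover have "?e (z *\<^sub>C a) = (\<lambda>x. z *\<^sub>C ?e a x + 0 *\<^sub>C ?e a x)"
      by (rule word_extension_eq[OF bounded_clinear_on_combination[OF bl bl]])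
         (simp only: w scaleC_zero_left add_0_right Cons.IH[OF word_form_Cons[OF Cons.prems]])
    ultimately show ?case
      unfolding e by simp
  qed
  then show "word_form C P \<Longrightarrow> multilinear (multi_extension P)"
    unfolding multilinear_def by blast
qed

text \<open>Passes the constant from elementary tensors to the whole power, which
  \<open>ptensor_power_universal\<close> does not record; the estimates of class norms depend on
  it.\<close>

lemma ptensor_power_norm_bound:
  fixes D :: "'v::complex_normed_vector ptensor \<Rightarrow> 'w::complex_normed_vector"
  assumes D: "bounded_clinear_on (ptensor_power k) D" and C: "C \<ge> 0"
    and b: "\<And>vs. length vs = k \<Longrightarrow> norm (D (tensor vs)) \<le> C * prod_list (map norm vs)"
    and x: "x \<in> ptensor_power k"
  shows "norm (D x) \<le> C * norm x"
proof -
  \<comment> \<open>Other degrees get the value 0, because \<open>norm_formal_ext_le\<close> is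
    about functions that are multilinear in all degrees.\<close>
  let ?\<Phi> = "\<lambda>vs. if length vs = k then D (tensor vs) else 0"
  have t: "tensor vs \<in> ptensor_power k" if "length vs = k" for vs :: "'v list"
    using tensor_in_power[of vs] that by simp
  have m: "multilinear ?\<Phi>"
    using multilinear_tensor[where 'v = 'v] D t unfolding multilinear_def bounded_clinear_on_def by simp
  have n: "norm (D (formal_tensor u)) \<le> C * norm (formal_tensor u)" if u: "homogeneous k u" for u
  proof -
    have "D (formal_tensor u) = formal_ext ?\<Phi> u"
      unfolding bounded_clinear_on_formal_tensor[OF D u] formal_ext_def
      using u by (intro sum.cong) (auto simp: homogeneous_def)
    then show ?thesis
      using norm_formal_ext_le[OF m C, of u] b by (simp add: norm_formal_tensor C)
  qed
  from x obtain u where u: "\<And>n. homogeneous k (u n)" "(\<lambda>n. formal_tensor (u n)) \<longlonglongrightarrow> x"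
    unfolding ptensor_power_sequence by blast
  from bounded_clinear_on_LIMSEQ[OF D x u] n[OF u(1)] show ?thesis
    by (intro LIMSEQ_le[OF tendsto_norm tendsto_mult_left[OF tendsto_norm[OF u(2)]]]) auto
qed

text \<open>The way back from lists to cochains: the primitives of cocycles and the cocycle of a
  trace are formulas on words that become bounded functionals through it.\<close>

lemma word_form_functional:
  fixes P :: "'v::complex_normed_vector list list \<Rightarrow> complex"
  assumes P: "word_form C P"
  obtains f where "f \<in> dual_space (ptensor_power n)" "\<And>x. x \<in> ptensor_power n \<Longrightarrow> cmod (f x) \<le> C * norm x"
    "\<And>ws. length ws = n \<Longrightarrow> f (tensor (map word ws)) = P ws"
proof -
  have "multilinear_at n (multi_extension P)"
    using multi_extension_multilinear[OF P] by (auto simp: multilinear_def multilinear_at_def)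
  from ptensor_power_universal[OF this multi_extension_bound[OF P]]
  obtain f where f: "bounded_clinear_on (ptensor_power n) f" "\<forall>x. x \<notin> ptensor_power n \<longrightarrow> f x = 0"
    "\<And>as. length as = n \<Longrightarrow> f (tensor as) = multi_extension P as" by blast
  show ?thesis
  proof (rule that[of f])
    show "f \<in> dual_space (ptensor_power n)" using f by (simp add: dual_space_def)
    show "cmod (f x) \<le> C * norm x" if "x \<in> ptensor_power n" for x
      by (rule ptensor_power_norm_bound[OF f(1) word_form_nonneg[OF P] _ that])
         (simp add: f(3) multi_extension_bound[OF P])
    show "f (tensor (map word ws)) = P ws" if "length ws = n" for ws
      using that by (simp add: f(3) multi_extension_words[OF P])
  qed
qed

lemma functional_words_unique:
  fixes f g :: "'v::complex_normed_vector tensor_algebra ptensor \<Rightarrow> complex"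
  assumes f: "f \<in> dual_space (ptensor_power n)" and g: "g \<in> dual_space (ptensor_power n)"
    and eq: "\<And>ws. length ws = n \<Longrightarrow> f (tensor (map word ws)) = g (tensor (map word ws))"
  shows "f = g"
proof
  fix x
  have fb: "bounded_clinear_on (ptensor_power n) f" and gb: "bounded_clinear_on (ptensor_power n) g"
    using f g by (auto simp: dual_space_def)
  have bl: "bounded_clinear_on UNIV (\<lambda>a. h (tensor (us @ a # vs)))"
    if h: "bounded_clinear_on (ptensor_power n) h" and l: "length us + length vs + 1 = n"
    for us vs and h :: "'v tensor_algebra ptensor \<Rightarrow> complex"
  proof -
    have t: "tensor (us @ a # vs) \<in> ptensor_power n" for a
      using tensor_in_power[of "us @ a # vs"] l by (simp add: add_ac)
    obtain K where K: "\<And>x. x \<in> ptensor_power n \<Longrightarrow> cmod (h x) \<le> K * norm x"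
      using h unfolding bounded_clinear_on_def by blast
    have "cmod (h (tensor (us @ a # vs))) \<le> max K 0 * (prod_list (map norm us) * prod_list (map norm vs)) * norm a" for a
    proof -
      have "cmod (h (tensor (us @ a # vs))) \<le> K * norm (tensor (us @ a # vs))" by (rule K[OF t])
      also have "\<dots> \<le> max K 0 * norm (tensor (us @ a # vs))" by (intro mult_right_mono) auto
      also have "\<dots> \<le> max K 0 * prod_list (map norm (us @ a # vs))"
        by (intro mult_left_mono norm_tensor_le) auto
      finally show ?thesis by (simp add: mult_ac)
    qed
    moreover have "h (tensor (us @ (a + b) # vs)) = h (tensor (us @ a # vs)) + h (tensor (us @ b # vs))"
      "h (tensor (us @ (c *\<^sub>C a) # vs)) = c *\<^sub>C h (tensor (us @ a # vs))" for a b c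
      using multilinear_tensor[where 'v = "'v tensor_algebra"] h t by (simp_all add: multilinear_def bounded_clinear_on_def)
    ultimately show ?thesis unfolding bounded_clinear_on_def by blast
  qed
  \<comment> \<open>Words give way to arbitrary elements one argument at a time: the entries of
    \<open>as\<close> are already arbitrary, those after them still words.\<close>
  have w: "f (tensor (as @ map word ws)) = g (tensor (as @ map word ws))" if "length as + length ws = n" for as ws
    using that
  proof (induction as arbitrary: ws rule: rev_induct)
    case (snoc a as)
    have "(\<lambda>a. f (tensor (as @ a # map word ws))) = (\<lambda>a. g (tensor (as @ a # map word ws)))"
    proof (rule word_functional_unique[OF bl[OF fb] bl[OF gb]])
      fix v
      show "f (tensor (as @ word v # map word ws)) = g (tensor (as @ word v # map word ws))"
        using snoc.IH[of "v # ws"] snoc.prems by simp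
    qed (use snoc.prems in auto)
    from fun_cong[OF this, of a] show ?case by simp
  qed (use eq in auto)
  show "f x = g x"
  proof (cases "x \<in> ptensor_power n")
    case True
    show ?thesis
      by (rule bounded_clinear_on_ptensor_power_unique[OF fb gb _ True]) (use w[of _ "[]"] in simp)
  next
    case False
    then show ?thesis using f g by (simp add: dual_space_def)
  qed
qed

subsection \<open>Boundedness of the homotopy\<close>

definition clinear_form :: "('v::complex_normed_vector \<Rightarrow> complex) \<Rightarrow> bool" where
  "clinear_form f \<longleftrightarrow> (\<forall>a b. f (a + b) = f a + f b) \<and> (\<forall>z a. f (z *\<^sub>C a) = z * f a)"

lemma clinear_form_0: "clinear_form (\<lambda>c. 0)"
  and clinear_form_minus: "clinear_form f \<Longrightarrow> clinear_form (\<lambda>c. - f c)"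
  and clinear_form_add: "clinear_form f \<Longrightarrow> clinear_form g \<Longrightarrow> clinear_form (\<lambda>c. f c + g c)"
  and clinear_form_diff: "clinear_form f \<Longrightarrow> clinear_form g \<Longrightarrow> clinear_form (\<lambda>c. f c - g c)"
  and clinear_form_mult: "clinear_form f \<Longrightarrow> clinear_form (\<lambda>c. k * f c)"
  and clinear_form_divide: "clinear_form f \<Longrightarrow> clinear_form (\<lambda>c. f c / k)"
  by (simp_all add: clinear_form_def algebra_simps add_divide_distrib)

lemma clinear_form_sum: "(\<And>j. j \<in> J \<Longrightarrow> clinear_form (\<lambda>c. f c j)) \<Longrightarrow> clinear_form (\<lambda>c. \<Sum>j\<in>J. f c j)"
  by (simp add: clinear_form_def sum.distrib sum_distrib_left)

text \<open>Reduces multilinearity to one letter \<open>c\<close> varying in one word. Each term of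
  the homotopies contains that letter once, so the closure rules for \<open>clinear_form\<close>
  apply.\<close>

lemma entrywise_multilinear_iff:
  "entrywise_multilinear P \<longleftrightarrow> (\<forall>us xs ys vs. clinear_form (\<lambda>c. P (us @ (xs @ c # ys) # vs)))"
  by (auto simp: entrywise_multilinear_def multilinear_def clinear_form_def scaleC_complex_def)

lemma entrywise_multilinearD: "entrywise_multilinear P \<Longrightarrow> clinear_form (\<lambda>c. P (us @ (xs @ c # ys) # vs))"
  by (simp add: entrywise_multilinear_iff)

text \<open>The varied letter falls into the second piece if \<open>j \<le> length xs\<close> and
  into the first piece otherwise.\<close>

lemma clinear_form_split:
  assumes 1: "\<And>xs1 xs2. clinear_form (\<lambda>c. f xs1 (xs2 @ c # ys))"
    and 2: "\<And>ys1 ys2. clinear_form (\<lambda>c. f (xs @ c # ys1) ys2)"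
  shows "clinear_form (\<lambda>c. f (take j (xs @ c # ys)) (drop j (xs @ c # ys)))"
proof (cases "j \<le> length xs")
  case True
  then show ?thesis using 1[of "take j xs" "drop j xs"] by simp
next
  case False
  then obtain i where "j = length xs + Suc i" by (metis add_Suc_right less_imp_Suc_add not_le)
  then show ?thesis using 2[of "take i ys" "drop i ys"] by simp
qed

lemma clinear_form_splitting:
  assumes "\<And>ws. clinear_form (\<lambda>c. P c ws)" shows "clinear_form (\<lambda>c. splitting (P c) ws)"
proof -
  have a: "P (a + b) = (\<lambda>ws. P a ws + P b ws)" and z: "P (z *\<^sub>C a) = (\<lambda>ws. z * P a ws)" for a b z
    using assms by (auto simp: clinear_form_def)
  show ?thesis
    unfolding clinear_form_def a z splitting_add splitting_cmult by simp
qed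

lemma entrywise_multilinear_splitting:
  fixes P :: "'v::complex_normed_vector list list \<Rightarrow> complex"
  assumes "entrywise_multilinear P" shows "entrywise_multilinear (splitting P)"
proof -
  have "clinear_form (\<lambda>c. splitting P (us @ (xs @ c # ys) # vs))" if "entrywise_multilinear P"
    for us xs ys vs and P :: "'v list list \<Rightarrow> complex"
    using that
  proof (induction us arbitrary: P)
    case Nil
    have "clinear_form (\<lambda>c. splitting (\<lambda>ws. P ((xs @ c # ys) # ws)) vs)"
      by (rule clinear_form_splitting) (use entrywise_multilinearD[OF Nil, of "[]"] in simp)
    moreover have "clinear_form (\<lambda>c. P (take j (xs @ c # ys) # drop j (xs @ c # ys) # vs))" for j
    proof (rule clinear_form_split[where f = "\<lambda>x y. P (x # y # vs)"])
      show "clinear_form (\<lambda>c. P (x # (y @ c # ys) # vs))" for x y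
        using entrywise_multilinearD[OF Nil, of "[x]"] by simp
      show "clinear_form (\<lambda>c. P ((xs @ c # x) # y # vs))" for x y
        using entrywise_multilinearD[OF Nil, of "[]"] by simp
    qed
    ultimately show ?case
      by (simp only: append_Nil splitting.simps length_append list.size) (intro clinear_form_diff clinear_form_minus clinear_form_sum)
  next
    case (Cons u us)
    have e: "entrywise_multilinear (\<lambda>ws. P (x # ws))" for x
      using entrywise_multilinearD[OF Cons.prems, of "x # us" for us] by (simp add: entrywise_multilinear_iff)
    have "clinear_form (\<lambda>c. P (take j u # drop j u # us @ (xs @ c # ys) # vs))" for j
      using entrywise_multilinearD[OF Cons.prems, of "take j u # drop j u # us"] by simp
    then show ?case
      using Cons.IH[OF e] by (auto intro!: clinear_form_diff clinear_form_minus clinear_form_sum)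
  qed
  then show ?thesis using assms by (simp add: entrywise_multilinear_iff)
qed

lemma rotation_append:
  "rotation P (a # m @ [z]) = (\<Sum>j=1..length a. P (drop j a # m @ [z @ take j a, []]))"
proof -
  obtain b as where b: "m @ [z] = b # as" by (cases "m @ [z]") auto
  have "butlast (b # as) = m" "last (b # as) = z" by (simp_all flip: b)
  then show ?thesis unfolding b by simp
qed

lemma rotation_short: "length as < 2 \<Longrightarrow> rotation P as = 0"
  by (cases as; cases "tl as") auto

lemma entrywise_multilinear_rotation:
  fixes P :: "'v::complex_normed_vector list list \<Rightarrow> complex"
  assumes P: "entrywise_multilinear P" shows "entrywise_multilinear (rotation P)"
  unfolding entrywise_multilinear_iff
proof (intro allI)
  fix us vs :: "'v list list" and xs ys
  \<comment> \<open>The varied word is the only one, the first, the last, or strictly between;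
    \<open>rotation\<close> treats these positions differently.\<close>
  consider "us = []" "vs = []" | m z where "us = []" "vs = m @ [z]" | a m where "us = a # m" "vs = []"
    | a m n z where "us = a # m" "vs = n @ [z]"
    by (cases us; cases vs rule: rev_cases) auto
  then show "clinear_form (\<lambda>c. rotation P (us @ (xs @ c # ys) # vs))"
  proof cases
    case 1
    then show ?thesis by (simp add: rotation_short clinear_form_0)
  next
    case 2
    have "clinear_form (\<lambda>c. P (drop j (xs @ c # ys) # m @ [z @ take j (xs @ c # ys), []]))" for j
    proof (rule clinear_form_split[where f = "\<lambda>x y. P (y # m @ [z @ x, []])"])
      show "clinear_form (\<lambda>c. P ((y @ c # ys) # m @ [z @ x, []]))" for x y
        using entrywise_multilinearD[OF P, of "[]"] by simp
      show "clinear_form (\<lambda>c. P (y # m @ [z @ xs @ c # x, []]))" for x y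
        using entrywise_multilinearD[OF P, of "y # m" "z @ xs" x "[[]]"] by simp
    qed
    then show ?thesis
      unfolding 2 append_Nil rotation_append length_append list.size by (intro clinear_form_sum)
  next
    case 3
    have "clinear_form (\<lambda>c. P (drop j a # m @ [(xs @ c # ys) @ take j a, []]))" for j
      using entrywise_multilinearD[OF P, of "drop j a # m" xs "ys @ take j a" "[[]]"] by simp
    then show ?thesis
      unfolding 3 append_Cons rotation_append by (auto intro!: clinear_form_sum)
  next
    case 4
    have "clinear_form (\<lambda>c. P (drop j a # (m @ (xs @ c # ys) # n) @ [z @ take j a, []]))" for j
      using entrywise_multilinearD[OF P, of "drop j a # m" xs "ys" "n @ [z @ take j a, []]"] by simp
    moreover have "us @ (xs @ c # ys) # vs = a # (m @ (xs @ c # ys) # n) @ [z]" for c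
      using 4 by simp
    ultimately show ?thesis
      by (simp only: rotation_append) (auto intro!: clinear_form_sum)
  qed
qed

lemma prod_norm_split:
  "prod_list (map norm (take j a)) * prod_list (map norm (drop j a)) = prod_list (map norm a)"
  by (metis append_take_drop_id map_append prod_list.append)

text \<open>Cutting and rotating rearrange the letters without changing the product of their norms.
  After division by the number of letters, \<open>splitting\<close> and \<open>rotation\<close>
  contribute one \<open>C\<close> each.\<close>

lemma word_form_primitive:
  fixes P :: "'v::complex_normed_vector list list \<Rightarrow> complex"
  assumes P: "word_form C P" shows "word_form (2 * C) (primitive P)"
proof -
  have C: "C \<ge> 0" by (rule word_form_nonneg[OF P])
  let ?n = "\<lambda>ws. prod_list (map norm (concat (ws :: 'v list list)))"
  have e: "entrywise_multilinear P" using P by (simp add: word_form_def)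
  have lin: "clinear_form (\<lambda>c. primitive P (us @ (xs @ c # ys) # vs))" for us xs ys vs
  proof -
    \<comment> \<open>The number of letters does not depend on the varied letter, whose place
      \<open>undefined\<close> holds.\<close>
    define N :: complex where "N = of_nat (length (concat (us @ (xs @ undefined # ys) # vs)))"
    have "primitive P (us @ (xs @ c # ys) # vs) = (splitting P (us @ (xs @ c # ys) # vs) +
        (- 1) ^ (length us + Suc (length vs)) * rotation P (us @ (xs @ c # ys) # vs)) / N" for c
      by (simp add: primitive_def contraction_def N_def)
    then show ?thesis
      using entrywise_multilinearD[OF entrywise_multilinear_splitting[OF e]] entrywise_multilinearD[OF entrywise_multilinear_rotation[OF e]]
      by (simp only:) (intro clinear_form_divide clinear_form_add clinear_form_mult)
  qed
  \<comment> \<open>Stated for all \<open>C\<close> and \<open>P\<close>, as the induction absorbs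
    the first word into \<open>P\<close> and its norms into \<open>C\<close>.\<close>
  have sp: "cmod (splitting P ws) \<le> real (length (concat ws)) * (C * ?n ws)"
    if "word_form C P" for ws C and P :: "'v list list \<Rightarrow> complex"
    using that
  proof (induction ws arbitrary: C P)
    case (Cons a ws)
    have "cmod (P (take j a # drop j a # ws)) \<le> C * ?n (a # ws)" for j
    proof -
      have "?n (take j a # drop j a # ws) = ?n (a # ws)"
        by (simp add: prod_norm_split flip: mult.assoc)
      then show ?thesis using word_form_bound[OF Cons.prems, of "take j a # drop j a # ws"] by (simp only:)
    qed
    then have "cmod (\<Sum>j=1..length a. P (take j a # drop j a # ws)) \<le> real (length a) * (C * ?n (a # ws))"
      by (intro order_trans[OF sum_norm_bound]) auto
    moreover have "cmod (splitting (\<lambda>xs. P (a # xs)) ws) \<le> real (length (concat ws)) * (C * ?n (a # ws))"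
      using Cons.IH[OF word_form_Cons[OF Cons.prems, of a]] by (simp add: mult_ac)
    ultimately show ?case
      using norm_triangle_ineq4[of "- (\<Sum>j=1..length a. P (take j a # drop j a # ws))" "splitting (\<lambda>xs. P (a # xs)) ws"]
      by (simp add: algebra_simps)
  qed simp
  have rot: "cmod (rotation P ws) \<le> real (length (concat ws)) * (C * ?n ws)" for ws
  proof (cases "length ws < 2")
    case True
    then show ?thesis using C by (simp add: rotation_short)
  next
    case False
    then obtain a m z where ws: "ws = a # m @ [z]" by (cases ws; cases "tl ws" rule: rev_cases) auto
    have "cmod (P (drop j a # m @ [z @ take j a, []])) \<le> C * ?n ws" for j
    proof -
      have "?n (drop j a # m @ [z @ take j a, []]) = prod_list (map norm (take j a)) * prod_list (map norm (drop j a)) * ?n (m @ [z])"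
        by (simp add: mult_ac)
      also have "prod_list (map norm (take j a)) * prod_list (map norm (drop j a)) = prod_list (map norm a)"
        by (rule prod_norm_split)
      finally have "?n (drop j a # m @ [z @ take j a, []]) = ?n ws" by (simp add: ws)
      then show ?thesis using word_form_bound[OF P, of "drop j a # m @ [z @ take j a, []]"] by (simp only:)
    qed
    then have "cmod (rotation P ws) \<le> real (length a) * (C * ?n ws)"
      unfolding ws rotation_append by (intro order_trans[OF sum_norm_bound]) auto
    also have "\<dots> \<le> real (length (concat ws)) * (C * ?n ws)"
      using C by (intro mult_right_mono) (auto simp: ws)
    finally show ?thesis .
  qed
  have "cmod (primitive P ws) \<le> 2 * C * ?n ws" for ws
  proof (cases "concat ws = []")
    case True
    then have "?n ([] # ws) = 1" "?n ws = 1" by (simp_all only: concat.simps append_Nil list.map prod_list.Nil)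
    then show ?thesis
      using word_form_bound[OF P, of "[] # ws"] C by (simp add: primitive_def True)
  next
    case False
    then have N: "real (length (concat ws)) > 0" by (simp del: length_concat concat_eq_Nil_conv)
    have "cmod (contraction P ws) \<le> cmod (splitting P ws) + cmod (rotation P ws)"
      unfolding contraction_def by (rule norm_triangle_le) (simp add: norm_mult norm_power)
    also have "\<dots> \<le> real (length (concat ws)) * (2 * C * ?n ws)"
      using sp[OF P, of ws] rot[of ws] by (simp add: algebra_simps)
    finally show ?thesis
      using N False unfolding primitive_def
      by (simp add: norm_divide pos_divide_le_eq mult.commute del: length_concat concat_eq_Nil_conv)
  qed
  with lin show ?thesis by (simp add: word_form_def entrywise_multilinear_iff)
qed

subsection \<open>Cohomology classes\<close>

lemma dual_spaceD:
  assumes "f \<in> dual_space S" "x \<in> S"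
  shows "y \<in> S \<Longrightarrow> f (x + y) = f x + f y" "f (c *\<^sub>C x) = c * f x"
  using assms by (auto simp: dual_space_def bounded_clinear_on_def scaleC_complex_def)

lemma dual_space_bounded:
  assumes "f \<in> dual_space S"
  obtains K where "K \<ge> 0" "\<And>x. x \<in> S \<Longrightarrow> cmod (f x) \<le> K * norm x"
proof -
  obtain K where K: "\<And>x. x \<in> S \<Longrightarrow> cmod (f x) \<le> K * norm x"
    using assms unfolding dual_space_def bounded_clinear_on_def by blast
  have "cmod (f x) \<le> max K 0 * norm x" if "x \<in> S" for x
    using order_trans[OF K[OF that], of "max K 0 * norm x"] by (simp add: mult_right_mono)
  then show ?thesis using that[of "max K 0"] by simp
qed

lemma dual_spaceI:
  assumes "\<And>x y. x \<in> S \<Longrightarrow> y \<in> S \<Longrightarrow> f (x + y) = f x + f y" "\<And>c x. x \<in> S \<Longrightarrow> f (c *\<^sub>C x) = c * f x"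
    "\<And>x. x \<in> S \<Longrightarrow> cmod (f x) \<le> K * norm x" "\<And>x. x \<notin> S \<Longrightarrow> f x = 0"
  shows "f \<in> dual_space S"
  using assms(1,2,4) exI[of "\<lambda>K. \<forall>x\<in>S. cmod (f x) \<le> K * norm x" K] assms(3)
  unfolding dual_space_def bounded_clinear_on_def by (simp add: scaleC_complex_def)

lemma dual_space_combination:
  assumes f: "f \<in> dual_space S" and g: "g \<in> dual_space S"
  shows "(\<lambda>x. c * f x + d * g x) \<in> dual_space S"
proof -
  obtain K where K: "K \<ge> 0" "\<And>x. x \<in> S \<Longrightarrow> cmod (f x) \<le> K * norm x" using dual_space_bounded[OF f] by blast
  obtain L where L: "L \<ge> 0" "\<And>x. x \<in> S \<Longrightarrow> cmod (g x) \<le> L * norm x" using dual_space_bounded[OF g] by blast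
  show ?thesis
  proof (rule dual_spaceI[where K = "cmod c * K + cmod d * L"])
    fix x assume x: "x \<in> S"
    have "cmod (c * f x + d * g x) \<le> cmod c * cmod (f x) + cmod d * cmod (g x)"
      by (rule norm_triangle_le) (simp add: norm_mult)
    also have "\<dots> \<le> cmod c * (K * norm x) + cmod d * (L * norm x)"
      by (intro add_mono mult_left_mono K(2)[OF x] L(2)[OF x]) auto
    finally show "cmod (c * f x + d * g x) \<le> (cmod c * K + cmod d * L) * norm x"
      by (simp add: algebra_simps)
  qed (use f g in \<open>auto simp: dual_spaceD[OF f] dual_spaceD[OF g] algebra_simps dual_space_def\<close>)
qed

lemma dual_norm_properties:
  assumes S: "0 \<in> S" "\<forall>c. \<forall>x\<in>S. c *\<^sub>C x \<in> S" and f: "f \<in> dual_space S"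
  shows "0 \<le> dual_norm S f" and "x \<in> S \<Longrightarrow> cmod (f x) \<le> dual_norm S f * norm x"
proof -
  obtain K where K: "K \<ge> 0" "\<And>x. x \<in> S \<Longrightarrow> cmod (f x) \<le> K * norm x" using dual_space_bounded[OF f] by blast
  have bdd: "bdd_above ((\<lambda>x. cmod (f x)) ` {x \<in> S. norm x \<le> 1})"
  proof (rule bdd_aboveI2)
    fix x assume "x \<in> {x \<in> S. norm x \<le> 1}"
    then have "cmod (f x) \<le> K * norm x" "K * norm x \<le> K"
      using K by (auto intro: mult_left_le)
    then show "cmod (f x) \<le> K" by simp
  qed
  have u: "cmod (f x) \<le> dual_norm S f" if "x \<in> S" "norm x \<le> 1" for x
    unfolding dual_norm_def by (rule cSUP_upper[OF _ bdd]) (use that in simp)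
  have f0: "f 0 = 0" using K(2)[OF S(1)] by simp
  show "0 \<le> dual_norm S f" using u[OF S(1)] by (simp add: f0)
  assume x: "x \<in> S"
  show "cmod (f x) \<le> dual_norm S f * norm x"
  proof (cases "x = 0")
    case False
    let ?c = "complex_of_real (inverse (norm x))"
    have "cmod (f (?c *\<^sub>C x)) \<le> dual_norm S f"
      by (rule u) (use S(2) x in \<open>simp_all add: norm_scaleC False norm_inverse\<close>)
    then show ?thesis
      using False by (simp add: dual_spaceD(2)[OF f x] norm_divide divide_inverse norm_mult norm_inverse)
        (simp add: field_simps)
  qed (simp add: f0)
qed

lemma dual_norm_le:
  assumes "0 \<in> S" "K \<ge> 0" "\<And>x. x \<in> S \<Longrightarrow> cmod (f x) \<le> K * norm x"
  shows "dual_norm S f \<le> K"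
  unfolding dual_norm_def
proof (rule cSUP_least)
  show "{x \<in> S. norm x \<le> 1} \<noteq> {}" using assms(1) by force
  fix x assume "x \<in> {x \<in> S. norm x \<le> 1}"
  then have "cmod (f x) \<le> K * norm x" "K * norm x \<le> K"
    using assms by (auto intro: mult_left_le)
  then show "cmod (f x) \<le> K" by simp
qed

section \<open>Linear structure of cochains, cocycles and coboundaries\<close>

lemma coboundary_in_dual_space:
  assumes f: "f \<in> cochains n" shows "coboundary n f \<in> dual_space (ptensor_power (n + 2))"
proof -
  note d = hochschild_d_characterization[where n = n]
  obtain K where K: "K \<ge> 0" "\<And>x. x \<in> ptensor_power (n + 1) \<Longrightarrow> cmod (f x) \<le> K * norm x"
    using dual_space_bounded f unfolding cochains_def by blast
  have f': "f \<in> dual_space (ptensor_power (n + 1))" using f by (simp add: cochains_def)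
  obtain L where L: "\<And>x :: 'a ptensor. x \<in> ptensor_power (n + 2) \<Longrightarrow> norm (hochschild_d n x) \<le> L * norm x"
    using d(1)[where 'a = 'a] unfolding bounded_clinear_on_def by blast
  have f0: "f 0 = 0" using K(2)[of 0] by simp
  show ?thesis
  proof (rule dual_spaceI[where K = "K * L"])
    fix x :: "'a ptensor" assume x: "x \<in> ptensor_power (n + 2)"
    show "cmod (coboundary n f x) \<le> K * L * norm x"
      using order_trans[OF K(2)[OF d(4)[OF x]] mult_left_mono[OF L[OF x] K(1)]]
      by (simp add: coboundary_def mult.assoc)
    show "coboundary n f (c *\<^sub>C x) = c * coboundary n f x" for c
      using d(1)[where 'a = 'a] x d(4)[OF x]
      by (simp add: coboundary_def bounded_clinear_on_def dual_spaceD[OF f'])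
    show "coboundary n f (x + y) = coboundary n f x + coboundary n f y" if "y \<in> ptensor_power (n + 2)" for y
      using d(1)[where 'a = 'a] x d(4)[OF x] that d(4)[OF that]
      by (simp add: coboundary_def bounded_clinear_on_def dual_spaceD[OF f'])
  qed (simp add: coboundary_def d(2) f0)
qed

lemma cochains_combination:
  "f \<in> cochains n \<Longrightarrow> g \<in> cochains n \<Longrightarrow> (\<lambda>x. c * f x + d * g x) \<in> cochains n"
  unfolding cochains_def by (rule dual_space_combination)

lemma coboundary_combination:
  "coboundary n (\<lambda>x. c * f x + d * g x) = (\<lambda>x. c * coboundary n f x + d * coboundary n g x)"
  by (simp add: coboundary_def fun_eq_iff)

lemma cocycles_combination:
  "f \<in> cocycles n \<Longrightarrow> g \<in> cocycles n \<Longrightarrow> (\<lambda>x. c * f x + d * g x) \<in> cocycles n"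
  by (simp add: cocycles_def cochains_combination coboundary_combination)

lemma zero_cochain: "(\<lambda>_. 0) \<in> cochains n"
  unfolding cochains_def by (rule dual_spaceI[where K = 0]) auto

lemma zero_cocycle: "(\<lambda>_. 0) \<in> cocycles n"
  by (simp add: cocycles_def zero_cochain coboundary_def fun_eq_iff)

lemma zero_coboundary: "(\<lambda>_. 0) \<in> coboundaries n"
proof (cases n)
  case (Suc m)
  then show ?thesis
    using zero_cochain[of m] by (auto simp: coboundary_def fun_eq_iff intro!: image_eqI[of _ _ "\<lambda>_. 0"])
qed simp

lemma coboundaries_combination:
  assumes "f \<in> coboundaries n" "g \<in> coboundaries n"
  shows "(\<lambda>x. c * f x + d * g x) \<in> coboundaries n"
proof (cases n)
  case (Suc m)
  then obtain f' g' where "f' \<in> cochains m" "g' \<in> cochains m" "f = coboundary m f'" "g = coboundary m g'"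
    using assms by auto
  then show ?thesis
    unfolding Suc coboundaries.simps
    by (intro image_eqI[OF _ cochains_combination[of f' m g' c d]]) (simp_all add: coboundary_combination)
qed (use assms in auto)

lemma coboundaries_subset_cochains: "coboundaries n \<subseteq> cochains n"
proof (cases n)
  case (Suc m)
  then show ?thesis using coboundary_in_dual_space[of _ m] by (auto simp: cochains_def)
qed (use zero_cochain in auto)

lemma mem_cohomology_class: "f \<in> cohomology_class n f"
  unfolding cohomology_class_def by (rule image_eqI[OF _ zero_coboundary]) simp

lemma cohomology_class_eqI:
  fixes f g :: "'a::complex_banach_algebra ptensor \<Rightarrow> complex"
  assumes "(\<lambda>x. f x - g x) \<in> coboundaries n"
  shows "cohomology_class n f = cohomology_class n g"
proof -
  have "cohomology_class n f \<subseteq> cohomology_class n g" if "(\<lambda>x. f x - g x) \<in> coboundaries n" for f g :: "'a ptensor \<Rightarrow> complex"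
    unfolding cohomology_class_def
  proof clarify
    fix h :: "'a ptensor \<Rightarrow> complex" assume "h \<in> coboundaries n"
    from coboundaries_combination[OF that this, of 1 1]
    show "(\<lambda>x. f x + h x) \<in> (\<lambda>h x. g x + h x) ` coboundaries n"
      by (auto intro: image_eqI[where x = "\<lambda>x. f x - g x + h x"])
  qed
  moreover have "(\<lambda>x. g x - f x) \<in> coboundaries n"
    using coboundaries_combination[OF assms assms, of "-1" 0] by simp
  ultimately show ?thesis using assms by blast
qed

text \<open>Both isomorphisms evaluate a cocycle at chains \<open>e a\<close>: these are
  \<open>tensor [a]\<close> in degree 0 and \<open>tensor [a, 1]\<close> in degree 1. The constant
  is 1 in both directions: evaluation does not increase norms since
  \<open>norm (e a) \<le> norm a\<close>, and the second condition provides a representative no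
  larger than the functional it realizes.\<close>

lemma cohomology_iso_evaluation:
  fixes e :: "'a::complex_banach_algebra \<Rightarrow> 'a ptensor" and S :: "('a \<Rightarrow> complex) set"
  assumes e: "\<And>a. e a \<in> ptensor_power (n + 1)" "\<And>a. norm (e a) \<le> norm a"
    and e0: "\<And>f a. f \<in> coboundaries n \<Longrightarrow> f (e a) = 0"
    and S: "S \<subseteq> dual_space UNIV"
    and 1: "\<And>f. f \<in> cocycles n \<Longrightarrow> (\<lambda>a. f (e a)) \<in> S"
    and 2: "\<And>\<tau>. \<tau> \<in> S \<Longrightarrow> \<exists>f\<in>cocycles n. (\<lambda>a. f (e a)) = \<tau> \<and>
      (\<forall>x\<in>ptensor_power (n + 1). cmod (f x) \<le> dual_norm UNIV \<tau> * norm x)"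
    and 3: "\<And>f. f \<in> cocycles n \<Longrightarrow> (\<And>a. f (e a) = 0) \<Longrightarrow> f \<in> coboundaries n"
  shows "\<exists>\<Theta>. cohomology_iso n S \<Theta> \<and> (\<forall>f\<in>cocycles n. \<Theta> (cohomology_class n f) = (\<lambda>a. f (e a)))"
proof -
  \<comment> \<open>The choice of a representative is harmless because coboundaries vanish at every
    \<open>e a\<close>.\<close>
  define \<Theta> where "\<Theta> X = (\<lambda>a. (SOME f. f \<in> X) (e a))" for X :: "('a ptensor \<Rightarrow> complex) set"
  have mem: "f' (e a) = f (e a)" if "f' \<in> cohomology_class n f" for f f' a
    using that e0 by (auto simp: cohomology_class_def)
  have \<Theta>: "\<Theta> (cohomology_class n f) = (\<lambda>a. f (e a))" for f
    using mem[OF someI[of "\<lambda>f'. f' \<in> cohomology_class n f", OF mem_cohomology_class]] by (simp add: \<Theta>_def)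
  have eq: "cohomology_class n f = cohomology_class n g"
    if f: "f \<in> cocycles n" and g: "g \<in> cocycles n" and fg: "(\<lambda>a. f (e a)) = (\<lambda>a. g (e a))" for f g
  proof (rule cohomology_class_eqI[OF 3])
    show "(\<lambda>x. f x - g x) \<in> cocycles n" using cocycles_combination[OF f g, of 1 "-1"] by simp
    show "f (e a) - g (e a) = 0" for a using fun_cong[OF fg, of a] by simp
  qed
  have pp: "0 \<in> ptensor_power (n + 1)" "\<forall>c. \<forall>x\<in>ptensor_power (n + 1). c *\<^sub>C x \<in> ptensor_power (n + 1)"
    by (auto intro: ptensor_power_scaleC)
  have "bij_betw \<Theta> (simplicial_cohomology TYPE('a) n) S"
    unfolding bij_betw_def
  proof
    show "inj_on \<Theta> (simplicial_cohomology TYPE('a) n)"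
    proof (rule inj_onI)
      fix X Y assume "X \<in> simplicial_cohomology TYPE('a) n" "Y \<in> simplicial_cohomology TYPE('a) n" "\<Theta> X = \<Theta> Y"
      then obtain f g where "f \<in> cocycles n" "g \<in> cocycles n" "X = cohomology_class n f" "Y = cohomology_class n g"
        unfolding simplicial_cohomology_def by blast
      with \<open>\<Theta> X = \<Theta> Y\<close> show "X = Y" using eq[of f g] by (simp only: \<Theta>)
    qed
    show "\<Theta> ` simplicial_cohomology TYPE('a) n = S"
    proof (intro equalityI subsetI)
      fix \<tau> assume "\<tau> \<in> S"
      from 2[OF this] obtain f where "f \<in> cocycles n" "(\<lambda>a. f (e a)) = \<tau>" by blast
      then have "\<tau> = \<Theta> (cohomology_class n f)" "cohomology_class n f \<in> simplicial_cohomology TYPE('a) n"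
        using \<Theta>[of f] by (simp_all add: simplicial_cohomology_def)
      then show "\<tau> \<in> \<Theta> ` simplicial_cohomology TYPE('a) n" by (rule image_eqI)
    next
      fix \<tau> assume "\<tau> \<in> \<Theta> ` simplicial_cohomology TYPE('a) n"
      then obtain f where "f \<in> cocycles n" "\<tau> = \<Theta> (cohomology_class n f)"
        unfolding simplicial_cohomology_def by blast
      then show "\<tau> \<in> S" using 1[of f] by (simp only: \<Theta>)
    qed
  qed
  moreover have "dual_norm UNIV (\<Theta> X) \<le> 1 * class_norm n X \<and> class_norm n X \<le> 1 * dual_norm UNIV (\<Theta> X)"
    if "X \<in> simplicial_cohomology TYPE('a) n" for X
  proof -
    from that obtain f where f: "f \<in> cocycles n" and X: "X = cohomology_class n f"
      by (auto simp: simplicial_cohomology_def)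
    have d: "h \<in> dual_space (ptensor_power (n + 1))" if "h \<in> X" for h
    proof -
      from that obtain g where g: "g \<in> coboundaries n" "h = (\<lambda>x. f x + g x)"
        by (auto simp: X cohomology_class_def)
      have "(\<lambda>x. 1 * f x + 1 * g x) \<in> cochains n"
        by (rule cochains_combination) (use f g coboundaries_subset_cochains in \<open>auto simp: cocycles_def\<close>)
      then show ?thesis by (simp add: g cochains_def)
    qed
    have fX: "f \<in> X" unfolding X by (rule mem_cohomology_class)
    have "dual_norm UNIV (\<Theta> X) \<le> class_norm n X"
      unfolding class_norm_def
    proof (rule cINF_greatest)
      show "X \<noteq> {}" using fX by blast
      fix h assume h: "h \<in> X"
      note p = dual_norm_properties[OF pp d[OF h]]
      have "cmod (\<Theta> X a) \<le> dual_norm (ptensor_power (n + 1)) h * norm a" for a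
      proof -
        have "cmod (\<Theta> X a) \<le> dual_norm (ptensor_power (n + 1)) h * norm (e a)"
          using p(2)[OF e(1)[of a]] mem[of h f a] h by (simp add: X \<Theta>)
        also have "\<dots> \<le> dual_norm (ptensor_power (n + 1)) h * norm a"
          by (rule mult_left_mono[OF e(2) p(1)])
        finally show ?thesis .
      qed
      then show "dual_norm UNIV (\<Theta> X) \<le> dual_norm (ptensor_power (n + 1)) h"
        by (intro dual_norm_le p(1)) auto
    qed
    moreover have "class_norm n X \<le> dual_norm UNIV (\<Theta> X)"
    proof -
      have t: "\<Theta> X \<in> S" using 1[OF f] by (simp add: X \<Theta>)
      from 2[OF this] obtain g where g: "g \<in> cocycles n" "(\<lambda>a. g (e a)) = \<Theta> X"
        "\<And>x. x \<in> ptensor_power (n + 1) \<Longrightarrow> cmod (g x) \<le> dual_norm UNIV (\<Theta> X) * norm x" by blast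
      have "g \<in> X"
        using mem_cohomology_class[of g n] eq[OF g(1) f] g(2) by (simp add: X \<Theta>)
      have "bdd_below ((\<lambda>h. dual_norm (ptensor_power (n + 1)) h) ` X)"
        by (rule bdd_belowI2[where m = 0]) (rule dual_norm_properties(1)[OF pp d])
      from cINF_lower[OF this \<open>g \<in> X\<close>] have "class_norm n X \<le> dual_norm (ptensor_power (n + 1)) g"
        by (simp add: class_norm_def)
      also have "\<dots> \<le> dual_norm UNIV (\<Theta> X)"
        by (rule dual_norm_le[OF pp(1) _ g(3)]) (use dual_norm_properties(1)[of UNIV "\<Theta> X"] S t in auto)
      finally show ?thesis .
    qed
    ultimately show ?thesis by simp
  qed
  ultimately have "cohomology_iso n S \<Theta>"
    unfolding cohomology_iso_def \<Theta> by (intro conjI ballI allI refl exI[of _ 1]) auto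
  with \<Theta> show ?thesis by (intro exI[of _ \<Theta>]) simp
qed

subsection \<open>Cocycles on the tensor algebra\<close>

text \<open>Apart from the first face, the faces of a list are those of its tail with the index
  shifted by one, which accounts for the sign in the recursion of \<open>merging\<close>.\<close>

lemma face_sum_eq_merging:
  assumes "length ws = Suc m"
  shows "(\<Sum>j=1..m. (- 1) ^ j * P (take (j - 1) ws @ [ws ! (j - 1) @ ws ! j] @ drop (j + 1) ws)) = merging P ws"
  using assms
proof (induction m arbitrary: ws P)
  case 0
  then show ?case by (cases ws) auto
next
  case (Suc m)
  then obtain a b c where ws: "ws = a # b # c" "length (b # c) = Suc m"
    by (metis length_Suc_conv)
  let ?g = "\<lambda>ws P j. (- 1) ^ j * P (take (j - 1) ws @ [ws ! (j - 1) @ ws ! j] @ drop (j + 1) ws)"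
  have "(\<Sum>j=1..Suc m. ?g ws P j) = ?g ws P 1 + (\<Sum>j=1..m. ?g ws P (Suc j))"
    by (simp add: sum.atLeast_Suc_atMost sum.shift_bounds_cl_Suc_ivl del: sum.cl_ivl_Suc)
  also have "?g ws P 1 = - P ((a @ b) # c)" by (simp add: ws)
  also have "(\<Sum>j=1..m. ?g ws P (Suc j)) = (\<Sum>j=1..m. - ?g (b # c) (\<lambda>xs. P (a # xs)) j)"
  proof (rule sum.cong[OF refl])
    fix j assume "j \<in> {1..m}"
    then obtain i where "j = Suc i" by (cases j) auto
    then show "?g ws P (Suc j) = - ?g (b # c) (\<lambda>xs. P (a # xs)) j" by (simp add: ws(1))
  qed
  also have "\<dots> = - merging (\<lambda>xs. P (a # xs)) (b # c)"
    using Suc.IH[OF ws(2), of "\<lambda>xs. P (a # xs)"] by (simp only: sum_negf)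
  finally show ?case by (simp add: ws(1))
qed

text \<open>The value 0 on other lengths makes this a word form, a notion that ranges over lists of
  all lengths.\<close>

definition on_words :: "nat \<Rightarrow> ('v::complex_normed_vector tensor_algebra ptensor \<Rightarrow> complex) \<Rightarrow> 'v list list \<Rightarrow> complex" where
  "on_words n f ws = (if length ws = n then f (tensor (map word ws)) else 0)"

lemma tensor_in_power_length: "length as = n \<Longrightarrow> tensor as \<in> ptensor_power n"
  using tensor_in_power[of as] by simp

lemma dual_space_tensor_linear:
  assumes "f \<in> dual_space (ptensor_power n)" "length us + length vs + 1 = n"
  shows "f (tensor (us @ (a + b) # vs)) = f (tensor (us @ a # vs)) + f (tensor (us @ b # vs))"
    and "f (tensor (us @ (c *\<^sub>C a) # vs)) = c * f (tensor (us @ a # vs))"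
proof -
  have t: "tensor (us @ a # vs) \<in> ptensor_power n" for a
    by (rule tensor_in_power_length) (use assms(2) in simp)
  show "f (tensor (us @ (a + b) # vs)) = f (tensor (us @ a # vs)) + f (tensor (us @ b # vs))"
    and "f (tensor (us @ (c *\<^sub>C a) # vs)) = c * f (tensor (us @ a # vs))"
    using multilinear_tensor[where 'v = 'a] dual_spaceD[OF assms(1) t] t by (simp_all add: multilinear_def)
qed

lemma word_form_on_words:
  fixes f :: "'v::complex_normed_vector tensor_algebra ptensor \<Rightarrow> complex"
  assumes f: "f \<in> dual_space (ptensor_power n)"
  obtains C where "word_form C (on_words n f)"
proof -
  obtain K where K: "K \<ge> 0" "\<And>x. x \<in> ptensor_power n \<Longrightarrow> cmod (f x) \<le> K * norm x"
    using dual_space_bounded[OF f] by blast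
  have "clinear_form (\<lambda>c. on_words n f (us @ (xs @ c # ys) # vs))" for us vs :: "'v list list" and xs ys
  proof (cases "length us + length vs + 1 = n")
    case True
    then have l: "length (map word us) + length (map word vs) + 1 = n" by simp
    have *: "on_words n f (us @ w # vs) = f (tensor (map word us @ word w # map word vs))" for w
      using True by (simp add: on_words_def)
    show ?thesis
      unfolding * clinear_form_def
      using multilinear_word[where 'v = 'v] dual_space_tensor_linear[OF f l] by (simp add: multilinear_def)
  next
    case False
    then show ?thesis by (simp add: on_words_def clinear_form_0)
  qed
  moreover have "cmod (on_words n f ws) \<le> K * prod_list (map norm (concat ws))" for ws
  proof (cases "length ws = n")
    case True
    have "prod_list (map norm (map word ws)) \<le> prod_list (map norm (concat ws))" for ws :: "'v list list"
    proof (induction ws)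
      case (Cons w ws)
      have "norm (word w) * prod_list (map norm (map word ws)) \<le> prod_list (map norm w) * prod_list (map norm (concat ws))"
        by (intro mult_mono norm_word_le Cons prod_list_norm_nonneg)
      then show ?case by simp
    qed simp
    then have "norm (tensor (map word ws)) \<le> prod_list (map norm (concat ws))"
      using norm_tensor_le order_trans by blast
    moreover have "cmod (on_words n f ws) \<le> K * norm (tensor (map word ws))"
      using True by (simp add: on_words_def K(2) tensor_in_power_length)
    ultimately show ?thesis
      using K(1) by (meson mult_left_mono order_trans)
  qed (use K(1) in \<open>simp add: on_words_def\<close>)
  ultimately show ?thesis
    using that[of K] by (simp add: word_form_def entrywise_multilinear_iff)
qed

text \<open>The bridge from Hochschild cochains to lists: since \<open>word\<close> is
  multiplicative, every face of a tensor of words is again a tensor of words.\<close>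

lemma coboundary_on_words:
  assumes f: "f \<in> cochains n" and l: "length ws = n + 2"
  shows "coboundary n f (tensor (map word ws)) = boundary (on_words (n + 1) f) ws"
proof -
  have f': "f \<in> dual_space (ptensor_power (n + 1))" using f by (simp add: cochains_def)
  let ?as = "map word ws" and ?P = "on_words (n + 1) f"
  have w: "f (tensor (map word us)) = ?P us" if "length us = n + 1" for us
    using that by (simp add: on_words_def)
  have ne: "ws \<noteq> []" using l by auto
  let ?cyc = "tl (butlast ws) @ [last ws @ hd ws]"
  let ?face = "\<lambda>j. take (j - 1) ws @ [ws ! (j - 1) @ ws ! j] @ drop (j + 1) ws"
  have cyc: "tl (butlast ?as) @ [last ?as * hd ?as] = map word ?cyc"
    using ne by (simp add: word_append last_map hd_map map_tl map_butlast)
  have face: "take (j - 1) ?as @ [?as ! (j - 1) * ?as ! j] @ drop (j + 1) ?as = map word (?face j)"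
    if "j \<in> {1..n + 1}" for j
  proof -
    have "j - 1 < length ws" "j < length ws" using that l by auto
    then show ?thesis by (simp add: word_append take_map drop_map)
  qed
  have lf: "length (?face j) = n + 1" if "j \<in> {1..n + 1}" for j
    using that l by auto
  have "hochschild_formula n ?as = tensor (map word ?cyc) + (\<Sum>j=1..n + 1. (- 1) ^ j *\<^sub>C tensor (map word (?face j)))"
    unfolding hochschild_formula_def cyc using face by (intro arg_cong2[where f = "(+)"] sum.cong) auto
  \<comment> \<open>\<open>f\<close> is additive only on the tensor power, so the sum is taken apart
    one face at a time, with membership checked for each part.\<close>
  moreover have "f (\<Sum>j\<in>J. (- 1) ^ j *\<^sub>C tensor (map word (?face j))) = (\<Sum>j\<in>J. (- 1) ^ j * ?P (?face j))"
    if "J \<subseteq> {1..n + 1}" "finite J" for J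
    using that(2,1)
  proof (induction J rule: finite_induct)
    case empty
    show ?case using dual_spaceD(2)[OF f' ptensor_power_0, of 0] by simp
  next
    case (insert j J)
    have t: "tensor (map word (?face i)) \<in> ptensor_power (n + 1)" if "i \<in> insert j J" for i
      by (rule tensor_in_power_length) (use lf that insert.prems in auto)
    have "(\<Sum>j\<in>J. (- 1) ^ j *\<^sub>C tensor (map word (?face j))) \<in> ptensor_power (n + 1)"
      by (intro ptensor_power_sum ptensor_power_scaleC t) simp
    then show ?case
      using insert t[of j] w[OF lf, of j] by (simp add: dual_spaceD[OF f'] ptensor_power_scaleC)
  qed
  moreover have "(\<Sum>j=1..n + 1. (- 1) ^ j *\<^sub>C tensor (map word (?face j))) \<in> ptensor_power (n + 1)"
    by (intro ptensor_power_sum ptensor_power_scaleC tensor_in_power_length) (use lf in simp)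
  moreover have "length ?cyc = n + 1" using l by simp
  ultimately have "f (hochschild_formula n ?as) = ?P ?cyc + (\<Sum>j=1..n + 1. (- 1) ^ j * ?P (?face j))"
    using w[of ?cyc] by (simp only: dual_spaceD(1)[OF f' tensor_in_power_length] length_map subset_refl finite_atLeastAtMost)
  also have "\<dots> = boundary ?P ws"
    unfolding boundary_def wrapping_def using face_sum_eq_merging[of ws "n + 1" ?P] l by simp
  finally show ?thesis
    using hochschild_d_characterization(3)[of ?as n] l by (simp add: coboundary_def)
qed

lemma cocycle_on_words:
  assumes "f \<in> cocycles n" "length ws = n + 2"
  shows "boundary (on_words (n + 1) f) ws = 0"
  using coboundary_on_words[of f n ws] assms by (auto simp: cocycles_def)

lemma word_functional_eqI:
  fixes f g :: "'v::complex_normed_vector tensor_algebra ptensor \<Rightarrow> complex"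
  assumes "f \<in> cochains n" "g \<in> cochains n"
    "\<And>ws. length ws = n + 1 \<Longrightarrow> f (tensor (map word ws)) = g (tensor (map word ws))"
  shows "f = g"
  using assms unfolding cochains_def by (rule functional_words_unique)

text \<open>Serves degree 1 as well as the higher degrees: it makes \<open>primitive\<close> a
  bounded cochain, and what its coboundary is on words is then left to the computation with
  lists.\<close>

lemma primitive_cochain:
  fixes f :: "'v::complex_normed_vector tensor_algebra ptensor \<Rightarrow> complex"
  assumes f: "f \<in> cochains (Suc m)"
  shows "\<exists>g\<in>cochains m. \<forall>ws. length ws = m + 2 \<longrightarrow>
    coboundary m g (tensor (map word ws)) = boundary (primitive (on_words (m + 2) f)) ws"
proof -
  obtain C where C: "word_form C (on_words (m + 2) f)"
    using word_form_on_words[of f "m + 2"] f by (auto simp: cochains_def)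
  obtain g where g: "g \<in> dual_space (ptensor_power (m + 1))"
    "\<And>ws. length ws = m + 1 \<Longrightarrow> g (tensor (map word ws)) = primitive (on_words (m + 2) f) ws"
    using word_form_functional[OF word_form_primitive[OF C]] by metis
  show ?thesis
  proof (intro bexI allI impI)
    show gc: "g \<in> cochains m" using g(1) by (simp add: cochains_def)
    fix ws :: "'v list list" assume l: "length ws = m + 2"
    \<comment> \<open>All faces of \<open>ws\<close> have length \<open>m + 1\<close>, where the two
      functions agree; \<open>on_words\<close> is 0 on every other length.\<close>
    have "boundary (on_words (m + 1) g) ws = boundary (primitive (on_words (m + 2) f)) ws"
      by (rule boundary_cong) (use l g(2) in \<open>auto simp: on_words_def\<close>)
    then show "coboundary m g (tensor (map word ws)) = boundary (primitive (on_words (m + 2) f)) ws"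
      by (simp add: coboundary_on_words[OF gc l])
  qed
qed

theorem cocycle_is_coboundary:
  fixes f :: "'v::complex_normed_vector tensor_algebra ptensor \<Rightarrow> complex"
  assumes f: "f \<in> cocycles n" and n: "n \<ge> 2"
  shows "f \<in> coboundaries n"
proof -
  obtain m where m: "n = Suc m" using n by (cases n) auto
  have fc: "f \<in> cochains (Suc m)" using f m by (simp add: cocycles_def)
  obtain g where g: "g \<in> cochains m"
    "\<forall>ws. length ws = m + 2 \<longrightarrow> coboundary m g (tensor (map word ws)) = boundary (primitive (on_words (m + 2) f)) ws"
    using primitive_cochain[OF fc] by (rule bexE)
  have "f = coboundary m g"
  proof (rule word_functional_eqI[OF fc])
    show "coboundary m g \<in> cochains (Suc m)"
      using coboundary_in_dual_space[OF g(1)] by (simp add: cochains_def)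
    fix ws :: "'v list list" assume l: "length ws = Suc m + 1"
    then have l': "length ws = m + 2" by simp
    have "boundary (primitive (on_words (m + 2) f)) ws = on_words (m + 2) f ws"
    proof (rule boundary_primitive)
      show "boundary (on_words (m + 2) f) xs = 0" if "length xs = Suc (length ws)" for xs
        using cocycle_on_words[OF f[unfolded m], of xs] that l' by simp
      \<comment> \<open>Chains of degree \<open>n\<close> have \<open>n + 1\<close> factors, so
        degree 2 is the first with a word between the first and the last, as
        \<open>contraction_boundary\<close> requires.\<close>
      show "length ws \<ge> 3" using l' n m by simp
    qed
    then show "f (tensor (map word ws)) = coboundary m g (tensor (map word ws))"
      unfolding g(2)[rule_format, OF l'] by (simp add: on_words_def l')
  qed
  with g(1) show ?thesis unfolding m coboundaries.simps by (intro image_eqI[of f _ g])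
qed

section \<open>Degrees 0 and 1\<close>

lemma coboundary_tensor:
  "length as = n + 2 \<Longrightarrow> coboundary n f (tensor as) = f (hochschild_formula n as)"
  by (simp add: coboundary_def hochschild_d_characterization(3))

lemma coboundary_0_tensor:
  assumes "f \<in> cochains 0"
  shows "coboundary 0 f (tensor [a, b]) = f (tensor [b * a]) - f (tensor [a * b])"
proof -
  have f: "f \<in> dual_space (ptensor_power 1)" using assms by (simp add: cochains_def)
  have "f (tensor [b * a] + (- 1) *\<^sub>C tensor [a * b]) = f (tensor [b * a]) - f (tensor [a * b])"
    by (simp add: dual_spaceD[OF f] ptensor_power_scaleC tensor_in_power_length)
  then show ?thesis
    by (simp add: coboundary_tensor hochschild_formula_def)
qed

lemma coboundary_1_tensor:
  assumes "f \<in> cochains 1"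
  shows "coboundary 1 f (tensor [a, b, c]) = f (tensor [b, c * a]) - f (tensor [a * b, c]) + f (tensor [a, b * c])"
proof -
  have f: "f \<in> dual_space (ptensor_power 2)" using assms by (simp add: cochains_def numeral_2_eq_2)
  have t: "tensor [x, y] \<in> ptensor_power 2" for x y :: 'a
    by (rule tensor_in_power_length) simp
  have "hochschild_formula 1 [a, b, c] = tensor [b, c * a] + ((- 1) *\<^sub>C tensor [a * b, c] + tensor [a, b * c])"
    by (simp add: hochschild_formula_def numeral_2_eq_2)
  moreover have "f (tensor [b, c * a] + ((- 1) *\<^sub>C tensor [a * b, c] + tensor [a, b * c])) =
      f (tensor [b, c * a]) - f (tensor [a * b, c]) + f (tensor [a, b * c])"
    by (simp add: dual_spaceD[OF f] ptensor_power_scaleC ptensor_power_add t)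
  ultimately show ?thesis
    by (simp add: coboundary_tensor)
qed

text \<open>Valid for every Banach algebra: in degree 0 the only coboundary is 0, a functional on
  the one-fold tensor power is one on the algebra, and the cocycle condition at
  \<open>tensor [a, b]\<close> is the trace identity.\<close>

lemma cohomology_iso_0:
  "\<exists>\<Theta>. cohomology_iso 0 (traces :: ('a::complex_banach_algebra \<Rightarrow> complex) set) \<Theta> \<and>
     (\<forall>f\<in>cocycles 0. \<Theta> (cohomology_class 0 f) = (\<lambda>a. f (tensor [a])))"
proof (rule cohomology_iso_evaluation)
  have t: "tensor [a] \<in> ptensor_power 1" for a :: 'a
    by (rule tensor_in_power_length) simp
  then show "tensor [a] \<in> ptensor_power (0 + 1)" for a :: 'a by simp
  show n: "norm (tensor [a]) \<le> norm a" for a :: 'a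
    using norm_tensor_le[of "[a]"] by simp
  show "f (tensor [a]) = 0" if "f \<in> coboundaries 0" for f and a :: 'a
    using that by simp
  show "traces \<subseteq> dual_space (UNIV :: 'a set)" by (auto simp: traces_def)
  show "(\<lambda>a. f (tensor [a])) \<in> traces" if f: "f \<in> cocycles 0" for f :: "'a ptensor \<Rightarrow> complex"
  proof -
    have fc: "f \<in> cochains 0" and f': "f \<in> dual_space (ptensor_power 1)"
      using f by (auto simp: cocycles_def cochains_def)
    obtain K where K: "K \<ge> 0" "\<And>x. x \<in> ptensor_power 1 \<Longrightarrow> cmod (f x) \<le> K * norm x"
      using dual_space_bounded[OF f'] by blast
    have "(\<lambda>a. f (tensor [a])) \<in> dual_space UNIV"
    proof (rule dual_spaceI[where K = K])
      show "cmod (f (tensor [a])) \<le> K * norm a" for a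
        using order_trans[OF K(2)[OF t] mult_left_mono[OF n K(1)]] .
    qed (use dual_space_tensor_linear[OF f', of "[]" "[]"] in simp_all)
    moreover have "f (tensor [a * b]) = f (tensor [b * a])" for a b
      using coboundary_0_tensor[OF fc, of a b] f by (simp add: cocycles_def)
    ultimately show ?thesis by (simp add: traces_def)
  qed
  show "\<exists>f\<in>cocycles 0. (\<lambda>a. f (tensor [a])) = \<tau> \<and>
      (\<forall>x\<in>ptensor_power (0 + 1). cmod (f x) \<le> dual_norm UNIV \<tau> * norm x)"
    if \<tau>: "\<tau> \<in> traces" for \<tau> :: "'a \<Rightarrow> complex"
  proof -
    have d: "\<tau> \<in> dual_space UNIV" and tr: "\<And>a b. \<tau> (a * b) = \<tau> (b * a)" using \<tau> by (auto simp: traces_def)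
    note p = dual_norm_properties[OF UNIV_I _ d, simplified]
    have m: "multilinear_at 1 (\<lambda>as. \<tau> (hd as))"
      by (simp add: multilinear_at_def dual_spaceD[OF d] scaleC_complex_def)
    have b: "cmod (\<tau> (hd as)) \<le> dual_norm UNIV \<tau> * prod_list (map norm as)" if "length as = 1" for as
      using that p(2)[of "hd as"] by (cases as) auto
    from ex1_implies_ex[OF ptensor_power_universal[OF m b]]
    obtain f where f: "bounded_clinear_on (ptensor_power 1) f" "\<forall>x. x \<notin> ptensor_power 1 \<longrightarrow> f x = 0"
      "\<And>as. length as = 1 \<Longrightarrow> f (tensor as) = \<tau> (hd as)" by blast
    have fc: "f \<in> cochains 0" using f by (simp add: cochains_def dual_space_def)
    have cb: "coboundary 0 f \<in> dual_space (ptensor_power 2)"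
      using coboundary_in_dual_space[OF fc] by (simp add: numeral_2_eq_2)
    have "coboundary 0 f x = 0" for x
    proof (cases "x \<in> ptensor_power 2")
      case True
      have "coboundary 0 f (tensor as) = 0" if "length as = 2" for as
      proof -
        from that obtain a b where "as = [a, b]" by (auto simp: length_Suc_conv numeral_2_eq_2)
        then show ?thesis by (simp add: coboundary_0_tensor[OF fc] f(3) tr)
      qed
      moreover have "bounded_clinear_on (ptensor_power 2) (coboundary 0 f)" "bounded_clinear_on (ptensor_power 2) (\<lambda>x :: 'a ptensor. 0 :: complex)"
        using cb zero_cochain[of 1] by (simp_all add: dual_space_def cochains_def numeral_2_eq_2)
      ultimately show ?thesis
        using bounded_clinear_on_ptensor_power_unique[of 2 "coboundary 0 f" "\<lambda>x. 0" x] True by simp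
    next
      case False
      then show ?thesis using cb by (simp add: dual_space_def)
    qed
    then have "f \<in> cocycles 0" using fc by (auto simp: cocycles_def)
    moreover have "cmod (f x) \<le> dual_norm UNIV \<tau> * norm x" if "x \<in> ptensor_power 1" for x
      by (rule ptensor_power_norm_bound[OF f(1) p(1) _ that])
         (use p(2) in \<open>auto simp: f(3) length_Suc_conv\<close>)
    ultimately show ?thesis by (intro bexI[of _ f]) (auto simp: f(3))
  qed
  show "f \<in> coboundaries 0" if f: "f \<in> cocycles 0" and 0: "\<And>a. f (tensor [a]) = 0" for f :: "'a ptensor \<Rightarrow> complex"
  proof -
    have f': "f \<in> dual_space (ptensor_power 1)" using f by (auto simp: cocycles_def cochains_def)
    have "f x = 0" for x
    proof (cases "x \<in> ptensor_power 1")
      case True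
      have "bounded_clinear_on (ptensor_power 1) f" "bounded_clinear_on (ptensor_power 1) (\<lambda>x :: 'a ptensor. 0 :: complex)"
        using f' zero_cochain[of 0] by (simp_all add: dual_space_def cochains_def)
      moreover have "f (tensor as) = 0" if "length as = 1" for as
        using that 0 by (auto simp: length_Suc_conv)
      ultimately show ?thesis
        using bounded_clinear_on_ptensor_power_unique[of 1 f "\<lambda>x. 0" x] True by simp
    next
      case False
      then show ?thesis using f' by (simp add: dual_space_def)
    qed
    then show ?thesis by auto
  qed
qed

text \<open>The quotient is 0/0 = 0 on two empty words, which is why only traces that vanish at 1 are recovered.\<close>

definition weighted_trace :: "('v::complex_normed_vector tensor_algebra \<Rightarrow> complex) \<Rightarrow> 'v list list \<Rightarrow> complex" where
  "weighted_trace \<tau> ws = (if length ws = 2 then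
     of_nat (length (hd ws)) / of_nat (length (concat ws)) * \<tau> (word (concat ws)) else 0)"

text \<open>The weight is at most 1, so the constant is the norm of the trace itself; this is what
  makes the isomorphism in degree 1 isometric.\<close>

lemma word_form_weighted_trace:
  fixes \<tau> :: "'v::complex_normed_vector tensor_algebra \<Rightarrow> complex"
  assumes \<tau>: "\<tau> \<in> dual_space UNIV"
  shows "word_form (dual_norm UNIV \<tau>) (weighted_trace \<tau>)"
proof -
  note p = dual_norm_properties[OF UNIV_I _ \<tau>, simplified]
  have "clinear_form (\<lambda>c. weighted_trace \<tau> (us @ (xs @ c # ys) # vs))" for us vs xs ys
  proof -
    \<comment> \<open>The weight depends only on lengths, so \<open>undefined\<close> can hold the
      place of \<open>c\<close>.\<close>
    define k :: complex where "k = (if length us + length vs = 1 then of_nat (length (hd (us @ [xs @ undefined # ys]))) /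
      of_nat (length (concat (us @ (xs @ undefined # ys) # vs))) else 0)"
    have "weighted_trace \<tau> (us @ (xs @ c # ys) # vs) = k * \<tau> (word ((concat us @ xs) @ c # (ys @ concat vs)))" for c
      by (cases us) (auto simp: weighted_trace_def k_def)
    moreover have "clinear_form (\<lambda>c. \<tau> (word ((concat us @ xs) @ c # (ys @ concat vs))))"
      using multilinear_word[where 'v = 'v] by (simp add: clinear_form_def multilinear_def dual_spaceD[OF \<tau>] del: append_assoc)
    ultimately show ?thesis by (simp only: clinear_form_mult)
  qed
  moreover have "cmod (weighted_trace \<tau> ws) \<le> dual_norm UNIV \<tau> * prod_list (map norm (concat ws))" for ws
  proof (cases "length ws = 2")
    case True
    then obtain a b where ws: "ws = [a, b]" by (auto simp: length_Suc_conv numeral_2_eq_2)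
    have "cmod (weighted_trace \<tau> ws) = real (length a) / real (length (a @ b)) * cmod (\<tau> (word (a @ b)))"
      by (simp add: weighted_trace_def ws norm_mult norm_divide del: length_append)
    also have "\<dots> \<le> 1 * (dual_norm UNIV \<tau> * prod_list (map norm (a @ b)))"
    proof (rule mult_mono)
      show "real (length a) / real (length (a @ b)) \<le> 1" by (simp add: divide_le_eq)
      show "cmod (\<tau> (word (a @ b))) \<le> dual_norm UNIV \<tau> * prod_list (map norm (a @ b))"
        by (rule order_trans[OF p(2) mult_left_mono[OF norm_word_le p(1)]])
    qed simp_all
    finally show ?thesis by (simp add: ws)
  next
    case False
    then show ?thesis by (simp add: weighted_trace_def p(1))
  qed
  ultimately show ?thesis by (simp add: word_form_def entrywise_multilinear_iff)
qed

text \<open>Multiplication of each word by its length is a derivation D, in general unbounded, and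
  \<open>\<tau> (D a * b)\<close> is the cocycle that it defines. Division by the total length,
  which all faces share, makes it bounded. The three weights are proportional to the lengths of
  \<open>b\<close>, of \<open>a @ b\<close> (with a minus sign) and of \<open>a\<close>.\<close>

lemma boundary_weighted_trace:
  assumes tr: "\<tau> \<in> traces"
  shows "boundary (weighted_trace \<tau>) [a, b, c] = 0"
proof -
  have "\<tau> (word (b @ c @ a)) = \<tau> (word (a @ b @ c))"
    using tr word_append[of a "b @ c"] word_append[of "b @ c" a] by (simp add: traces_def)
  then show ?thesis
    by (simp add: boundary_def wrapping_def weighted_trace_def add_divide_distrib distrib_right add_ac)
qed

text \<open>The cocycle identity at \<open>[a, b, 1]\<close> writes
  \<open>f (tensor [a * b, 1])\<close> as a sum symmetric in \<open>a\<close> and \<open>b\<close>.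
  At \<open>a = b = 1\<close> it equates a number with its double.\<close>

lemma trace_evaluation:
  fixes f :: "'a::{complex_banach_algebra, real_normed_algebra_1} ptensor \<Rightarrow> complex"
  assumes f: "f \<in> cocycles 1"
  shows "(\<lambda>a. f (tensor [a, 1])) \<in> {\<tau> \<in> traces. \<tau> 1 = 0}"
proof -
  have fc: "f \<in> cochains 1" and f': "f \<in> dual_space (ptensor_power 2)"
    using f by (auto simp: cocycles_def cochains_def numeral_2_eq_2)
  obtain K where K: "K \<ge> 0" "\<And>x. x \<in> ptensor_power 2 \<Longrightarrow> cmod (f x) \<le> K * norm x"
    using dual_space_bounded[OF f'] by blast
  have "(\<lambda>a. f (tensor [a, 1])) \<in> dual_space UNIV"
  proof (rule dual_spaceI[where K = K])
    show "cmod (f (tensor [a, 1])) \<le> K * norm a" for a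
      using order_trans[OF K(2)[OF tensor_in_power_length] mult_left_mono[OF norm_tensor_le K(1)], of "[a, 1]"] by simp
  qed (use dual_space_tensor_linear[OF f', of "[]" "[1]"] in simp_all)
  moreover have c: "f (tensor [b, a]) + f (tensor [a, b]) = f (tensor [a * b, 1])" for a b
    using coboundary_1_tensor[OF fc, of a b 1] f by (simp add: cocycles_def algebra_simps)
  have "f (tensor [a * b, 1]) = f (tensor [b * a, 1])" for a b
    unfolding c[symmetric] by simp
  moreover have "f (tensor [1, 1]) = 0" using c[of 1 1] by simp
  ultimately show ?thesis by (simp add: traces_def)
qed

lemma coboundary_evaluation:
  fixes f :: "'a::{complex_banach_algebra, real_normed_algebra_1} ptensor \<Rightarrow> complex"
  assumes "f \<in> coboundaries 1" shows "f (tensor [a, 1]) = 0"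
proof -
  obtain g where "g \<in> cochains 0" "f = coboundary 0 g" using assms by auto
  then show ?thesis using coboundary_0_tensor[of g a 1] by simp
qed

lemma trivial_trace_coboundary:
  fixes f :: "'v::complex_normed_vector tensor_algebra ptensor \<Rightarrow> complex"
  assumes f: "f \<in> cocycles 1" and 0: "\<And>a. f (tensor [a, 1]) = 0"
  shows "f \<in> coboundaries 1"
proof -
  have fc: "f \<in> cochains (Suc 0)" using f by (simp add: cocycles_def)
  obtain g where g: "g \<in> cochains 0"
    "\<forall>ws. length ws = 2 \<longrightarrow> coboundary 0 g (tensor (map word ws)) = boundary (primitive (on_words 2 f)) ws"
    using primitive_cochain[OF fc, unfolded add_0] by (rule bexE)
  have "f = coboundary 0 g"
  proof (rule word_functional_eqI[OF fc])
    show "coboundary 0 g \<in> cochains (Suc 0)"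
      using coboundary_in_dual_space[OF g(1)] by (simp add: cochains_def)
    fix ws :: "'v list list" assume "length ws = Suc 0 + 1"
    then obtain a z where ws: "ws = [a, z]" by (auto simp: length_Suc_conv)
    have "boundary (on_words 2 f) xs = 0" if "length xs = 3" for xs
      using cocycle_on_words[OF f, of xs] that by (simp add: numeral_2_eq_2)
    \<comment> \<open>All terms of the correction are values of \<open>f\<close> at tensors of the
      form \<open>tensor [b, 1]\<close>, which vanish by hypothesis.\<close>
    from boundary_primitive_pair[of "on_words 2 f" a z, OF this]
    have "boundary (primitive (on_words 2 f)) [a, z] = on_words 2 f [a, z]"
      using 0 by (simp add: on_words_def word_Nil)
    then show "f (tensor (map word ws)) = coboundary 0 g (tensor (map word ws))"
      using g(2)[rule_format, of ws] by (simp add: ws on_words_def)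
  qed
  with g(1) show ?thesis unfolding One_nat_def coboundaries.simps by (intro image_eqI[of f _ g])
qed

lemma trace_realized:
  fixes \<tau> :: "'v::complex_normed_vector tensor_algebra \<Rightarrow> complex"
  assumes \<tau>: "\<tau> \<in> traces" and 1: "\<tau> 1 = 0"
  shows "\<exists>f\<in>cocycles 1. (\<lambda>a. f (tensor [a, 1])) = \<tau> \<and>
    (\<forall>x\<in>ptensor_power (1 + 1). cmod (f x) \<le> dual_norm UNIV \<tau> * norm x)"
proof -
  have d: "\<tau> \<in> dual_space UNIV" using \<tau> by (simp add: traces_def)
  obtain f where f: "f \<in> dual_space (ptensor_power 2)" "\<And>x. x \<in> ptensor_power 2 \<Longrightarrow> cmod (f x) \<le> dual_norm UNIV \<tau> * norm x"
    "\<And>ws. length ws = 2 \<Longrightarrow> f (tensor (map word ws)) = weighted_trace \<tau> ws"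
    using word_form_functional[OF word_form_weighted_trace[OF d], of 2] by blast
  have fc: "f \<in> cochains 1" using f(1) by (simp add: cochains_def numeral_2_eq_2)
  have "on_words 2 f = weighted_trace \<tau>"
    using f(3) by (auto simp: on_words_def weighted_trace_def)
  then have "boundary (on_words 2 f) ws = 0" if "length ws = 3" for ws
    using that boundary_weighted_trace[OF \<tau>] by (auto simp: length_Suc_conv numeral_3_eq_3)
  then have "coboundary 1 f (tensor (map word ws)) = 0" if "length ws = 3" for ws
    using coboundary_on_words[OF fc, of ws] that by (simp add: numeral_2_eq_2)
  then have "coboundary 1 f = (\<lambda>_. 0)"
    using coboundary_in_dual_space[OF fc] zero_cochain[of 2]
    by (intro word_functional_eqI[of _ 2]) (auto simp: cochains_def numeral_3_eq_3)
  then have fz: "f \<in> cocycles 1" using fc by (simp add: cocycles_def)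
  have "(\<lambda>a. f (tensor [a, 1])) \<in> dual_space UNIV"
    using trace_evaluation[OF fz] by (simp add: traces_def)
  then have "(\<lambda>a. f (tensor [a, 1])) = \<tau>"
  proof (intro word_functional_unique)
    fix w
    \<comment> \<open>The weight of \<open>[w, []]\<close> is 1 unless \<open>w\<close> is empty;
      there it is 0, in agreement with \<open>\<tau> 1 = 0\<close>.\<close>
    show "f (tensor [word w, 1]) = \<tau> (word w)"
      using f(3)[of "[w, []]"] 1 by (cases w) (simp_all add: weighted_trace_def word_Nil del: of_nat_Suc)
  qed (use d in \<open>simp_all add: dual_space_def\<close>)
  with fz f(2) show ?thesis by (intro bexI[of _ f]) (simp_all add: numeral_2_eq_2)
qed

lemma cohomology_iso_1:
  "\<exists>\<Theta>. cohomology_iso 1 {\<tau> \<in> traces. \<tau> (1 :: 'v::complex_normed_vector tensor_algebra) = 0} \<Theta> \<and>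
     (\<forall>f\<in>cocycles 1. \<Theta> (cohomology_class 1 f) = (\<lambda>a. f (tensor [a, 1])))"
proof (rule cohomology_iso_evaluation)
  show "tensor [a, 1] \<in> ptensor_power (1 + 1)" for a :: "'v tensor_algebra"
    by (rule tensor_in_power_length) simp
  show "norm (tensor [a, 1]) \<le> norm a" for a :: "'v tensor_algebra"
    using norm_tensor_le[of "[a, 1]"] by simp
  show "{\<tau> \<in> traces. \<tau> (1 :: 'v tensor_algebra) = 0} \<subseteq> dual_space UNIV" by (auto simp: traces_def)
  show "f (tensor [a, 1]) = 0" if "f \<in> coboundaries 1" for f and a :: "'v tensor_algebra"
    by (rule coboundary_evaluation[OF that])
  show "(\<lambda>a. f (tensor [a, 1])) \<in> {\<tau> \<in> traces. \<tau> 1 = 0}" if "f \<in> cocycles 1"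
    for f :: "'v tensor_algebra ptensor \<Rightarrow> complex"
    by (rule trace_evaluation[OF that])
  show "\<exists>f\<in>cocycles 1. (\<lambda>a. f (tensor [a, 1])) = \<tau> \<and>
      (\<forall>x\<in>ptensor_power (1 + 1). cmod (f x) \<le> dual_norm UNIV \<tau> * norm x)"
    if "\<tau> \<in> {\<tau> \<in> traces. \<tau> 1 = 0}" for \<tau> :: "'v tensor_algebra \<Rightarrow> complex"
    by (rule trace_realized) (use that in simp_all)
  show "f \<in> coboundaries 1" if "f \<in> cocycles 1" "\<And>a. f (tensor [a, 1]) = 0"
    for f :: "'v tensor_algebra ptensor \<Rightarrow> complex"
    by (rule trivial_trace_coboundary[OF that])
qed

lemma simplicial_cohomology_trivial:
  assumes "n \<ge> 2"
  shows "simplicial_cohomology TYPE('v::complex_normed_vector tensor_algebra) n = {cohomology_class n (\<lambda>_. 0)}"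
proof -
  have "cohomology_class n f = cohomology_class n (\<lambda>_. 0)" if "f \<in> cocycles n"
    for f :: "'v tensor_algebra ptensor \<Rightarrow> complex"
    by (rule cohomology_class_eqI) (use cocycle_is_coboundary[OF that assms] in simp)
  then show ?thesis
    unfolding simplicial_cohomology_def using zero_cocycle[of n] by force
qed

theorem theorem7p4:
  shows "(\<forall>n\<ge>2. simplicial_cohomology TYPE('v::complex_banach tensor_algebra) n
             = {cohomology_class n (\<lambda>_. 0)}) \<and>
         (\<exists>\<Theta>. cohomology_iso 0 (traces :: ('v tensor_algebra \<Rightarrow> complex) set) \<Theta> \<and>
            (\<forall>f\<in>cocycles 0. \<Theta> (cohomology_class 0 f) = (\<lambda>a. f (tensor [a])))) \<and>
         (\<exists>\<Theta>. cohomology_iso 1 {\<tau> \<in> traces. \<tau> (1 :: 'v tensor_algebra) = 0} \<Theta>)"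
proof (intro conjI allI impI)
  show "\<exists>\<Theta>. cohomology_iso 1 {\<tau> \<in> traces. \<tau> (1 :: 'v tensor_algebra) = 0} \<Theta>"
    using cohomology_iso_1[where 'v = 'v] by blast
qed (rule simplicial_cohomology_trivial cohomology_iso_0; assumption)+

end
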